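(* Let $n\geq 3$, let $q\in\mathbb{K}^*$ and let $L=L_n^q$. Suppose that $q$ is not a root of unity. If $n$ is odd then the prime ideals of $L$ are $0$ and, for each $\lambda\in\mathbb{K}$, $P_\lambda:=(z_n-\lambda)L$. If $n$ is even then the prime ideals of $L$ are $0$, $z_nL$ and, for each $\lambda\in\mathbb{K}^*$, $P'_\lambda:=(z_{n-1}-\lambda)L+z_nL$.
   Context: $\mathbb{K}$ is an algebraically closed field, $\mathbb{K}^*=\mathbb{K}\setminus\{0\}$. $L_n^q$ is the $\mathbb{K}$-algebra generated by $x_1,\dots,x_n$ subject to the relations: $x_ix_{i+1}-qx_{i+1}x_i=1-q$ for $1\leq i\leq n-1$; $x_ix_j=qx_jx_i$ for $1\leq i$, $i+1<j\leq n$, $j-i$ odd; $x_ix_j=q^{-1}x_jx_i$ for $1\leq i$, $i+1<j\leq n$, $j-i$ even. In $L_n^q$ define $z_{-1}=0$, $z_0=1$ and $z_i=z_{i-1}x_i-z_{i-2}$ for $1\leq i\leq n$. *)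

theory Defs
  imports "HOL-Algebra.QuotRing" "HOL-Algebra.Ideal_Product" "HOL-Computational_Algebra.Polynomial"
begin

text \<open>The free associative unital algebra over a field in noncommuting indeterminates
  \<open>X\<^sub>1, \<dots>, X\<^sub>n\<close>. A word is a list over \<open>{1..n}\<close>, and an element is the function sending
  each word to its coefficient; the product is convolution along concatenation of words.\<close>

definition free_alg :: "nat \<Rightarrow> (nat list \<Rightarrow> 'k::field) ring" where
  "free_alg n =
    \<lparr>carrier = {f. finite {w. f w \<noteq> 0} \<and> (\<forall>w. f w \<noteq> 0 \<longrightarrow> set w \<subseteq> {1..n})},
     monoid.mult = (\<lambda>f g w. \<Sum>i\<le>length w. f (take i w) * g (drop i w)),
     one = (\<lambda>w. if w = [] then 1 else 0),
     ring.zero = (\<lambda>w. 0),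
     add = (\<lambda>f g w. f w + g w)\<rparr>"

definition free_var :: "nat \<Rightarrow> (nat list \<Rightarrow> 'k::field)" where
  "free_var i = (\<lambda>w. if w = [i] then 1 else 0)"

definition free_const :: "'k::field \<Rightarrow> (nat list \<Rightarrow> 'k)" where
  "free_const c = (\<lambda>w. if w = [] then c else 0)"

text \<open>A relation \<open>u = v\<close> is encoded by the element \<open>u - v\<close>.\<close>

definition L_rels :: "nat \<Rightarrow> 'k::field \<Rightarrow> (nat list \<Rightarrow> 'k) set" where
  "L_rels n q = (let F = free_alg n; X = free_var; c = free_const in
     {(X i \<otimes>\<^bsub>F\<^esub> X (i + 1) \<ominus>\<^bsub>F\<^esub> c q \<otimes>\<^bsub>F\<^esub> (X (i + 1) \<otimes>\<^bsub>F\<^esub> X i)) \<ominus>\<^bsub>F\<^esub> c (1 - q) | i.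
        1 \<le> i \<and> i \<le> n - 1} \<union>
     {X i \<otimes>\<^bsub>F\<^esub> X j \<ominus>\<^bsub>F\<^esub> c q \<otimes>\<^bsub>F\<^esub> (X j \<otimes>\<^bsub>F\<^esub> X i) | i j.
        1 \<le> i \<and> i + 1 < j \<and> j \<le> n \<and> odd (j - i)} \<union>
     {X i \<otimes>\<^bsub>F\<^esub> X j \<ominus>\<^bsub>F\<^esub> c (inverse q) \<otimes>\<^bsub>F\<^esub> (X j \<otimes>\<^bsub>F\<^esub> X i) | i j.
        1 \<le> i \<and> i + 1 < j \<and> j \<le> n \<and> even (j - i)})"

definition L_ideal :: "nat \<Rightarrow> 'k::field \<Rightarrow> (nat list \<Rightarrow> 'k) set" where
  "L_ideal n q = Idl\<^bsub>free_alg n\<^esub> (L_rels n q)"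

definition L_alg :: "nat \<Rightarrow> 'k::field \<Rightarrow> (nat list \<Rightarrow> 'k) set ring" where
  "L_alg n q = free_alg n Quot L_ideal n q"

definition L_var :: "nat \<Rightarrow> 'k::field \<Rightarrow> nat \<Rightarrow> (nat list \<Rightarrow> 'k) set" where
  "L_var n q i = L_ideal n q +>\<^bsub>free_alg n\<^esub> free_var i"

definition L_const :: "nat \<Rightarrow> 'k::field \<Rightarrow> 'k \<Rightarrow> (nat list \<Rightarrow> 'k) set" where
  "L_const n q c = L_ideal n q +>\<^bsub>free_alg n\<^esub> free_const c"

text \<open>The convention \<open>z\<^sub>-\<^sub>1 = 0\<close> enters only through the clause for index \<open>1\<close>.\<close>

fun L_z :: "nat \<Rightarrow> 'k::field \<Rightarrow> nat \<Rightarrow> (nat list \<Rightarrow> 'k) set" where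
  "L_z n q 0 = \<one>\<^bsub>L_alg n q\<^esub>"
| "L_z n q (Suc 0) = L_z n q 0 \<otimes>\<^bsub>L_alg n q\<^esub> L_var n q (Suc 0) \<ominus>\<^bsub>L_alg n q\<^esub> \<zero>\<^bsub>L_alg n q\<^esub>"
| "L_z n q (Suc (Suc i)) =
     L_z n q (Suc i) \<otimes>\<^bsub>L_alg n q\<^esub> L_var n q (Suc (Suc i)) \<ominus>\<^bsub>L_alg n q\<^esub> L_z n q i"

text \<open>Prime ideals of a not necessarily commutative ring; the library's \<^locale>\<open>primeideal\<close>
  requires commutativity.\<close>

definition nc_prime_ideal :: "'a set \<Rightarrow> ('a, 'b) ring_scheme \<Rightarrow> bool" where
  "nc_prime_ideal P R \<longleftrightarrow> ideal P R \<and> P \<noteq> carrier R \<and>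
     (\<forall>I J. ideal I R \<longrightarrow> ideal J R \<longrightarrow> ideal_prod R I J \<subseteq> P \<longrightarrow> I \<subseteq> P \<or> J \<subseteq> P)"

text \<open>\<^const>\<open>genideal\<close> and \<^const>\<open>FactRing\<close> only have their intended meaning over
  a ring and a two-sided ideal, which the following facts confirm.\<close>

lemma free_alg_mult_assoc:
  fixes f g h :: "nat list \<Rightarrow> 'k::field"
  shows "(f \<otimes>\<^bsub>free_alg n\<^esub> g) \<otimes>\<^bsub>free_alg n\<^esub> h = f \<otimes>\<^bsub>free_alg n\<^esub> (g \<otimes>\<^bsub>free_alg n\<^esub> h)"
proof
  fix w :: "nat list"
  let ?N = "length w"
  have "((f \<otimes>\<^bsub>free_alg n\<^esub> g) \<otimes>\<^bsub>free_alg n\<^esub> h) w =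
      (\<Sum>i\<le>?N. \<Sum>j\<le>i. f (take j w) * g (take (i - j) (drop j w)) * h (drop i w))"
    by (auto simp: free_alg_def sum_distrib_right drop_take min_def intro!: sum.cong)
  also have "\<dots> = (\<Sum>(i, j)\<in>(SIGMA i:{..?N}. {..i}).
      f (take j w) * g (take (i - j) (drop j w)) * h (drop i w))"
    by (simp add: sum.Sigma)
  also have "\<dots> = (\<Sum>(j, k)\<in>(SIGMA j:{..?N}. {..?N - j}).
      f (take j w) * (g (take k (drop j w)) * h (drop k (drop j w))))"
    by (rule sum.reindex_bij_witness[where i = "\<lambda>(j, k). (j + k, j)" and j = "\<lambda>(i, j). (j, i - j)"])
      (auto simp: mult.assoc)
  also have "\<dots> = (f \<otimes>\<^bsub>free_alg n\<^esub> (g \<otimes>\<^bsub>free_alg n\<^esub> h)) w"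
    by (simp add: free_alg_def sum_distrib_left sum.Sigma)
  finally show "((f \<otimes>\<^bsub>free_alg n\<^esub> g) \<otimes>\<^bsub>free_alg n\<^esub> h) w =
      (f \<otimes>\<^bsub>free_alg n\<^esub> (g \<otimes>\<^bsub>free_alg n\<^esub> h)) w" .
qed

lemma free_alg_mult_closed:
  fixes f g :: "nat list \<Rightarrow> 'k::field"
  assumes f: "f \<in> carrier (free_alg n)" and g: "g \<in> carrier (free_alg n)"
  shows "f \<otimes>\<^bsub>free_alg n\<^esub> g \<in> carrier (free_alg n)"
proof -
  let ?h = "f \<otimes>\<^bsub>free_alg n\<^esub> g"
  have ex: "\<exists>i. f (take i w) \<noteq> 0 \<and> g (drop i w) \<noteq> 0" if "?h w \<noteq> 0" for w
  proof (rule ccontr)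
    assume "\<not> ?thesis"
    then have "?h w = 0"
      by (auto simp: free_alg_def intro!: sum.neutral)
    with that show False by contradiction
  qed
  have "{w. ?h w \<noteq> 0} \<subseteq> (\<lambda>(u, v). u @ v) ` ({w. f w \<noteq> 0} \<times> {w. g w \<noteq> 0})"
  proof
    fix w assume "w \<in> {w. ?h w \<noteq> 0}"
    then obtain i where "f (take i w) \<noteq> 0" "g (drop i w) \<noteq> 0"
      using ex by blast
    then show "w \<in> (\<lambda>(u, v). u @ v) ` ({w. f w \<noteq> 0} \<times> {w. g w \<noteq> 0})"
      by (intro image_eqI[where x = "(take i w, drop i w)"]) auto
  qed
  then have "finite {w. ?h w \<noteq> 0}"
    by (rule finite_subset) (use f g in \<open>simp add: free_alg_def\<close>)
  moreover have "set w \<subseteq> {1..n}" if h: "?h w \<noteq> 0" for w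
  proof -
    obtain i where i: "f (take i w) \<noteq> 0" "g (drop i w) \<noteq> 0"
      using ex[OF h] by blast
    have "set (take i w) \<subseteq> {1..n}" "set (drop i w) \<subseteq> {1..n}"
      using f g i by (simp_all add: free_alg_def)
    then show ?thesis
      by (metis append_take_drop_id set_append Un_subset_iff)
  qed
  ultimately show ?thesis
    unfolding free_alg_def by simp
qed

lemma free_alg_add_closed:
  fixes f g :: "nat list \<Rightarrow> 'k::field"
  assumes "f \<in> carrier (free_alg n)" "g \<in> carrier (free_alg n)"
  shows "f \<oplus>\<^bsub>free_alg n\<^esub> g \<in> carrier (free_alg n)"
proof -
  have "{w. f w + g w \<noteq> 0} \<subseteq> {w. f w \<noteq> 0} \<union> {w. g w \<noteq> 0}" by auto
  then have "finite {w. f w + g w \<noteq> 0}"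
    by (rule finite_subset) (use assms in \<open>simp add: free_alg_def\<close>)
  moreover have "set w \<subseteq> {1..n}" if "f w + g w \<noteq> 0" for w
    using assms that by (cases "f w = 0") (auto simp: free_alg_def)
  ultimately show ?thesis
    by (simp add: free_alg_def)
qed

lemma ring_free_alg: "ring (free_alg n :: (nat list \<Rightarrow> 'k::field) ring)"
proof (rule ringI)
  show "abelian_group (free_alg n :: (nat list \<Rightarrow> 'k) ring)"
  proof (rule abelian_groupI)
    fix f :: "nat list \<Rightarrow> 'k" assume "f \<in> carrier (free_alg n)"
    then show "\<exists>g\<in>carrier (free_alg n). g \<oplus>\<^bsub>free_alg n\<^esub> f = \<zero>\<^bsub>free_alg n\<^esub>"
      by (intro bexI[where x = "\<lambda>w. - f w"]) (auto simp: free_alg_def)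
  next
    fix f g :: "nat list \<Rightarrow> 'k"
    assume "f \<in> carrier (free_alg n)" "g \<in> carrier (free_alg n)"
    then show "f \<oplus>\<^bsub>free_alg n\<^esub> g \<in> carrier (free_alg n)"
      by (rule free_alg_add_closed)
  qed (auto simp: free_alg_def add_ac)
  show "monoid (free_alg n :: (nat list \<Rightarrow> 'k) ring)"
  proof (rule monoidI)
    fix f g :: "nat list \<Rightarrow> 'k"
    assume "f \<in> carrier (free_alg n)" "g \<in> carrier (free_alg n)"
    then show "f \<otimes>\<^bsub>free_alg n\<^esub> g \<in> carrier (free_alg n)"
      by (rule free_alg_mult_closed)
  next
    show "\<one>\<^bsub>free_alg n\<^esub> \<in> carrier (free_alg n :: (nat list \<Rightarrow> 'k) ring)"
      by (auto simp: free_alg_def)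
  next
    fix f :: "nat list \<Rightarrow> 'k"
    have "(\<Sum>i\<le>length w. (if take i w = [] then 1 else 0) * f (drop i w)) = f w" for w
    proof -
      have "(\<Sum>i\<le>length w. (if take i w = [] then 1 else 0) * f (drop i w))
          = (\<Sum>i\<in>{0}. f (drop i w))"
        by (rule sum.mono_neutral_cong_right) (auto simp: take_eq_Nil)
      then show ?thesis by simp
    qed
    then show "\<one>\<^bsub>free_alg n\<^esub> \<otimes>\<^bsub>free_alg n\<^esub> f = f"
      by (simp add: free_alg_def)
  next
    fix f :: "nat list \<Rightarrow> 'k"
    have "(\<Sum>i\<le>length w. f (take i w) * (if drop i w = [] then 1 else 0)) = f w" for w
    proof -
      have "(\<Sum>i\<le>length w. f (take i w) * (if drop i w = [] then 1 else 0))
          = (\<Sum>i\<in>{length w}. f (take i w))"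
        by (rule sum.mono_neutral_cong_right) auto
      then show ?thesis by simp
    qed
    then show "f \<otimes>\<^bsub>free_alg n\<^esub> \<one>\<^bsub>free_alg n\<^esub> = f"
      by (simp add: free_alg_def)
  qed (rule free_alg_mult_assoc)
qed (simp_all add: free_alg_def sum.distrib ring_distribs)

lemma free_const_closed: "free_const c \<in> carrier (free_alg n)"
  by (auto simp: free_alg_def free_const_def)

lemma free_var_closed: "1 \<le> i \<Longrightarrow> i \<le> n \<Longrightarrow> free_var i \<in> carrier (free_alg n)"
  by (auto simp: free_alg_def free_var_def)

lemma L_rels_closed: "L_rels n q \<subseteq> carrier (free_alg n)"
proof -
  interpret F: ring "free_alg n :: (nat list \<Rightarrow> 'a) ring" by (rule ring_free_alg)
  have var: "free_var i \<in> carrier (free_alg n)" if "1 \<le> i" "i \<le> n" for i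
    using that by (rule free_var_closed)
  show ?thesis
    unfolding L_rels_def Let_def
    by (auto intro!: F.minus_closed F.m_closed free_const_closed var)
qed

lemma ideal_L_ideal: "ideal (L_ideal n q) (free_alg n)"
  unfolding L_ideal_def by (rule ring.genideal_ideal[OF ring_free_alg L_rels_closed])

lemma ring_L_alg: "ring (L_alg n q)"
  unfolding L_alg_def by (rule ideal.quotient_is_ring[OF ideal_L_ideal])

end

theory Submission
  imports Defs "HOL-Library.Poly_Mapping"
begin

text \<open>Since \<open>z\<^sub>i\<^sub>-\<^sub>1 x\<^sub>i = z\<^sub>i + z\<^sub>i\<^sub>-\<^sub>2\<close>, the algebra \<open>L\<^sub>n\<close> embeds into the quantum torus in
  \<open>z\<^sub>1, \<dots>, z\<^sub>n\<close>, where \<open>z\<^sub>i z\<^sub>j = q z\<^sub>j z\<^sub>i\<close> for \<open>i < j\<close> with \<open>i\<close> odd and \<open>j\<close> even, and all other pairs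
  commute; injectivity follows from comparing the leading exponents of the sorted words in the
  \<open>x\<^sub>i\<close>. Clearing denominators, a nonzero ideal contains a nonzero polynomial in the \<open>z\<^sub>i\<close>, and by
  \<open>q\<close>-commutators with the \<open>z\<^sub>j\<close> even a monomial in \<open>z\<^sub>1, \<dots>, z\<^sub>n\<^sub>-\<^sub>1\<close> times \<open>p(z\<^sub>n)\<close>, where \<open>p\<close> is a power if
  \<open>n\<close> is even. Commutators with the \<open>x\<^sub>j\<close> remove the monomial, so the ideal contains \<open>p(z\<^sub>n)\<close>. Thus
  a nonzero prime contains some \<open>z\<^sub>n - c\<close>, with \<open>c = 0\<close> if \<open>n\<close> is even. As \<open>(z\<^sub>n - c) L\<^sub>n\<close> is
  the kernel of the specialisation \<open>z\<^sub>n = c\<close> of the torus, it is completely prime, and the same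
  argument applied to the specialised polynomials in \<open>z\<^sub>1, \<dots>, z\<^sub>n\<^sub>-\<^sub>1\<close> describes the ideals above it.\<close>

text \<open>The rings that carry the argument are the \<open>Tp m\<close>: they contain
  \<open>L m\<close> and invert only \<open>z 1\<close>, ..., \<open>z (m - 1)\<close>, because
  \<open>x i\<close> has the single denominator \<open>z (i - 1)\<close>. So \<open>z m\<close> can
  be set to any constant, even to 0, and division by \<open>z m - sc c\<close> leaves a remainder in
  a domain. The main obstacle is to identify the kernel on \<open>L m\<close>: a quotient taken in
  \<open>Tp m\<close> has to be shown to lie in \<open>L m\<close> (\<open>u_saturated\<close>).
  Parity enters because an odd \<open>z m\<close> commutes with everything built from
  \<open>z 1\<close>, ..., \<open>z m\<close>, whereas an even one does so only up to powers of
  \<open>q\<close>. For odd \<open>n\<close> a polynomial in \<open>z n\<close> can thus be split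
  into linear factors by primeness. For even \<open>n\<close> only a power of \<open>z n\<close>
  survives, and \<open>z (n - 1)\<close> becomes central once \<open>z n\<close> is factored out;
  there the constant 0 is excluded since \<open>z (n - 1)\<close> generates the unit ideal.\<close>

section \<open>Linear operators\<close>

text \<open>The quantum torus is realised inside the ring of linear operators on functions of exponents:
  its twisted product depends on the parameter \<open>q\<close> and therefore cannot be a type class
  instance, whereas composition of operators can.\<close>

typedef (overloaded) ('g, 'k) lin_op =
  "{f :: ('g \<Rightarrow> 'k::field) \<Rightarrow> ('g \<Rightarrow> 'k).
     (\<forall>u v. f (\<lambda>c. u c + v c) = (\<lambda>c. f u c + f v c)) \<and> (\<forall>k u. f (\<lambda>c. k * u c) = (\<lambda>c. k * f u c))}"
  morphisms app Abs_lin_op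
  by (rule exI[where x = "\<lambda>v. v"]) simp

setup_lifting type_definition_lin_op

instantiation lin_op :: (type, field) ring_1
begin

lift_definition zero_lin_op :: "('a, 'b) lin_op" is "\<lambda>v c. 0" by simp
lift_definition one_lin_op :: "('a, 'b) lin_op" is "\<lambda>v. v" by simp
lift_definition plus_lin_op :: "('a, 'b) lin_op \<Rightarrow> ('a, 'b) lin_op \<Rightarrow> ('a, 'b) lin_op"
  is "\<lambda>f g v c. f v c + g v c" by (auto simp: algebra_simps)
lift_definition minus_lin_op :: "('a, 'b) lin_op \<Rightarrow> ('a, 'b) lin_op \<Rightarrow> ('a, 'b) lin_op"
  is "\<lambda>f g v c. f v c - g v c" by (auto simp: algebra_simps)
lift_definition uminus_lin_op :: "('a, 'b) lin_op \<Rightarrow> ('a, 'b) lin_op"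
  is "\<lambda>f v c. - f v c" by auto
lift_definition times_lin_op :: "('a, 'b) lin_op \<Rightarrow> ('a, 'b) lin_op \<Rightarrow> ('a, 'b) lin_op"
  is "\<lambda>f g v. f (g v)" by auto

instance
proof
  show "(0 :: ('a, 'b) lin_op) \<noteq> 1"
    by transfer (metis zero_neq_one)
  show "x * (y + z) = x * y + x * z" for x y z :: "('a, 'b) lin_op"
    by transfer (auto simp: fun_eq_iff)
qed (transfer; auto simp: fun_eq_iff algebra_simps)+

end

lift_definition sc :: "'k::field \<Rightarrow> ('g, 'k) lin_op" is "\<lambda>k v c. k * v c"
  by (auto simp: algebra_simps)

lemma sc_0 [simp]: "sc 0 = 0" and sc_1 [simp]: "sc 1 = 1"
  by (transfer; simp)+

lemma sc_add: "sc (a + b) = sc a + sc b" and sc_diff: "sc (a - b) = sc a - sc b"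
  and sc_minus: "sc (- a) = - sc a" and sc_mult: "sc (a * b) = sc a * sc b"
  by (transfer; auto simp: fun_eq_iff algebra_simps)+

lemma sc_mult_assoc: "sc a * (sc b * t) = sc (a * b) * t"
  by (simp add: sc_mult mult.assoc)

lemma sc_comm: "t * sc a = sc a * t"
  by transfer (auto simp: fun_eq_iff)

lemma sc_left_commute: "t * (sc a * s) = sc a * (t * s)"
  by (simp only: mult.assoc[symmetric] sc_comm[of t a])

lemma app_0 [simp]: "app 0 v = (\<lambda>c. 0)" by (simp add: zero_lin_op.rep_eq)
lemma app_add: "app (s + t) v c = app s v c + app t v c" by (simp add: plus_lin_op.rep_eq)
lemma app_diff: "app (s - t) v c = app s v c - app t v c" by (simp add: minus_lin_op.rep_eq)
lemma app_mult: "app (s * t) v = app s (app t v)" by (simp add: times_lin_op.rep_eq)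
lemma app_sc: "app (sc k) v c = k * v c" by (simp add: sc.rep_eq)
lemma app_sum: "app (sum f A) v c = (\<Sum>a\<in>A. app (f a) v c)"
  by (induction A rule: infinite_finite_induct) (auto simp: app_add)

section \<open>Exponents\<close>

text \<open>The exponent of \<open>z\<^sub>i\<close> is stored at position \<open>- i\<close>, so that the lexicographic order of
  \<^typ>\<open>int \<Rightarrow>\<^sub>0 int\<close> compares the exponent of the last variable first. The variable \<open>z\<^sub>0\<close> is \<open>1\<close>.\<close>

type_synonym expo = "int \<Rightarrow>\<^sub>0 int"

definition expt :: "expo \<Rightarrow> nat \<Rightarrow> int" where
  "expt a i = Poly_Mapping.lookup a (- int i)"

definition e :: "nat \<Rightarrow> expo" where
  "e i = (if i = 0 then 0 else Poly_Mapping.single (- int i) 1)"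

lemma expt_simps [simp]: "expt 0 i = 0" "expt (a + b) i = expt a i + expt b i"
  "expt (a - b) i = expt a i - expt b i" "expt (- a) i = - expt a i"
  by (simp_all add: expt_def lookup_add lookup_minus)

lemma expt_e: "expt (e j) i = (if i = j \<and> 0 < j then 1 else 0)"
  by (auto simp: expt_def e_def lookup_single when_def)

lemma e_0 [simp]: "e 0 = 0"
  by (simp add: e_def)

text \<open>This choice makes \<open>E a\<close> the product of the powers of the variables in
  increasing order of index: moving an even variable to the right past an earlier odd one costs a
  factor \<open>inverse q\<close>. Indices are negated here, so the earlier variable has the larger
  position.\<close>

definition twist_sign :: "int \<Rightarrow> int \<Rightarrow> int" where
  "twist_sign j i = (if even j \<and> odd i \<and> j < i \<and> i < 0 then - 1 else 0)"

definition twist :: "expo \<Rightarrow> expo \<Rightarrow> int" where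
  "twist a b = (\<Sum>j\<in>Poly_Mapping.keys a. \<Sum>i\<in>Poly_Mapping.keys b.
     Poly_Mapping.lookup a j * Poly_Mapping.lookup b i * twist_sign j i)"

text \<open>A common index set turns bilinearity into a computation with sums, although keys may
  cancel in \<open>a + b\<close>.\<close>

lemma twist_superset:
  assumes "finite J" "finite I" "Poly_Mapping.keys a \<subseteq> J" "Poly_Mapping.keys b \<subseteq> I"
  shows "twist a b = (\<Sum>j\<in>J. \<Sum>i\<in>I. Poly_Mapping.lookup a j * Poly_Mapping.lookup b i * twist_sign j i)"
proof -
  have "twist a b = (\<Sum>j\<in>Poly_Mapping.keys a. \<Sum>i\<in>I.
      Poly_Mapping.lookup a j * Poly_Mapping.lookup b i * twist_sign j i)"
    unfolding twist_def using assms
    by (intro sum.cong refl sum.mono_neutral_left) (auto simp: in_keys_iff)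
  also have "\<dots> = (\<Sum>j\<in>J. \<Sum>i\<in>I. Poly_Mapping.lookup a j * Poly_Mapping.lookup b i * twist_sign j i)"
    using assms by (intro sum.mono_neutral_left) (auto simp: in_keys_iff)
  finally show ?thesis .
qed

lemma twist_add_left: "twist (a + b) c = twist a c + twist b c"
proof -
  let ?J = "Poly_Mapping.keys a \<union> Poly_Mapping.keys b" and ?I = "Poly_Mapping.keys c"
  have "Poly_Mapping.keys (a + b) \<subseteq> ?J" by (rule keys_add)
  then show ?thesis
    by (simp add: twist_superset[of ?J ?I] lookup_add sum.distrib ring_distribs)
qed

lemma twist_add_right: "twist c (a + b) = twist c a + twist c b"
proof -
  let ?J = "Poly_Mapping.keys a \<union> Poly_Mapping.keys b" and ?I = "Poly_Mapping.keys c"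
  have "Poly_Mapping.keys (a + b) \<subseteq> ?J" by (rule keys_add)
  then show ?thesis
    by (simp add: twist_superset[of ?I ?J] lookup_add sum.distrib ring_distribs)
qed

lemma twist_0 [simp]: "twist 0 a = 0" "twist a 0 = 0"
  by (simp_all add: twist_def)

lemma twist_uminus: "twist (- a) b = - twist a b" "twist a (- b) = - twist a b"
  using twist_add_left[of a "- a" b] twist_add_right[of a b "- b"] by simp_all

lemma twist_diff: "twist (a - b) c = twist a c - twist b c" "twist c (a - b) = twist c a - twist c b"
  using twist_add_left[of "a - b" b c] twist_add_right[of c "a - b" b] by simp_all

text \<open>The alternating form of the torus: by \<open>E_comm\<close> it is the exponent of
  \<open>q\<close> by which \<open>E a\<close> and \<open>E b\<close> fail to commute.\<close>

definition comm_exp :: "expo \<Rightarrow> expo \<Rightarrow> int" where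
  "comm_exp a b = twist a b - twist b a"

lemma comm_exp_simps: "comm_exp 0 a = 0" "comm_exp a 0 = 0" "comm_exp (a + b) c = comm_exp a c + comm_exp b c" "comm_exp c (a + b) = comm_exp c a + comm_exp c b"
  "comm_exp (a - b) c = comm_exp a c - comm_exp b c" "comm_exp c (a - b) = comm_exp c a - comm_exp c b"
  "comm_exp (- a) c = - comm_exp a c" "comm_exp c (- a) = - comm_exp c a"
  by (simp_all add: comm_exp_def twist_add_left twist_add_right twist_diff twist_uminus)

lemma comm_exp_swap: "comm_exp a b = - comm_exp b a"
  by (simp add: comm_exp_def)

lemma comm_exp_self [simp]: "comm_exp a a = 0"
  by (simp add: comm_exp_def)

lemma twist_single:
  "twist a (Poly_Mapping.single i 1) = (\<Sum>j\<in>Poly_Mapping.keys a. Poly_Mapping.lookup a j * twist_sign j i)"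
  "twist (Poly_Mapping.single i 1) a = (\<Sum>j\<in>Poly_Mapping.keys a. Poly_Mapping.lookup a j * twist_sign i j)"
  by (simp_all add: twist_def)

lemma comm_exp_single: "comm_exp a (Poly_Mapping.single i 1) =
  (\<Sum>j\<in>Poly_Mapping.keys a. Poly_Mapping.lookup a j * (twist_sign j i - twist_sign i j))"
  by (simp add: comm_exp_def twist_single sum_subtractf ring_distribs)

lemma comm_exp_e: "comm_exp a (e r) =
  (\<Sum>j\<in>Poly_Mapping.keys a. Poly_Mapping.lookup a j *
     (if r = 0 then 0 else twist_sign j (- int r) - twist_sign (- int r) j))"
  by (auto simp: e_def comm_exp_simps comm_exp_single)

lemma twist_sign_step:
  assumes "0 < r"
  shows "(twist_sign j (- int (Suc r)) - twist_sign (- int (Suc r)) j) -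
    (if r = 1 then 0 else twist_sign j (- int (r - 1)) - twist_sign (- int (r - 1)) j)
    = (if j = - int r then 1 else 0)"
proof -
  have "int (r - 1) = int r - 1" using assms by simp
  then show ?thesis
    using assms unfolding twist_sign_def by simp presburger
qed

text \<open>Two consecutive variables of the same parity differ, as far as commutation is concerned, only
  by the variable between them.\<close>

lemma comm_exp_e_step:
  assumes "0 < r"
  shows "comm_exp a (e (Suc r)) - comm_exp a (e (r - 1)) = expt a r"
proof -
  have "comm_exp a (e (Suc r)) - comm_exp a (e (r - 1)) =
     (\<Sum>j\<in>Poly_Mapping.keys a. Poly_Mapping.lookup a j * (if j = - int r then 1 else 0))"
    unfolding comm_exp_e sum_subtractf[symmetric]
    by (intro sum.cong refl, subst twist_sign_step[OF assms, symmetric])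
       (use assms in \<open>auto simp: algebra_simps\<close>)
  also have "\<dots> = (\<Sum>j\<in>Poly_Mapping.keys a. if j = - int r then Poly_Mapping.lookup a j else 0)"
    by (intro sum.cong) auto
  also have "\<dots> = expt a r"
    by (auto simp: expt_def in_keys_iff)
  finally show ?thesis .
qed

definition upto_ex :: "nat \<Rightarrow> expo set" where
  "upto_ex m = {a. Poly_Mapping.keys a \<subseteq> {- int m..-1}}"

text \<open>An odd variable fails to commute only with later even ones, and \<open>a\<close>
  contains nothing later. The case \<open>r = m\<close> yields central elements;
  \<open>r = Suc m\<close> closes the recursion of \<open>comm_exp_e_step\<close> at the
  top.\<close>

lemma comm_exp_e_odd_top:
  assumes "a \<in> upto_ex m" "odd r" "m \<le> r"
  shows "comm_exp a (e r) = 0"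
proof -
  have "twist_sign j (- int r) - twist_sign (- int r) j = 0" if "j \<in> Poly_Mapping.keys a" for j
    using that assms by (auto simp: upto_ex_def twist_sign_def)
  then show ?thesis by (auto simp: comm_exp_e intro!: sum.neutral)
qed

lemma comm_exp_e_e:
  assumes "i < j"
  shows "comm_exp (e i) (e j) = (if odd i \<and> even j then 1 else 0)"
  using assms by (auto simp: e_def comm_exp_simps comm_exp_def twist_single twist_sign_def)

lemma upto_ex_ex: "a \<in> upto_ex m \<Longrightarrow> m < i \<Longrightarrow> expt a i = 0"
  by (force simp: upto_ex_def expt_def in_keys_iff)

lemma upto_ex_mono: "m \<le> k \<Longrightarrow> upto_ex m \<subseteq> upto_ex k"
  by (auto simp: upto_ex_def)

lemma upto_ex_eqI:
  assumes "a \<in> upto_ex m" "b \<in> upto_ex m" "\<And>i. 1 \<le> i \<Longrightarrow> i \<le> m \<Longrightarrow> expt a i = expt b i"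
  shows "a = b"
proof (rule poly_mapping_eqI)
  fix k
  show "Poly_Mapping.lookup a k = Poly_Mapping.lookup b k"
  proof (cases "k \<in> {- int m..-1}")
    case True
    then have "k = - int (nat (- k))" "1 \<le> nat (- k)" "nat (- k) \<le> m" by auto
    then show ?thesis using assms(3)[of "nat (- k)"] by (simp add: expt_def)
  next
    case False
    then have "k \<notin> Poly_Mapping.keys a" "k \<notin> Poly_Mapping.keys b"
      using assms(1,2) by (auto simp: upto_ex_def)
    then show ?thesis by (simp add: in_keys_iff)
  qed
qed

lemma upto_ex_add: "a \<in> upto_ex m \<Longrightarrow> b \<in> upto_ex m \<Longrightarrow> a + b \<in> upto_ex m"
  using keys_add[of a b] by (auto simp: upto_ex_def)

lemma upto_ex_uminus: "a \<in> upto_ex m \<Longrightarrow> - a \<in> upto_ex m"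
  by (simp add: upto_ex_def)

lemma upto_ex_diff: "a \<in> upto_ex m \<Longrightarrow> b \<in> upto_ex m \<Longrightarrow> a - b \<in> upto_ex m"
  using upto_ex_add[of a m "- b"] upto_ex_uminus by simp

lemma upto_ex_0 [simp]: "0 \<in> upto_ex m"
  by (simp add: upto_ex_def)

lemma upto_ex_e: "i \<le> m \<Longrightarrow> e i \<in> upto_ex m"
  by (auto simp: upto_ex_def e_def)

lemma e_pos: "0 < m \<Longrightarrow> 0 < e m"
  by (auto simp: e_def less_poly_mapping.rep_eq less_fun_def lookup_single when_def)

section \<open>The quantum torus\<close>

locale qtorus =
  fixes q :: "'k::field"
  assumes q_nz: "q \<noteq> 0"
begin

abbreviation qp :: "int \<Rightarrow> 'k" where "qp k \<equiv> q powi k"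

lemma qp_add: "qp (a + b) = qp a * qp b" and qp_nz: "qp a \<noteq> 0"
  using q_nz by (simp_all add: power_int_add)

text \<open>The left regular representation of the twisted group algebra: the basis vector at
  \<open>b\<close> goes to \<open>qp (twist a b)\<close> times the basis vector at
  \<open>a + b\<close>, here with \<open>b = c - a\<close>.\<close>

definition E :: "expo \<Rightarrow> (expo, 'k) lin_op" where
  "E a = Abs_lin_op (\<lambda>v c. qp (twist a (c - a)) * v (c - a))"

lemma app_E: "app (E a) v c = qp (twist a (c - a)) * v (c - a)"
  unfolding E_def by (subst Abs_lin_op_inverse) (auto simp: algebra_simps)

lemma E_mult: "E a * E b = sc (qp (twist a b)) * E (a + b)"
proof -
  have "app (E a * E b) v c = app (sc (qp (twist a b)) * E (a + b)) v c" for v c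
  proof -
    have "twist a (c - a) + twist b (c - a - b) = twist a b + twist (a + b) (c - (a + b))"
      by (simp add: twist_diff twist_add_left twist_add_right)
    then have "qp (twist a (c - a)) * qp (twist b (c - a - b)) = qp (twist a b) * qp (twist (a + b) (c - (a + b)))"
      by (simp only: qp_add[symmetric])
    moreover have "c - (a + b) = c - a - b" by simp
    ultimately show ?thesis by (simp only: app_mult app_E app_sc mult.assoc[symmetric])
  qed
  then have "app (E a * E b) = app (sc (qp (twist a b)) * E (a + b))" by (intro ext)
  then show ?thesis by (simp add: app_inject)
qed

lemma monomial_mult: "sc k * E a * (sc l * E b) = sc (k * l * qp (twist a b)) * E (a + b)"
proof -
  have "sc k * E a * (sc l * E b) = sc k * (sc l * (E a * E b))"
    by (simp only: mult.assoc sc_left_commute[of "E a"])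
  also have "\<dots> = sc (k * l * qp (twist a b)) * E (a + b)"
    by (simp only: E_mult sc_mult_assoc mult.assoc)
  finally show ?thesis .
qed

lemma E_0 [simp]: "E 0 = 1"
proof -
  have "app (E 0) v c = app 1 v c" for v c
    by (simp add: app_E one_lin_op.rep_eq)
  then have "app (E 0) = app 1" by (intro ext)
  then show ?thesis by (simp add: app_inject)
qed

lemma E_comm: "E a * E b = sc (qp (comm_exp a b)) * (E b * E a)"
  by (simp add: E_mult sc_mult_assoc comm_exp_def add.commute flip: qp_add)

text \<open>\<open>E a\<close> sends the basis vector at 0 to the basis vector at \<open>a\<close>,
  so applying a combination of monomials to that vector reads off its coefficients.\<close>

definition coef :: "(expo, 'k) lin_op \<Rightarrow> expo \<Rightarrow> 'k" where
  "coef t = app t (\<lambda>c. if c = 0 then 1 else 0)"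

lemma coef_simps: "coef 0 c = 0" "coef (s + t) c = coef s c + coef t c" "coef (s - t) c = coef s c - coef t c"
  "coef (sc k * t) c = k * coef t c" "coef (E a) c = (if c = a then 1 else 0)"
  by (auto simp: coef_def app_add app_diff app_mult app_sc app_E)

lemma coef_sum: "coef (sum f A) c = (\<Sum>a\<in>A. coef (f a) c)"
  by (simp add: coef_def app_sum)

inductive_set mspan :: "expo set \<Rightarrow> (expo, 'k) lin_op set" for A where
  mspan_0: "0 \<in> mspan A"
| mspan_step: "a \<in> A \<Longrightarrow> t \<in> mspan A \<Longrightarrow> sc k * E a + t \<in> mspan A"

lemma mspan_add: "s \<in> mspan A \<Longrightarrow> t \<in> mspan A \<Longrightarrow> s + t \<in> mspan A"
  by (induction s rule: mspan.induct) (auto simp: add.assoc intro: mspan.intros)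

lemma mspan_E: "a \<in> A \<Longrightarrow> E a \<in> mspan A"
  using mspan_step[OF _ mspan_0, of a A 1] by simp

lemma mspan_sc: "t \<in> mspan A \<Longrightarrow> sc k * t \<in> mspan A"
  by (induction t rule: mspan.induct) (auto simp: distrib_left sc_mult_assoc intro: mspan.intros)

lemma mspan_minus: "t \<in> mspan A \<Longrightarrow> - t \<in> mspan A"
  using mspan_sc[of t A "- 1"] by (simp add: sc_minus)

lemma mspan_diff: "s \<in> mspan A \<Longrightarrow> t \<in> mspan A \<Longrightarrow> s - t \<in> mspan A"
  using mspan_add[of s A "- t"] mspan_minus by simp

lemma mspan_mono: "A \<subseteq> B \<Longrightarrow> mspan A \<subseteq> mspan B"
proof
  fix t assume "A \<subseteq> B"
  assume "t \<in> mspan A"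
  then show "t \<in> mspan B" using \<open>A \<subseteq> B\<close> by (induction t rule: mspan.induct) (auto intro: mspan.intros)
qed

lemma mspan_mult:
  assumes "s \<in> mspan A" "t \<in> mspan B" "\<And>a b. a \<in> A \<Longrightarrow> b \<in> B \<Longrightarrow> a + b \<in> C"
  shows "s * t \<in> mspan C"
  using assms(1)
proof (induction s rule: mspan.induct)
  case (mspan_step a s k)
  have "E a * t \<in> mspan C"
    using assms(2)
  proof (induction t rule: mspan.induct)
    case (mspan_step b t l)
    have "E a * (sc l * E b + t) = sc (l * qp (twist a b)) * E (a + b) + E a * t"
      by (simp add: distrib_left sc_left_commute[of "E a"] E_mult sc_mult_assoc)
    then show ?case using mspan.mspan_step assms(3) mspan_step \<open>a \<in> A\<close> by metis
  qed (auto intro: mspan_0)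
  then have "sc k * (E a * t) + s * t \<in> mspan C"
    using mspan_step by (intro mspan_add mspan_sc)
  then show ?case by (simp add: algebra_simps)
qed (auto intro: mspan_0)

definition supp :: "(expo, 'k) lin_op \<Rightarrow> expo set" where
  "supp t = {c. coef t c \<noteq> 0}"

lemma supp_mspan: "t \<in> mspan A \<Longrightarrow> finite (supp t) \<and> supp t \<subseteq> A"
proof (induction t rule: mspan.induct)
  case (mspan_step a t k)
  have "supp (sc k * E a + t) \<subseteq> insert a (supp t)"
    by (auto simp: supp_def coef_simps split: if_splits)
  then show ?case using mspan_step by (meson finite.insertI finite_subset insert_subset subset_trans)
qed (simp add: supp_def coef_simps)

lemma mspan_expand:
  assumes "t \<in> mspan A"
  shows "t = (\<Sum>a\<in>supp t. sc (coef t a) * E a)"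
proof -
  \<comment> \<open>Stated for every finite superset of the support, since adding a term can cancel
    another one and shrink the support.\<close>
  have "\<forall>S. finite S \<longrightarrow> supp t \<subseteq> S \<longrightarrow> t = (\<Sum>a\<in>S. sc (coef t a) * E a)"
    using assms
  proof (induction t rule: mspan.induct)
    case mspan_0
    show ?case by (auto simp: coef_simps)
  next
    case (mspan_step a t k)
    show ?case
    proof (intro allI impI)
      fix S assume S: "finite S" "supp (sc k * E a + t) \<subseteq> S"
      let ?t = "sc k * E a + t"
      let ?S = "insert a (S \<union> supp t)"
      have fin: "finite ?S" using S supp_mspan mspan_step by blast
      have "(\<Sum>c\<in>S. sc (coef ?t c) * E c) = (\<Sum>c\<in>?S. sc (coef ?t c) * E c)"
      proof (rule sum.mono_neutral_left)
        show "\<forall>c\<in>?S - S. sc (coef ?t c) * E c = 0"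
          using S(2) by (metis (mono_tags, lifting) Diff_iff mem_Collect_eq mult_zero_left sc_0 subsetD supp_def)
      qed (use fin in auto)
      also have "\<dots> = (\<Sum>c\<in>?S. (if c = a then sc k * E a else 0)) + (\<Sum>c\<in>?S. sc (coef t c) * E c)"
        by (subst sum.distrib[symmetric], intro sum.cong)
           (auto simp: coef_simps sc_add algebra_simps)
      also have "(\<Sum>c\<in>?S. sc (coef t c) * E c) = t"
        using mspan_step fin by (metis Un_upper2 subset_insertI2)
      also have "(\<Sum>c\<in>?S. (if c = a then sc k * E a else 0)) = sc k * E a"
        using fin by (subst sum.delta) auto
      finally show "?t = (\<Sum>c\<in>S. sc (coef ?t c) * E c)" by simp
    qed
  qed
  then show ?thesis using supp_mspan[OF assms] by blast
qed

lemma mspan_eq_0_iff: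
  assumes "t \<in> mspan A"
  shows "t = 0 \<longleftrightarrow> supp t = {}"
proof
  show "supp t = {}" if "t = 0" using that by (simp add: supp_def coef_simps)
  show "t = 0" if "supp t = {}" using mspan_expand[OF assms] that by simp
qed

abbreviation "T \<equiv> mspan UNIV"

lemma mspan_in_T: "t \<in> mspan A \<Longrightarrow> t \<in> T"
  using mspan_mono[of A UNIV] by auto

definition lead :: "(expo, 'k) lin_op \<Rightarrow> expo" where
  "lead t = Max (supp t)"

lemma coef_mult:
  assumes "s \<in> T" "t \<in> T"
  shows "coef (s * t) c =
    (\<Sum>a\<in>supp s. \<Sum>b\<in>supp t. if a + b = c then coef s a * coef t b * qp (twist a b) else 0)"
proof -
  have "s * t = (\<Sum>a\<in>supp s. sc (coef s a) * E a) * (\<Sum>b\<in>supp t. sc (coef t b) * E b)"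
    by (simp only: mspan_expand[OF assms(1), symmetric] mspan_expand[OF assms(2), symmetric])
  also have "\<dots> = (\<Sum>a\<in>supp s. \<Sum>b\<in>supp t. sc (coef s a * coef t b * qp (twist a b)) * E (a + b))"
    unfolding sum_product monomial_mult ..
  finally have eq: "s * t = \<dots>" .
  show ?thesis
    by (subst eq) (auto simp: coef_sum coef_simps intro!: sum.cong)
qed

lemma lead_in_supp: "t \<in> T \<Longrightarrow> t \<noteq> 0 \<Longrightarrow> lead t \<in> supp t"
  using mspan_eq_0_iff supp_mspan unfolding lead_def by (metis Max_in)

lemma lead_eqI: "t \<in> T \<Longrightarrow> c \<in> supp t \<Longrightarrow> (\<And>a. a \<in> supp t \<Longrightarrow> a \<le> c) \<Longrightarrow> lead t = c"
  using supp_mspan unfolding lead_def by (meson Max_eqI)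

lemma lead_ge: "t \<in> T \<Longrightarrow> a \<in> supp t \<Longrightarrow> a \<le> lead t"
  using supp_mspan unfolding lead_def by (simp add: Max_ge)

text \<open>The order on exponents is compatible with addition, so only the two leading terms meet
  at \<open>lead s + lead t\<close>, and they meet with a power of \<open>q\<close>, which is
  nonzero. Hence the torus is a domain.\<close>

lemma lead_mult:
  assumes s: "s \<in> T" "s \<noteq> 0" and t: "t \<in> T" "t \<noteq> 0"
  shows "s * t \<noteq> 0" and "lead (s * t) = lead s + lead t"
proof -
  have fin: "finite (supp s)" "finite (supp t)" using s t supp_mspan by auto
  have st: "s * t \<in> T" using s t by (intro mspan_mult) auto
  have eq: "a = lead s \<and> b = lead t" if "a \<in> supp s" "b \<in> supp t" "a + b = lead s + lead t" for a b
    using lead_ge[OF s(1) that(1)] lead_ge[OF t(1) that(2)] that(3)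
    by (metis add_le_less_mono add_less_le_mono less_irrefl order_le_less)
  have "coef (s * t) (lead s + lead t) =
     (\<Sum>a\<in>supp s. \<Sum>b\<in>supp t. if a = lead s \<and> b = lead t then coef s a * coef t b * qp (twist a b) else 0)"
    unfolding coef_mult[OF s(1) t(1)] using eq by (intro sum.cong refl) auto
  also have "\<dots> = (\<Sum>a\<in>supp s. if a = lead s then coef s a * coef t (lead t) * qp (twist a (lead t)) else 0)"
    using fin lead_in_supp[OF t] by (intro sum.cong refl) (auto simp: sum.delta)
  also have "\<dots> = coef s (lead s) * coef t (lead t) * qp (twist (lead s) (lead t))"
    using fin lead_in_supp[OF s] by (simp add: sum.delta)
  also have "\<dots> \<noteq> 0"
    using lead_in_supp[OF s] lead_in_supp[OF t] qp_nz by (simp add: supp_def)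
  finally have nz: "lead s + lead t \<in> supp (s * t)" by (simp add: supp_def)
  then show "s * t \<noteq> 0" by (auto simp: supp_def coef_simps)
  show "lead (s * t) = lead s + lead t"
  proof (rule lead_eqI[OF st nz])
    fix c assume "c \<in> supp (s * t)"
    then have "(\<Sum>a\<in>supp s. \<Sum>b\<in>supp t. if a + b = c then coef s a * coef t b * qp (twist a b) else 0) \<noteq> 0"
      by (simp add: supp_def coef_mult[OF s(1) t(1)])
    then obtain a b where a: "a \<in> supp s" "b \<in> supp t" "a + b = c"
      by (auto elim!: sum.not_neutral_contains_not_neutral split: if_splits)
    then show "c \<le> lead s + lead t" using lead_ge[OF s(1)] lead_ge[OF t(1)] by (auto intro: add_mono)
  qed
qed

lemma T_no_zero_div: "s \<in> T \<Longrightarrow> t \<in> T \<Longrightarrow> s * t = 0 \<Longrightarrow> s = 0 \<or> t = 0"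
  using lead_mult(1) by blast

lemma E_nz: "E a \<noteq> 0"
  using coef_simps(1,5) by (metis zero_neq_one)

end

section \<open>Cones of exponents and the clearing of negative exponents\<close>

lemma twist_e_e [simp]: "twist (e i) (e i) = 0"
  by (simp add: twist_def e_def twist_sign_def)

lemma comm_exp_e_e': "j < i \<Longrightarrow> comm_exp (e i) (e j) = (if odd j \<and> even i then - 1 else 0)"
  using comm_exp_e_e[of j i] by (simp add: comm_exp_swap[of "e i"])

definition nn_ex :: "nat \<Rightarrow> expo set" where
  "nn_ex m = {a \<in> upto_ex m. \<forall>i. 0 \<le> expt a i}"

text \<open>The monomials of \<open>x m\<close> are of this kind, and setting the last variable to a
  constant makes sense exactly when it is not inverted.\<close>

definition top_nn_ex :: "nat \<Rightarrow> expo set" where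
  "top_nn_ex m = {a \<in> upto_ex m. 0 \<le> expt a m}"

lemma upto_ex_shrink:
  assumes "a \<in> upto_ex m" "\<And>j. i < j \<Longrightarrow> j \<le> m \<Longrightarrow> expt a j = 0"
  shows "a \<in> upto_ex i"
  unfolding upto_ex_def
proof (intro CollectI subsetI)
  fix k assume k: "k \<in> Poly_Mapping.keys a"
  then have "k \<in> {- int m..-1}" using assms(1) by (auto simp: upto_ex_def)
  moreover have "\<not> i < nat (- k)"
  proof
    assume "i < nat (- k)"
    then have "expt a (nat (- k)) = 0" using assms(2) \<open>k \<in> {- int m..-1}\<close> by auto
    then show False using k \<open>k \<in> {- int m..-1}\<close> by (auto simp: expt_def in_keys_iff)
  qed
  ultimately show "k \<in> {- int i..-1}" by auto
qed

lemma upto_ex_1_0: "expt a 0 = 0" if "a \<in> upto_ex m"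
  using that by (force simp: upto_ex_def expt_def in_keys_iff)

lemma nn_ex_add: "a \<in> nn_ex m \<Longrightarrow> b \<in> nn_ex m \<Longrightarrow> a + b \<in> nn_ex m"
  by (simp add: nn_ex_def upto_ex_add)

lemma nn_ex_mono: "m \<le> k \<Longrightarrow> nn_ex m \<subseteq> nn_ex k"
  using upto_ex_mono by (auto simp: nn_ex_def)

lemma nn_ex_e: "i \<le> m \<Longrightarrow> e i \<in> nn_ex m"
  by (simp add: nn_ex_def upto_ex_e expt_e)

lemma nn_ex_0: "0 \<in> nn_ex m"
  by (simp add: nn_ex_def)

lemma nn_ex_top: "nn_ex m \<subseteq> top_nn_ex m"
  by (auto simp: nn_ex_def top_nn_ex_def)

lemma upto_top: "upto_ex m \<subseteq> top_nn_ex (Suc m)"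
  using upto_ex_mono[of m "Suc m"] upto_ex_ex[of _ m "Suc m"] by (auto simp: top_nn_ex_def)

lemma top_nn_ex_add: "a \<in> top_nn_ex m \<Longrightarrow> b \<in> top_nn_ex m \<Longrightarrow> a + b \<in> top_nn_ex m"
  by (simp add: top_nn_ex_def upto_ex_add)

text \<open>A factor of largest index is split off, so that \<open>e i\<close> is added to an
  exponent without later variables; \<open>reduce_monomial\<close> depends on this order.\<close>

lemma nn_ex_induct [consumes 1, case_names zero add]:
  assumes "a \<in> nn_ex m"
    and zero: "P 0"
    and step: "\<And>a i. 1 \<le> i \<Longrightarrow> i \<le> m \<Longrightarrow> a \<in> nn_ex i \<Longrightarrow> P a \<Longrightarrow> P (a + e i)"
  shows "P a"
  using assms(1)
proof (induction "\<Sum>j=1..m. nat (expt a j)" arbitrary: a)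
  case 0
  then have "expt a j = 0" if "1 \<le> j" "j \<le> m" for j
    using that by (auto simp: nn_ex_def intro: order_antisym)
  then have "a = 0"
    using 0 by (intro upto_ex_eqI[of a m 0]) (auto simp: nn_ex_def)
  then show ?case using zero by simp
next
  case (Suc k)
  define i where "i = Max {j \<in> {1..m}. 0 < expt a j}"
  have "\<exists>j\<in>{1..m}. 0 < expt a j"
  proof (rule ccontr)
    assume "\<not> ?thesis"
    then have "(\<Sum>j=1..m. nat (expt a j)) = 0" by (intro sum.neutral) auto
    with Suc(2) show False by simp
  qed
  then have "i \<in> {j \<in> {1..m}. 0 < expt a j}"
    unfolding i_def by (intro Max_in) auto
  then have i: "1 \<le> i" "i \<le> m" "0 < expt a i" by auto
  have above: "expt a j = 0" if "i < j" "j \<le> m" for j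
  proof (rule ccontr)
    assume "expt a j \<noteq> 0"
    then have "0 < expt a j" using Suc(3) by (simp add: nn_ex_def order_less_le)
    then have "j \<le> i" unfolding i_def using that by (intro Max_ge) auto
    then show False using that by simp
  qed
  let ?a = "a - e i"
  have "a \<in> upto_ex i" using upto_ex_shrink[of a m i] above Suc(3) by (auto simp: nn_ex_def)
  then have ai: "?a \<in> nn_ex i"
    using Suc(3) i by (auto simp: nn_ex_def expt_e intro!: upto_ex_diff upto_ex_e)
  have "(\<Sum>j=1..m. nat (expt a j)) = (\<Sum>j=1..m. nat (expt ?a j) + (if j = i then 1 else 0))"
    using i by (intro sum.cong) (auto simp: expt_e)
  also have "\<dots> = (\<Sum>j=1..m. nat (expt ?a j)) + 1"
    using i by (simp add: sum.distrib)
  finally have "k = (\<Sum>j=1..m. nat (expt ?a j))" using Suc(2) by simp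
  moreover have "?a \<in> nn_ex m" using ai nn_ex_mono i by blast
  ultimately have "P ?a" using Suc(1) by blast
  then have "P (?a + e i)" using step i ai by blast
  then show ?case by simp
qed

lemma clear_exponents:
  assumes "a \<in> top_nn_ex m"
  shows "\<exists>b\<in>nn_ex (m - 1). a + b \<in> nn_ex m"
proof -
  \<comment> \<open>The negative part of \<open>a\<close>. It does not involve the last variable,
    whose exponent is nonnegative.\<close>
  define b where "b = Poly_Mapping.map (\<lambda>v. max 0 (- v)) a"
  have expt_b: "expt b i = max 0 (- expt a i)" for i
    by (auto simp: expt_def b_def Poly_Mapping.map.rep_eq when_def)
  have "Poly_Mapping.keys b \<subseteq> Poly_Mapping.keys a"
    by (auto simp: b_def Poly_Mapping.map.rep_eq in_keys_iff when_def)
  then have bm: "b \<in> upto_ex m"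
    using assms by (auto simp: upto_ex_def top_nn_ex_def)
  have "b \<in> upto_ex (m - 1)"
  proof (rule upto_ex_shrink[OF bm])
    fix j assume "m - 1 < j" "j \<le> m"
    then have "j = m" by simp
    then show "expt b j = 0" using assms by (simp add: expt_b top_nn_ex_def)
  qed
  then have "b \<in> nn_ex (m - 1)" by (auto simp: nn_ex_def expt_b)
  moreover have "a + b \<in> nn_ex m"
    using assms bm by (auto simp: nn_ex_def top_nn_ex_def expt_b upto_ex_add)
  ultimately show ?thesis by blast
qed

section \<open>The generators inside the torus and their relations\<close>

context qtorus
begin

lemma E_comm2: "E a * (E b * E c) = sc (qp (comm_exp a (b + c))) * (E b * E c * E a)"
proof -
  have "E a * (E b * E c) = sc (qp (twist b c)) * (E a * E (b + c))"
    by (simp only: E_mult[of b c] sc_left_commute[of "E a"])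
  also have "\<dots> = sc (qp (comm_exp a (b + c))) * (sc (qp (twist b c)) * (E (b + c) * E a))"
    by (simp only: E_comm[of a "b + c"] sc_mult_assoc mult.commute)
  also have "\<dots> = sc (qp (comm_exp a (b + c))) * (E b * E c * E a)"
    by (simp only: E_mult[of b c] mult.assoc)
  finally show ?thesis .
qed

lemma E2_comm: "E a * E b * (E c * E d) = sc (qp (comm_exp (a + b) (c + d))) * (E c * E d * (E a * E b))"
proof -
  have "qp (twist (a + b) (c + d)) = qp (comm_exp (a + b) (c + d)) * qp (twist (c + d) (a + b))"
    by (simp add: comm_exp_def flip: qp_add)
  then have "qp (twist a b) * qp (twist c d) * qp (twist (a + b) (c + d)) =
      qp (comm_exp (a + b) (c + d)) * (qp (twist c d) * qp (twist a b) * qp (twist (c + d) (a + b)))"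
    by (simp add: mult_ac)
  then show ?thesis
    by (simp only: E_mult[of a b] E_mult[of c d] monomial_mult sc_mult_assoc add.commute[of "c + d"])
qed

definition z :: "nat \<Rightarrow> (expo, 'k) lin_op" where
  "z i = E (e i)"

text \<open>The recursion of the \<open>z i\<close> solved for \<open>x i\<close>. For
  \<open>i \<le> 1\<close> the missing summand is the convention that the variable of index -1 is
  0.\<close>

definition x :: "nat \<Rightarrow> (expo, 'k) lin_op" where
  "x i = E (- e (i - 1)) * (z i + (if i \<le> 1 then 0 else z (i - 2)))"

lemma z_0 [simp]: "z 0 = 1"
  by (simp add: z_def)

lemma E_inverse: "E (- e i) * E (e i) = 1" "E (e i) * E (- e i) = 1"
  by (simp_all add: E_mult twist_uminus)

lemma z_Suc: "z (Suc r) = z r * x (Suc r) - (if r = 0 then 0 else z (r - 1))"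
proof -
  have "z r * x (Suc r) = z r * E (- e r) * (z (Suc r) + (if r = 0 then 0 else z (r - 1)))"
    by (auto simp: x_def mult.assoc)
  also have "z r * E (- e r) = 1" by (simp add: z_def E_inverse)
  finally show ?thesis by simp
qed

text \<open>The two terms of \<open>x (Suc r)\<close> pass \<open>E a\<close> with powers of
  \<open>q\<close> whose exponents differ by \<open>expt a r\<close>
  (\<open>comm_exp_e_step\<close>). Taking out the power of the first term leaves an error from the
  \<open>z (r - 1)\<close> term, which vanishes when \<open>z r\<close> does not occur in
  \<open>a\<close>.\<close>

lemma E_x:
  "E a * x (Suc r) = sc (qp (comm_exp a (e (Suc r) - e r))) * (x (Suc r) * E a) +
     (if r = 0 then 0 else sc (qp (comm_exp a (e (Suc r) - e r)) * (qp (- expt a r) - 1)) *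
       (E (- e r) * E (e (r - 1)) * E a))"
proof (cases "r = 0")
  case True
  then show ?thesis
    using E_comm[of a "e 1"] by (simp add: x_def z_def)
next
  case False
  let ?s = "comm_exp a (e (Suc r) - e r)"
  have s: "comm_exp a (- e r + e (Suc r)) = ?s" "comm_exp a (- e r + e (r - 1)) = ?s - expt a r"
    using comm_exp_e_step[of r a] False by (simp_all add: comm_exp_simps)
  have "E a * x (Suc r) = E a * (E (- e r) * E (e (Suc r))) + E a * (E (- e r) * E (e (r - 1)))"
    using False by (simp add: x_def z_def distrib_left)
  also have "\<dots> = sc (qp ?s) * (E (- e r) * E (e (Suc r)) * E a) +
     sc (qp ?s * qp (- expt a r)) * (E (- e r) * E (e (r - 1)) * E a)"
    unfolding E_comm2 s qp_add[symmetric] by simp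
  also have "\<dots> = sc (qp ?s) * (x (Suc r) * E a) +
     sc (qp ?s * (qp (- expt a r) - 1)) * (E (- e r) * E (e (r - 1)) * E a)"
    using False by (simp add: x_def z_def distrib_left distrib_right right_diff_distrib' sc_diff left_diff_distrib)
  finally show ?thesis using False by simp
qed

lemma E_x_comm:
  assumes "1 \<le> i" "i = 1 \<or> expt a (i - 1) = 0"
  shows "E a * x i = sc (qp (comm_exp a (e i - e (i - 1)))) * (x i * E a)"
proof -
  obtain r where r: "i = Suc r" using assms by (cases i) auto
  show ?thesis using assms unfolding r by (subst E_x) auto
qed

text \<open>Conjugation by \<open>z (i - 1)\<close> multiplies each term of the recursion by a power
  of \<open>q\<close>, so the recursion also holds with the factors in the opposite order, up to
  nonzero scalars.\<close>

lemma x_z_below: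
  assumes "2 \<le> i"
  shows "\<exists>k l. k \<noteq> 0 \<and> l \<noteq> 0 \<and> x i * z (i - 1) = sc k * z i + sc l * z (i - 2)"
proof -
  have "E (- e (i - 1)) * E (e j) * E (e (i - 1)) = sc (qp (comm_exp (e j) (e (i - 1)))) * E (e j)" for j
  proof -
    have "E (- e (i - 1)) * E (e j) * E (e (i - 1)) =
        E (- e (i - 1)) * (sc (qp (comm_exp (e j) (e (i - 1)))) * (E (e (i - 1)) * E (e j)))"
      by (simp only: mult.assoc E_comm[of "e j"])
    also have "\<dots> = sc (qp (comm_exp (e j) (e (i - 1)))) * (E (- e (i - 1)) * E (e (i - 1)) * E (e j))"
      by (simp only: sc_left_commute[of "E _"] mult.assoc)
    finally show ?thesis by (simp add: E_inverse)
  qed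
  then have "x i * z (i - 1) = sc (qp (comm_exp (e i) (e (i - 1)))) * z i + sc (qp (comm_exp (e (i - 2)) (e (i - 1)))) * z (i - 2)"
    using assms by (simp add: x_def z_def distrib_left distrib_right)
  then show ?thesis using qp_nz by blast
qed

lemma x_eq_monomials:
  assumes "1 \<le> i"
  shows "x i = sc (qp (twist (- e (i - 1)) (e i))) * E (e i - e (i - 1)) +
    (if i = 1 then 0 else sc (qp (twist (- e (i - 1)) (e (i - 2)))) * E (e (i - 2) - e (i - 1)))"
  using assms by (auto simp: x_def z_def distrib_left E_mult)

text \<open>Both monomials of \<open>x j\<close> pass \<open>x i\<close> with the same power of
  \<open>q\<close>: by \<open>comm_exp_e_step\<close> a difference could only come from
  \<open>z (j - 1)\<close> in a monomial of \<open>x i\<close>, or from \<open>z (i - 1)\<close> in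
  one of \<open>x j\<close>, and neither occurs.\<close>

lemma x_rel_far:
  assumes "1 \<le> i" "i + 1 < j"
  shows "x i * x j = sc (if odd (j - i) then q else inverse q) * (x j * x i)"
proof -
  have c1: "comm_exp (e j - e (j - 1)) (e i - e (i - 1)) = (if odd (j - i) then - 1 else 1)"
    using assms by (auto simp: comm_exp_simps comm_exp_e_e')
  have c2: "comm_exp (e (j - 2) - e (j - 1)) (e i - e (i - 1)) = comm_exp (e j - e (j - 1)) (e i - e (i - 1))"
  proof -
    have "Suc (j - 1) = j" "j - 1 - 1 = j - 2" using assms by auto
    then have "comm_exp (e i - e (i - 1)) (e j) - comm_exp (e i - e (i - 1)) (e (j - 2)) = expt (e i - e (i - 1)) (j - 1)"
      using comm_exp_e_step[of "j - 1" "e i - e (i - 1)"] assms by simp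
    also have "\<dots> = 0"
    proof -
      have "j - 1 \<noteq> i" "j - 1 \<noteq> i - 1" using assms by arith+
      then show ?thesis by (simp add: expt_e)
    qed
    finally show ?thesis
      by (subst (1 2) comm_exp_swap) (simp add: comm_exp_simps)
  qed
  let ?s = "comm_exp (e j - e (j - 1)) (e i - e (i - 1))"
  have m1: "E (e j - e (j - 1)) * x i = sc (qp ?s) * (x i * E (e j - e (j - 1)))"
    using assms by (intro E_x_comm) (auto simp: expt_e)
  have m2: "E (e (j - 2) - e (j - 1)) * x i = sc (qp ?s) * (x i * E (e (j - 2) - e (j - 1)))"
    unfolding c2[symmetric] using assms by (intro E_x_comm) (auto simp: expt_e)
  have "x j * x i = sc (qp ?s) * (x i * x j)"
    using assms by (simp add: x_eq_monomials[of j] distrib_left distrib_right mult.assoc m1 m2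
        sc_left_commute[of "x i"] sc_mult_assoc mult.commute del: One_nat_def)
  then have "sc (qp (- ?s)) * (x j * x i) = x i * x j"
    by (simp add: sc_mult_assoc qp_add[symmetric])
  moreover have "qp (- ?s) = (if odd (j - i) then q else inverse q)"
    unfolding c1 by (simp only: power_int_minus power_int_1_right minus_minus if_split) simp
  ultimately show ?thesis by simp
qed

text \<open>Split into monomials, \<open>x i = A + B\<close> and \<open>x (i + 1) = C + D\<close>.
  Moving \<open>C\<close> past \<open>x i\<close>, or \<open>D\<close> past \<open>B\<close>, costs
  the factor \<open>q\<close>, so these contributions cancel. \<open>A\<close> and \<open>D\<close>
  are inverse to each other and leave the constant.\<close>

lemma x_rel_near:
  assumes "1 \<le> i"
  shows "x i * x (i + 1) - sc q * (x (i + 1) * x i) = sc (1 - q)"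
proof -
  define C where "C = E (- e i) * E (e (i + 1))"
  define D where "D = E (- e i) * E (e (i - 1))"
  define A where "A = E (- e (i - 1)) * E (e i)"
  define B where "B = (if i = 1 then 0 else E (- e (i - 1)) * E (e (i - 2)))"
  have xi: "x i = A + B" and xj: "x (i + 1) = C + D"
    using assms by (auto simp: x_def z_def A_def B_def C_def D_def distrib_left)
  have "C * x i = sc (qp (- 1)) * (x i * C)"
  proof -
    have "C = sc (qp (twist (- e i) (e (i + 1)))) * E (e (i + 1) - e i)"
      by (simp add: C_def E_mult)
    moreover have "E (e (i + 1) - e i) * x i = sc (qp (- 1)) * (x i * E (e (i + 1) - e i))"
    proof -
      have "comm_exp (e (i + 1) - e i) (e i - e (i - 1)) = - 1"
        using assms by (auto simp: comm_exp_simps comm_exp_e_e')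
      moreover have "i - 1 \<noteq> i + 1" "i - 1 \<noteq> i" using assms by arith+
      ultimately show ?thesis using E_x_comm[of i "e (i + 1) - e i"] assms by (simp add: expt_e)
    qed
    ultimately show ?thesis by (simp add: mult.assoc sc_left_commute[of "x i"] sc_mult_assoc mult.commute)
  qed
  then have xC: "x i * C = sc q * (C * x i)"
    using q_nz by (simp add: sc_mult_assoc power_int_minus)
  have AD: "A * D = 1"
  proof -
    have "A * D = E (- e (i - 1)) * (E (e i) * E (- e i)) * E (e (i - 1))"
      by (simp add: A_def D_def mult.assoc)
    then show ?thesis by (simp add: E_inverse)
  qed
  have DA: "D * A = 1"
  proof -
    have "D * A = E (- e i) * (E (e (i - 1)) * E (- e (i - 1))) * E (e i)"
      by (simp add: A_def D_def mult.assoc)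
    then show ?thesis by (simp add: E_inverse)
  qed
  have BD: "B * D = sc q * (D * B)"
  proof (cases "i = 1")
    case False
    have "comm_exp (- e (i - 1) + e (i - 2)) (- e i + e (i - 1)) = 1"
      using assms False by (auto simp: comm_exp_simps comm_exp_e_e comm_exp_e_e')
    then show ?thesis
      using E2_comm[of "- e (i - 1)" "e (i - 2)" "- e i" "e (i - 1)"] False
      by (simp only: B_def D_def if_False power_int_1_right)
  qed (simp add: B_def)
  have "x i * x (i + 1) - sc q * (x (i + 1) * x i) =
      (x i * C - sc q * (C * x i)) + (A * D + B * D - sc q * (D * A + D * B))"
    by (simp only: xj) (simp add: xi algebra_simps)
  also have "\<dots> = sc (1 - q)"
    by (simp add: xC AD BD DA distrib_left sc_diff)
  finally show ?thesis .
qed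

end

section \<open>Powers of one variable and polynomials evaluated at an operator\<close>

definition e_mult :: "nat \<Rightarrow> nat \<Rightarrow> expo" where
  "e_mult m k = (if m = 0 then 0 else Poly_Mapping.single (- int m) (int k))"

lemma e_mult_Suc: "e_mult m (Suc k) = e m + e_mult m k"
  by (simp add: e_mult_def e_def single_add[symmetric])

lemma e_mult_0 [simp]: "e_mult m 0 = 0"
  by (simp add: e_mult_def)

lemma expt_e_mult: "expt (e_mult m k) i = (if i = m \<and> 0 < m then int k else 0)"
  by (auto simp: expt_def e_mult_def lookup_single when_def)

lemma nn_ex_e_mult: "m \<le> n \<Longrightarrow> e_mult m k \<in> nn_ex n"
  by (induction k) (auto simp: e_mult_Suc nn_ex_0 intro: nn_ex_add nn_ex_e)

definition poly_op :: "'a poly \<Rightarrow> ('g, 'a::field) lin_op \<Rightarrow> ('g, 'a) lin_op" where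
  "poly_op p t = fold_coeffs (\<lambda>c r. sc c + t * r) p 0"

lemma poly_op_0 [simp]: "poly_op 0 t = 0"
  by (simp add: poly_op_def)

lemma poly_op_pCons [simp]: "poly_op (pCons c p) t = sc c + t * poly_op p t"
  by (cases "p = 0 \<and> c = 0") (auto simp: poly_op_def)

lemma poly_op_add: "poly_op (p + r) t = poly_op p t + poly_op r t"
  by (induction p r rule: poly_induct2) (auto simp: sc_add algebra_simps)

lemma poly_op_smult: "poly_op (smult c p) t = sc c * poly_op p t"
  by (induction p) (auto simp: sc_mult distrib_left sc_left_commute[of t])

lemma poly_op_sum: "poly_op (sum f A) t = (\<Sum>a\<in>A. poly_op (f a) t)"
  by (induction A rule: infinite_finite_induct) (auto simp: poly_op_add)

lemma poly_op_monom: "poly_op (monom c k) t = sc c * t ^ k"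
  by (induction k) (auto simp: monom_0 monom_Suc sc_left_commute[of t])

lemma poly_op_linear_mult: "poly_op ([:- c, 1:] * p) t = (t - sc c) * poly_op p t"
proof -
  have "[:- c, 1:] * p = smult (- c) p + pCons 0 p" by simp
  then have "poly_op ([:- c, 1:] * p) t = sc (- c) * poly_op p t + t * poly_op p t"
    by (simp only: poly_op_add poly_op_smult poly_op_pCons sc_0 add_0)
  then show ?thesis by (simp add: sc_minus left_diff_distrib)
qed

lemma poly_op_commute:
  assumes "y * t = t * y"
  shows "y * poly_op p t = poly_op p t * y"
proof (induction p)
  case (pCons c p)
  have "y * (t * poly_op p t) = t * poly_op p t * y"
    using pCons(2) assms by (metis mult.assoc)
  then show ?case by (simp add: distrib_left distrib_right sc_comm)
qed simp

context qtorus
begin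

lemma E_e_mult: "E (e_mult m k) = z m ^ k"
proof (induction k)
  case (Suc k)
  have "twist (e m) (e_mult m k) = 0"
    by (simp add: e_mult_def e_def twist_def twist_sign_def)
  then have "E (e m) * E (e_mult m k) = E (e_mult m (Suc k))"
    by (simp add: E_mult e_mult_Suc)
  then show ?case using Suc by (simp add: z_def)
qed simp

section \<open>The subalgebra generated by the \<open>x i\<close>, between polynomials and Laurent
  polynomials in the \<open>z i\<close>\<close>

inductive_set L :: "nat \<Rightarrow> (expo, 'k) lin_op set" for m where
  L_sc: "sc k \<in> L m"
| L_x: "1 \<le> i \<Longrightarrow> i \<le> m \<Longrightarrow> x i \<in> L m"
| L_add: "r \<in> L m \<Longrightarrow> s \<in> L m \<Longrightarrow> r + s \<in> L m"
| L_mult: "r \<in> L m \<Longrightarrow> s \<in> L m \<Longrightarrow> r * s \<in> L m"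

lemma L_0: "0 \<in> L m" and L_1: "1 \<in> L m"
  using L_sc[of 0] L_sc[of 1] by simp_all

lemma L_minus: "r \<in> L m \<Longrightarrow> - r \<in> L m"
  using L_mult[OF L_sc[of "- 1"]] by (fastforce simp: sc_minus)

lemma L_diff: "r \<in> L m \<Longrightarrow> s \<in> L m \<Longrightarrow> r - s \<in> L m"
  using L_add[OF _ L_minus, of r m s] by simp

lemma L_power: "r \<in> L m \<Longrightarrow> r ^ k \<in> L m"
  by (induction k) (auto intro: L_1 L_mult)

lemma L_mono: "m \<le> n \<Longrightarrow> L m \<subseteq> L n"
proof
  fix r assume "m \<le> n"
  assume "r \<in> L m"
  then show "r \<in> L n" using \<open>m \<le> n\<close> by induction (auto intro: L.intros)
qed

lemma z_in_L: "i \<le> m \<Longrightarrow> z i \<in> L m"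
proof (induction i rule: less_induct)
  case (less i)
  show ?case
  proof (cases i)
    case (Suc r)
    then have "z r \<in> L m" "z (r - 1) \<in> L m" using less by auto
    then show ?thesis
      using Suc less(2) by (auto simp: z_Suc intro!: L_diff L_mult L_x L_0)
  qed (simp add: L_1)
qed

lemma poly_op_in_L: "t \<in> L m \<Longrightarrow> poly_op p t \<in> L m"
  by (induction p) (auto intro: L_0 L_add L_sc L_mult)

abbreviation "Tm m \<equiv> mspan (upto_ex m)"
abbreviation "Tp m \<equiv> mspan (top_nn_ex m)"
abbreviation "Q m \<equiv> mspan (nn_ex m)"

lemma mspan_one: "0 \<in> A \<Longrightarrow> sc k \<in> mspan A"
  using mspan_sc[OF mspan_E, of 0 A k] by simp

lemma Tm_mult: "s \<in> Tm m \<Longrightarrow> t \<in> Tm m \<Longrightarrow> s * t \<in> Tm m"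
  by (rule mspan_mult) (auto intro: upto_ex_add)

lemma Tp_mult: "s \<in> Tp m \<Longrightarrow> t \<in> Tp m \<Longrightarrow> s * t \<in> Tp m"
  by (rule mspan_mult) (auto intro: top_nn_ex_add)

lemma Q_mult: "s \<in> Q m \<Longrightarrow> t \<in> Q m \<Longrightarrow> s * t \<in> Q m"
  by (rule mspan_mult) (auto intro: nn_ex_add)

lemma x_in_Tp:
  assumes "1 \<le> i" "i \<le> m"
  shows "x i \<in> Tp m"
proof -
  have "e i - e (i - 1) \<in> top_nn_ex m" "i \<noteq> 1 \<Longrightarrow> e (i - 2) - e (i - 1) \<in> top_nn_ex m"
    using assms by (auto simp: top_nn_ex_def expt_e intro!: upto_ex_diff upto_ex_e)
  then show ?thesis
    unfolding x_eq_monomials[OF assms(1)] by (auto intro!: mspan_add mspan_sc mspan_E mspan_0)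
qed

lemma L_sub_Tp: "r \<in> L m \<Longrightarrow> r \<in> Tp m"
proof (induction rule: L.induct)
  case (L_sc k)
  show ?case by (rule mspan_one) (simp add: top_nn_ex_def)
qed (auto intro: x_in_Tp mspan_add Tp_mult)

lemma Tp_sub_Tm: "Tp m \<subseteq> Tm m"
  by (rule mspan_mono) (auto simp: top_nn_ex_def)

lemma Tm_sub_Tp: "Tm m \<subseteq> Tp (Suc m)"
  by (rule mspan_mono[OF upto_top])

lemma Q_sub_Tp: "Q m \<subseteq> Tp m"
  by (rule mspan_mono[OF nn_ex_top])

lemma E_add: "E (a + b) = sc (qp (- twist a b)) * (E a * E b)"
  by (simp add: E_mult sc_mult_assoc flip: qp_add)

lemma E_nn_in_L: "a \<in> nn_ex m \<Longrightarrow> E a \<in> L m"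
proof (induction rule: nn_ex_induct)
  case (add a i)
  then show ?case using z_in_L[of i m] by (auto simp: E_add z_def intro!: L_mult L_sc)
qed (simp add: L_1)

lemma Q_sub_L: "t \<in> Q m \<Longrightarrow> t \<in> L m"
  by (induction rule: mspan.induct) (auto intro!: L_0 L_add L_mult L_sc E_nn_in_L)

lemma L_in_T: "r \<in> L m \<Longrightarrow> r \<in> T"
  using L_sub_Tp mspan_in_T by blast

text \<open>Each term has its own monomial denominator. Monomials commute up to powers of
  \<open>q\<close>, so the product of the denominators clears every term, and none of them involves
  \<open>z m\<close>.\<close>

lemma clear_denominators:
  assumes "t \<in> Tp m"
  shows "\<exists>b\<in>nn_ex (m - 1). E b * t \<in> Q m"
  using assms
proof (induction t rule: mspan.induct)
  case mspan_0
  show ?case by (intro bexI[of _ 0]) (auto intro: mspan.mspan_0 nn_ex_0)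
next
  case (mspan_step a t k)
  obtain b where b: "b \<in> nn_ex (m - 1)" "E b * t \<in> Q m" using mspan_step by blast
  obtain c where c: "c \<in> nn_ex (m - 1)" "a + c \<in> nn_ex m" using clear_exponents mspan_step by blast
  have bm: "b \<in> nn_ex m" and cm: "c \<in> nn_ex m" using b c nn_ex_mono[of "m - 1" m] by auto
  have "E c * (E b * t) \<in> Q m" using mspan_E[OF cm] b(2) by (rule Q_mult)
  moreover have "E b * E (a + c) \<in> Q m" using bm c by (intro Q_mult mspan_E)
  then have "E (b + (a + c)) \<in> Q m" by (auto simp: E_add intro: mspan_sc)
  then have "E (c + b) * E a \<in> Q m"
    by (auto simp: E_mult ac_simps intro: mspan_sc)
  ultimately have "sc k * (E (c + b) * E a) + sc (qp (- twist c b)) * (E c * (E b * t)) \<in> Q m"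
    by (intro mspan_add mspan_sc)
  also have "sc (qp (- twist c b)) * (E c * (E b * t)) = E (c + b) * t"
    by (simp only: E_add mult.assoc)
  also have "sc k * (E (c + b) * E a) + E (c + b) * t = E (c + b) * (sc k * E a + t)"
    by (simp only: distrib_left sc_left_commute[of "E (c + b)"])
  finally have "E (c + b) * (sc k * E a + t) \<in> Q m" .
  then show ?case using nn_ex_add b c by blast
qed

section \<open>Two-sided ideals of the subalgebra\<close>

definition ideal_in_L :: "nat \<Rightarrow> (expo, 'k) lin_op set \<Rightarrow> bool" where
  "ideal_in_L n I \<longleftrightarrow> I \<subseteq> L n \<and> 0 \<in> I \<and> (\<forall>a\<in>I. \<forall>b\<in>I. a + b \<in> I) \<and>
     (\<forall>a\<in>I. \<forall>r\<in>L n. r * a \<in> I \<and> a * r \<in> I)"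

lemma ideal_in_L_add: "ideal_in_L n I \<Longrightarrow> a \<in> I \<Longrightarrow> b \<in> I \<Longrightarrow> a + b \<in> I"
  and ideal_in_L_left: "ideal_in_L n I \<Longrightarrow> a \<in> I \<Longrightarrow> r \<in> L n \<Longrightarrow> r * a \<in> I"
  and ideal_in_L_right: "ideal_in_L n I \<Longrightarrow> a \<in> I \<Longrightarrow> r \<in> L n \<Longrightarrow> a * r \<in> I"
  and ideal_in_L_L: "ideal_in_L n I \<Longrightarrow> a \<in> I \<Longrightarrow> a \<in> L n"
  and ideal_in_L_0: "ideal_in_L n I \<Longrightarrow> 0 \<in> I"
  by (auto simp: ideal_in_L_def)

lemma ideal_in_L_sc: "ideal_in_L n I \<Longrightarrow> a \<in> I \<Longrightarrow> sc k * a \<in> I"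
  by (rule ideal_in_L_left) (auto intro: L_sc)

lemma ideal_in_L_scD: "ideal_in_L n I \<Longrightarrow> sc k * a \<in> I \<Longrightarrow> k \<noteq> 0 \<Longrightarrow> a \<in> I"
  using ideal_in_L_sc[of n I "sc k * a" "inverse k"] by (simp add: sc_mult_assoc)

lemma ideal_in_L_diff: "ideal_in_L n I \<Longrightarrow> a \<in> I \<Longrightarrow> b \<in> I \<Longrightarrow> a - b \<in> I"
  using ideal_in_L_add[of n I a "- b"] ideal_in_L_sc[of n I b "- 1"] by (simp add: sc_minus)

text \<open>The recursion for the \<open>z\<^sub>i\<close>, read downwards, ends at \<open>z\<^sub>0 = 1\<close>.\<close>

lemma two_consecutive:
  assumes I: "ideal_in_L n I" and "r \<le> n" and "1 \<le> r" and "z r * y \<in> I" "z (r - 1) * y \<in> I"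
  shows "y \<in> I"
  using assms(2-)
proof (induction r)
  case (Suc r)
  show ?case
  proof (cases "r = 0")
    case True
    then show ?thesis using Suc by simp
  next
    case False
    obtain k l where kl: "k \<noteq> 0" "l \<noteq> 0" "x (Suc r) * z r = sc k * z (Suc r) + sc l * z (r - 1)"
      using x_z_below[of "Suc r"] False by (auto simp: numeral_2_eq_2)
    have "x (Suc r) * (z r * y) \<in> I"
      using Suc.prems by (intro ideal_in_L_left[OF I, of "z r * y"] L_x) auto
    moreover have "x (Suc r) * (z r * y) = sc k * (z (Suc r) * y) + sc l * (z (r - 1) * y)"
      by (simp only: mult.assoc[symmetric] kl(3) distrib_right)
    moreover have "sc k * (z (Suc r) * y) \<in> I"
      using Suc ideal_in_L_sc[OF I] by blast
    ultimately have "sc l * (z (r - 1) * y) \<in> I"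
      using ideal_in_L_diff[OF I] by (metis add_diff_cancel_left')
    then have "z (r - 1) * y \<in> I" using ideal_in_L_scD[OF I] kl by blast
    then show ?thesis using Suc False by auto
  qed
qed simp

lemma coef_E_mult: "coef (E a * t) c = qp (twist a (c - a)) * coef t (c - a)"
  by (simp add: coef_def app_mult app_E)

lemma E_mult_nz: "t \<in> T \<Longrightarrow> t \<noteq> 0 \<Longrightarrow> E a * t \<noteq> 0"
  using lead_mult(1)[of "E a" t] mspan_E[of a UNIV] E_nz by simp

section \<open>The elements \<open>z m - sc c\<close>: normality, and division with
  remainder\<close>

definition u :: "nat \<Rightarrow> 'k \<Rightarrow> (expo, 'k) lin_op" where
  "u m c = z m - sc c"

text \<open>The cases in which \<open>u m c\<close> is shown to be normal: for odd \<open>m\<close>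
  it is central in \<open>L m\<close>; for even \<open>m\<close> the variable \<open>z m\<close>
  commutes only up to powers of \<open>q\<close>, and a nonzero constant would not pass with the
  same factor.\<close>

definition u_normal_pair :: "nat \<Rightarrow> 'k \<Rightarrow> bool" where
  "u_normal_pair m c \<longleftrightarrow> 1 \<le> m \<and> (odd m \<or> c = 0)"

lemma u_in_L: "u m c \<in> L m"
  unfolding u_def by (intro L_diff z_in_L L_sc) simp

lemma u_in_Tp: "u m c \<in> Tp m"
  by (rule L_sub_Tp[OF u_in_L])

lemma lead_u: "1 \<le> m \<Longrightarrow> lead (u m c) = e m \<and> u m c \<noteq> 0"
proof -
  assume m: "1 \<le> m"
  have coef: "coef (u m c) a = (if a = e m then 1 else 0) - (if a = 0 then c else 0)" for a
    using coef_simps(4)[of c 1 a] coef_simps(5)[of 0 a]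
    by (auto simp: u_def z_def coef_simps)
  have "e m \<noteq> 0" "0 < e m" using e_pos[of m] m by auto
  then have "lead (u m c) = e m"
    using mspan_in_T[OF u_in_Tp[of m c]]
    by (intro lead_eqI) (auto simp: supp_def coef split: if_splits)
  moreover have "u m c \<noteq> 0"
    using coef[of "e m"] \<open>e m \<noteq> 0\<close> by (auto simp: coef_simps)
  ultimately show ?thesis by simp
qed

text \<open>The obstruction in \<open>E_x_comm\<close> is a factor \<open>z (i - 1)\<close>, and
  \<open>i - 1 < m\<close>.\<close>

lemma z_x_comm:
  assumes "1 \<le> i" "i \<le> m"
  shows "\<exists>k. k \<noteq> 0 \<and> (odd m \<longrightarrow> k = 1) \<and> z m * x i = sc k * (x i * z m)"
proof -
  have i: "i - 1 \<noteq> m" using assms by arith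
  have "z m * x i = sc (qp (comm_exp (e m) (e i - e (i - 1)))) * (x i * z m)"
    unfolding z_def using assms i by (intro E_x_comm) (auto simp: expt_e)
  moreover have "comm_exp (e m) (e i - e (i - 1)) = 0" if "odd m"
  proof -
    have "e i - e (i - 1) \<in> upto_ex m" using assms by (intro upto_ex_diff upto_ex_e) auto
    then show ?thesis using comm_exp_e_odd_top[of _ m m] that by (subst comm_exp_swap) simp
  qed
  ultimately show ?thesis
    using qp_nz by (intro exI[of _ "qp (comm_exp (e m) (e i - e (i - 1)))"]) auto
qed

lemma z_odd_central:
  assumes "odd m" "r \<in> L m"
  shows "z m * r = r * z m"
  using assms(2)
proof induction
  case (L_x i)
  then show ?case using z_x_comm[of i m] assms(1) by auto
next
  case (L_mult r s)
  have "z m * (r * s) = r * (z m * s)" by (simp only: L_mult(3) mult.assoc[symmetric])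
  then show ?case by (simp only: L_mult(4) mult.assoc)
qed (simp_all add: sc_comm distrib_left distrib_right)

lemma u_x_comm:
  assumes "u_normal_pair m c" "1 \<le> i" "i \<le> m"
  shows "\<exists>k. k \<noteq> 0 \<and> u m c * x i = sc k * (x i * u m c)"
proof (cases "odd m")
  case True
  then have "z m * x i = x i * z m" using assms by (intro z_odd_central L_x)
  then have "u m c * x i = sc 1 * (x i * u m c)"
    by (simp add: u_def left_diff_distrib right_diff_distrib sc_comm)
  then show ?thesis by (metis zero_neq_one)
next
  case False
  then show ?thesis using z_x_comm[OF assms(2,3)] assms(1) by (auto simp: u_def u_normal_pair_def)
qed

lemma u_normal:
  assumes "u_normal_pair m c" "r \<in> L m"
  shows "(\<exists>r'\<in>L m. r * u m c = u m c * r') \<and> (\<exists>r'\<in>L m. u m c * r = r' * u m c)"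
  using assms(2)
proof induction
  case (L_sc k)
  have "sc k * u m c = u m c * sc k" by (simp add: sc_comm)
  then show ?case using L.L_sc by metis
next
  case (L_x i)
  obtain k where k: "k \<noteq> 0" "u m c * x i = sc k * (x i * u m c)" using u_x_comm[OF assms(1) L_x] by blast
  have "u m c * (sc (inverse k) * x i) = x i * u m c"
    using k by (simp add: sc_left_commute[of "u m c"] sc_mult_assoc)
  moreover have "u m c * x i = (sc k * x i) * u m c" using k by (simp add: mult.assoc)
  moreover have "sc (inverse k) * x i \<in> L m" "sc k * x i \<in> L m"
    using L_x by (auto intro!: L_mult L_sc L.L_x)
  ultimately show ?case by metis
next
  case (L_add r s)
  then obtain r1 s1 r2 s2 where in_L: "r1 \<in> L m" "s1 \<in> L m" "r2 \<in> L m" "s2 \<in> L m"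
    and eq: "r * u m c = u m c * r1" "s * u m c = u m c * s1" "u m c * r = r2 * u m c" "u m c * s = s2 * u m c"
    by blast
  have "(r + s) * u m c = u m c * (r1 + s1)" "u m c * (r + s) = (r2 + s2) * u m c"
    by (simp_all only: distrib_left distrib_right eq)
  then show ?case using L.L_add[OF in_L(1,2)] L.L_add[OF in_L(3,4)] by blast
next
  case (L_mult r s)
  then obtain r1 s1 r2 s2 where in_L: "r1 \<in> L m" "s1 \<in> L m" "r2 \<in> L m" "s2 \<in> L m"
    and eq: "r * u m c = u m c * r1" "s * u m c = u m c * s1" "u m c * r = r2 * u m c" "u m c * s = s2 * u m c"
    by blast
  have "r * s * u m c = r * u m c * s1" by (simp only: eq(2) mult.assoc)
  also have "\<dots> = u m c * (r1 * s1)" by (simp only: eq(1) mult.assoc)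
  finally have 1: "r * s * u m c = u m c * (r1 * s1)" .
  have "u m c * (r * s) = r2 * (u m c * s)" by (simp only: eq(3) mult.assoc[symmetric])
  also have "\<dots> = r2 * s2 * u m c" by (simp only: eq(4) mult.assoc)
  finally have "u m c * (r * s) = r2 * s2 * u m c" .
  then show ?case using 1 L.L_mult[OF in_L(1,2)] L.L_mult[OF in_L(3,4)] by blast
qed

lemma u_normal_Tp:
  assumes "u_normal_pair m c" "t \<in> Tp m"
  shows "\<exists>t'\<in>Tp m. t * u m c = u m c * t'"
  using assms(2)
proof induction
  case mspan_0
  show ?case by (intro bexI[of _ 0]) (auto intro: mspan.mspan_0)
next
  case (mspan_step a t k)
  obtain t' where t': "t' \<in> Tp m" "t * u m c = u m c * t'" using mspan_step by blast
  have "\<exists>l. E a * u m c = sc l * (u m c * E a)"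
  proof (cases "odd m")
    case True
    then have "comm_exp a (e m) = 0"
      using mspan_step by (intro comm_exp_e_odd_top[of a m]) (auto simp: top_nn_ex_def)
    then have "E a * u m c = sc 1 * (u m c * E a)"
      using E_comm[of a "e m"] by (simp add: u_def z_def left_diff_distrib right_diff_distrib sc_comm)
    then show ?thesis by blast
  next
    case False
    then show ?thesis using E_comm[of a "e m"] assms(1) by (auto simp: u_def u_normal_pair_def z_def)
  qed
  then obtain l where l: "E a * u m c = sc l * (u m c * E a)" by blast
  have "(sc k * E a + t) * u m c = u m c * (sc (k * l) * E a + t')"
    by (simp add: distrib_left distrib_right t' mult.assoc l sc_left_commute[of "u m c"] sc_mult_assoc)
  moreover have "sc (k * l) * E a + t' \<in> Tp m" using mspan_step(1) t'(1) by (rule mspan.mspan_step)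
  ultimately show ?case by blast
qed

text \<open>Division with remainder in the last variable: one factor \<open>z m\<close> at a time is
  replaced by \<open>u m c + sc c\<close>. The set \<open>A\<close> is a parameter because the
  result is needed over Laurent monomials and over ordinary ones.\<close>

lemma u_division:
  assumes "t \<in> mspan A" "A \<subseteq> top_nn_ex m" "1 \<le> m"
    and A: "\<And>a. a \<in> A \<Longrightarrow> 0 < expt a m \<Longrightarrow> a - e m \<in> A"
  shows "\<exists>t'\<in>mspan A. \<exists>t0\<in>mspan (A \<inter> upto_ex (m - 1)). t = u m c * t' + t0"
  using assms(1)
proof induction
  case mspan_0
  show ?case by (intro bexI[of _ 0]) (auto intro: mspan.mspan_0)
next
  case (mspan_step a t k)
  have "a \<in> A \<Longrightarrow> \<exists>t'\<in>mspan A. \<exists>t0\<in>mspan (A \<inter> upto_ex (m - 1)). E a = u m c * t' + t0"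
  proof (induction "nat (expt a m)" arbitrary: a)
    case 0
    then have "a \<in> upto_ex m" "expt a m = 0" using assms(2) by (auto simp: top_nn_ex_def)
    have "a \<in> upto_ex (m - 1)"
    proof (rule upto_ex_shrink[OF \<open>a \<in> upto_ex m\<close>])
      fix j assume "m - 1 < j" "j \<le> m"
      then have "j = m" by simp
      then show "expt a j = 0" using \<open>expt a m = 0\<close> by simp
    qed
    then have "E a \<in> mspan (A \<inter> upto_ex (m - 1))" using 0 by (intro mspan_E) auto
    then show ?case by (intro bexI[of _ 0] bexI[of _ "E a"]) (auto intro: mspan.mspan_0)
  next
    case (Suc j)
    have "expt (a - e m) m = expt a m - 1" using assms(3) by (simp add: expt_e)
    then have "j = nat (expt (a - e m) m)" "a - e m \<in> A" using Suc A by auto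
    then obtain t' t0 where t: "t' \<in> mspan A" "t0 \<in> mspan (A \<inter> upto_ex (m - 1))" "E (a - e m) = u m c * t' + t0"
      using Suc(1) by blast
    define l where "l = qp (- twist (e m) (a - e m))"
    have "E a = sc l * (z m * E (a - e m))"
      using E_add[of "e m" "a - e m"] by (simp add: l_def z_def)
    also have "\<dots> = sc l * (u m c * E (a - e m) + sc c * (u m c * t' + t0))"
      by (simp add: u_def left_diff_distrib t(3)[unfolded u_def])
    also have "\<dots> = u m c * (sc l * E (a - e m) + sc (l * c) * t') + sc (l * c) * t0"
      by (simp add: distrib_left sc_left_commute[of "u m c"] sc_mult_assoc)
    finally have "E a = \<dots>" .
    moreover have "sc l * E (a - e m) + sc (l * c) * t' \<in> mspan A"
      using t \<open>a - e m \<in> A\<close> by (intro mspan.mspan_step mspan_sc)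
    ultimately show ?case using t mspan_sc by blast
  qed
  then obtain s' s0 where s: "s' \<in> mspan A" "s0 \<in> mspan (A \<inter> upto_ex (m - 1))" "E a = u m c * s' + s0"
    using mspan_step by blast
  obtain t' t0 where t: "t' \<in> mspan A" "t0 \<in> mspan (A \<inter> upto_ex (m - 1))" "t = u m c * t' + t0"
    using mspan_step by blast
  have "sc k * E a + t = u m c * (sc k * s' + t') + (sc k * s0 + t0)"
    by (simp add: s(3) t(3) distrib_left sc_left_commute[of "u m c"] ac_simps)
  moreover have "sc k * s' + t' \<in> mspan A" "sc k * s0 + t0 \<in> mspan (A \<inter> upto_ex (m - 1))"
    using s t by (simp_all add: mspan_add mspan_sc)
  ultimately show ?case by blast
qed

lemma u_division_Tp:
  assumes "t \<in> Tp m" "1 \<le> m"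
  shows "\<exists>t'\<in>Tp m. \<exists>t0\<in>Tm (m - 1). t = u m c * t' + t0"
proof -
  have "a - e m \<in> top_nn_ex m" if "a \<in> top_nn_ex m" "0 < expt a m" for a
    using that assms(2) by (auto simp: top_nn_ex_def expt_e intro!: upto_ex_diff upto_ex_e)
  then obtain t' t0 where "t' \<in> Tp m" "t0 \<in> mspan (top_nn_ex m \<inter> upto_ex (m - 1))" "t = u m c * t' + t0"
    using u_division[OF assms(1) order_refl assms(2)] by metis
  then show ?thesis using mspan_mono[of "top_nn_ex m \<inter> upto_ex (m - 1)" "upto_ex (m - 1)"] by blast
qed

lemma u_division_Q:
  assumes "t \<in> Q m" "1 \<le> m"
  shows "\<exists>t'\<in>Q m. \<exists>t0\<in>Q (m - 1). t = u m c * t' + t0"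
proof -
  have "a - e m \<in> nn_ex m" if "a \<in> nn_ex m" "0 < expt a m" for a
    using that assms(2) by (auto simp: nn_ex_def expt_e intro!: upto_ex_diff upto_ex_e)
  then obtain t' t0 where "t' \<in> Q m" "t0 \<in> mspan (nn_ex m \<inter> upto_ex (m - 1))" "t = u m c * t' + t0"
    using u_division[OF assms(1) nn_ex_top assms(2)] by metis
  then show ?thesis using mspan_mono[of "nn_ex m \<inter> upto_ex (m - 1)" "nn_ex (m - 1)"]
    by (auto simp: nn_ex_def)
qed

text \<open>For nonzero \<open>t\<close> the leading exponent of the product is
  \<open>e m + lead t\<close>, in which \<open>z m\<close> has a positive exponent. This gives the
  uniqueness of the remainder in \<open>u_division\<close>.\<close>

lemma u_multiple_below:
  assumes "t \<in> Tp m" "u m c * t \<in> Tm (m - 1)" "1 \<le> m"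
  shows "t = 0"
proof (rule ccontr)
  assume t: "t \<noteq> 0"
  have T: "t \<in> T" "u m c \<in> T" "u m c * t \<in> T" using assms u_in_Tp mspan_in_T by blast+
  then have lead: "lead (u m c * t) = e m + lead t" and nz: "u m c * t \<noteq> 0"
    using lead_mult[of "u m c" t] lead_u[of m c] assms(3) t by auto
  have "lead (u m c * t) \<in> upto_ex (m - 1)"
    using lead_in_supp[OF T(3) nz] supp_mspan[OF assms(2)] by blast
  then have "expt (e m + lead t) m = 0"
    using upto_ex_ex[of "e m + lead t" "m - 1" m] assms(3) by (simp only: lead)
  moreover have "0 \<le> expt (lead t) m"
    using lead_in_supp[OF T(1) t] supp_mspan[OF assms(1)] by (auto simp: top_nn_ex_def)
  ultimately show False using assms(3) by (simp add: expt_e)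
qed

section \<open>The degree in \<open>x m\<close>, and why quotients by \<open>z m - sc c\<close> stay
  in the subalgebra\<close>

text \<open>The degree filtration of \<open>L m\<close>, viewed as a skew polynomial ring in
  \<open>x m\<close> with coefficients from \<open>L (m - 1)\<close> on the left.\<close>

primrec L_deg :: "nat \<Rightarrow> nat \<Rightarrow> (expo, 'k) lin_op set" where
  "L_deg m 0 = L (m - 1)"
| "L_deg m (Suc d) = {b + c * x m ^ Suc d | b c. b \<in> L_deg m d \<and> c \<in> L (m - 1)}"

lemma L_deg_SucI: "b \<in> L_deg m d \<Longrightarrow> c \<in> L (m - 1) \<Longrightarrow> b + c * x m ^ Suc d \<in> L_deg m (Suc d)"
  by (simp only: L_deg.simps) blast

lemma L_deg_SucE:
  assumes "a \<in> L_deg m (Suc d)"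
  obtains b c where "a = b + c * x m ^ Suc d" "b \<in> L_deg m d" "c \<in> L (m - 1)"
  using assms by (simp only: L_deg.simps) blast

lemma L_deg_add: "a \<in> L_deg m d \<Longrightarrow> b \<in> L_deg m d \<Longrightarrow> a + b \<in> L_deg m d"
proof (induction d arbitrary: a b)
  case (Suc d)
  obtain a1 a2 where a: "a = a1 + a2 * x m ^ Suc d" "a1 \<in> L_deg m d" "a2 \<in> L (m - 1)"
    using Suc(2) by (rule L_deg_SucE)
  obtain b1 b2 where b: "b = b1 + b2 * x m ^ Suc d" "b1 \<in> L_deg m d" "b2 \<in> L (m - 1)"
    using Suc(3) by (rule L_deg_SucE)
  have "a + b = (a1 + b1) + (a2 + b2) * x m ^ Suc d"
    by (simp only: a b distrib_right add_ac)
  then show ?case using L_deg_SucI[OF Suc(1)[OF a(2) b(2)] L_add[OF a(3) b(3)]] by simp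
qed (simp add: L_add)

lemma L_deg_Suc: "a \<in> L_deg m d \<Longrightarrow> a \<in> L_deg m (Suc d)"
  using L_deg_SucI[OF _ L_0, of a m d] by (simp del: L_deg.simps)

lemma L_deg_mono: "d \<le> d' \<Longrightarrow> a \<in> L_deg m d \<Longrightarrow> a \<in> L_deg m d'"
  by (induction d' rule: dec_induct) (auto intro: L_deg_Suc simp del: L_deg.simps)

lemma L_deg_monomial: "c \<in> L (m - 1) \<Longrightarrow> c * x m ^ d \<in> L_deg m d"
proof (cases d)
  case (Suc k)
  assume c: "c \<in> L (m - 1)"
  have "0 \<in> L_deg m 0" by (simp add: L_0)
  then have "0 \<in> L_deg m k" using L_deg_mono[of 0 k] by blast
  then show ?thesis using L_deg_SucI[OF _ c] unfolding Suc by (metis add_0)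
qed simp

text \<open>Each defining relation moves \<open>x m\<close> to the right past a generator at the
  cost of a scalar and a constant; products follow by the twisted Leibniz rule.\<close>

lemma x_skew:
  assumes "r \<in> L (m - 1)" "1 \<le> m"
  shows "\<exists>s\<in>L (m - 1). \<exists>t\<in>L (m - 1). x m * r = s * x m + t"
  using assms(1)
proof induction
  case (L_sc k)
  have "x m * sc k = sc k * x m + 0" by (simp add: sc_comm)
  then show ?case using L.L_sc L_0 by metis
next
  case (L_x i)
  have xi: "x i \<in> L (m - 1)" using L_x L.L_x by blast
  show ?case
  proof (cases "i + 1 = m")
    case True
    have "x i * x m = sc q * (x m * x i) + sc (1 - q)"
      using x_rel_near[OF L_x(1)] True by (simp add: algebra_simps)
    then have "sc (inverse q) * (x i * x m) = x m * x i + sc (inverse q * (1 - q))"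
      using q_nz by (simp only: distrib_left sc_mult_assoc) (simp add: sc_mult)
    then have "x m * x i = (sc (inverse q) * x i) * x m + sc (- (inverse q * (1 - q)))"
      by (simp add: mult.assoc sc_minus)
    then show ?thesis using xi L.L_sc L_mult by blast
  next
    case False
    then have "x i * x m = sc (if odd (m - i) then q else inverse q) * (x m * x i)"
      using L_x by (intro x_rel_far) auto
    then obtain l where l: "l \<noteq> 0" "x i * x m = sc l * (x m * x i)"
      using q_nz by (metis inverse_nonzero_iff_nonzero)
    have "x m * x i = (sc (inverse l) * x i) * x m + 0"
      using l by (simp add: mult.assoc sc_mult_assoc)
    then show ?thesis using xi L.L_sc L_mult L_0 by metis
  qed
next
  case (L_add r1 r2)
  then obtain s1 t1 s2 t2 where "s1 \<in> L (m - 1)" "t1 \<in> L (m - 1)" "s2 \<in> L (m - 1)" "t2 \<in> L (m - 1)"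
    "x m * r1 = s1 * x m + t1" "x m * r2 = s2 * x m + t2" by blast
  moreover from this have "x m * (r1 + r2) = (s1 + s2) * x m + (t1 + t2)"
    by (simp add: algebra_simps)
  ultimately show ?case using L.L_add by blast
next
  case (L_mult r1 r2)
  then obtain s1 t1 s2 t2 where st: "s1 \<in> L (m - 1)" "t1 \<in> L (m - 1)" "s2 \<in> L (m - 1)" "t2 \<in> L (m - 1)"
    "x m * r1 = s1 * x m + t1" "x m * r2 = s2 * x m + t2" by blast
  have "x m * (r1 * r2) = s1 * (x m * r2) + t1 * r2"
    by (simp only: mult.assoc[symmetric] st(5) distrib_right)
  also have "\<dots> = (s1 * s2) * x m + (s1 * t2 + t1 * r2)"
    by (simp add: st(6) distrib_left mult.assoc add.assoc)
  finally show ?case using st L_mult L.L_add L.L_mult by blast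
qed

lemma L_deg_left: "c \<in> L (m - 1) \<Longrightarrow> a \<in> L_deg m d \<Longrightarrow> c * a \<in> L_deg m d"
proof (induction d arbitrary: a)
  case (Suc d)
  obtain b b' where b: "a = b + b' * x m ^ Suc d" "b \<in> L_deg m d" "b' \<in> L (m - 1)"
    using Suc(3) by (rule L_deg_SucE)
  have "c * a = c * b + (c * b') * x m ^ Suc d" by (simp only: b distrib_left mult.assoc)
  then show ?case using L_deg_SucI[OF Suc(1)[OF Suc(2) b(2)] L_mult[OF Suc(2) b(3)]] by simp
qed (simp add: L_mult)

lemma L_deg_x: "1 \<le> m \<Longrightarrow> a \<in> L_deg m d \<Longrightarrow> x m * a \<in> L_deg m (Suc d)"
proof (induction d arbitrary: a)
  case 0
  then obtain s t where "s \<in> L (m - 1)" "t \<in> L (m - 1)" "x m * a = t + s * x m"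
    using x_skew[of a m] by (metis L_deg.simps(1) add.commute)
  then show ?case using L_deg_SucI[of t m 0 s] by simp
next
  case (Suc d)
  obtain b b' where b: "a = b + b' * x m ^ Suc d" "b \<in> L_deg m d" "b' \<in> L (m - 1)"
    using Suc(3) by (rule L_deg_SucE)
  obtain s t where st: "s \<in> L (m - 1)" "t \<in> L (m - 1)" "x m * b' = s * x m + t"
    using x_skew[OF b(3)] Suc by blast
  have "x m * a = x m * b + (x m * b') * x m ^ Suc d"
    by (simp only: b(1) distrib_left mult.assoc)
  also have "\<dots> = (x m * b + t * x m ^ Suc d) + s * x m ^ Suc (Suc d)"
    by (simp only: st(3) distrib_right mult.assoc power_Suc add_ac)
  finally have "x m * a = \<dots>" .
  moreover have "x m * b + t * x m ^ Suc d \<in> L_deg m (Suc d)"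
    by (rule L_deg_add[OF Suc(1)[OF Suc(2) b(2)] L_deg_monomial[OF st(2)]])
  ultimately show ?case using L_deg_SucI[OF _ st(1)] by metis
qed

lemma L_in_L_deg:
  assumes "r \<in> L m" "1 \<le> m"
  shows "\<exists>d. r \<in> L_deg m d"
proof -
  \<comment> \<open>Taking \<open>a = 1\<close> gives the claim; an arbitrary \<open>a\<close> is
    what lets the induction pass through products.\<close>
  have "\<forall>d. \<forall>a\<in>L_deg m d. \<exists>d'. r * a \<in> L_deg m d'"
    using assms(1)
  proof induction
    case (L_sc k)
    then show ?case using L_deg_left L.L_sc by blast
  next
    case (L_x i)
    show ?case
    proof (cases "i = m")
      case True
      then show ?thesis using L_deg_x assms(2) by blast
    next
      case False
      then have "x i \<in> L (m - 1)" using L_x by (intro L.L_x) auto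
      then show ?thesis using L_deg_left by blast
    qed
  next
    case (L_add r s)
    show ?case
    proof (intro allI ballI)
      fix d a assume "a \<in> L_deg m d"
      then obtain d1 d2 where "r * a \<in> L_deg m d1" "s * a \<in> L_deg m d2" using L_add by blast
      then have "r * a + s * a \<in> L_deg m (max d1 d2)"
        using L_deg_mono[of d1 "max d1 d2"] L_deg_mono[of d2 "max d1 d2"] by (simp add: L_deg_add)
      then show "\<exists>d'. (r + s) * a \<in> L_deg m d'" by (auto simp: distrib_right)
    qed
  next
    case (L_mult r s)
    show ?case
    proof (intro allI ballI)
      fix d a assume "a \<in> L_deg m d"
      then obtain d' where "s * a \<in> L_deg m d'" using L_mult by blast
      then obtain d'' where "r * (s * a) \<in> L_deg m d''" using L_mult by blast
      then show "\<exists>d'. r * s * a \<in> L_deg m d'" by (auto simp: mult.assoc)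
    qed
  qed
  moreover have "1 \<in> L_deg m 0" by (simp add: L_1)
  ultimately show ?thesis by (metis mult.right_neutral)
qed

lemma L_sub_Tm: "r \<in> L m \<Longrightarrow> r \<in> Tm m"
  using L_sub_Tp Tp_sub_Tm by blast

lemma L_pred_in_Tp: "r \<in> L (m - 1) \<Longrightarrow> r \<in> Tp m"
  using L_mono[of "m - 1" m] L_sub_Tp by auto

text \<open>Modulo \<open>z\<^sub>m - c\<close> one has \<open>x\<^sub>m z\<^sub>m\<^sub>-\<^sub>1 = k c + l z\<^sub>m\<^sub>-\<^sub>2\<close>, and \<open>z\<^sub>m\<^sub>-\<^sub>2\<close> does not involve the last two variables.\<close>

lemma x_power_z_power:
  assumes "2 \<le> m" "u_normal_pair m c" "2 < m \<or> c = 0"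
  shows "\<exists>p\<in>L (m - 2). \<exists>s\<in>Tp m. p \<noteq> 0 \<and> x m ^ k * z (m - 1) ^ k = u m c * s + p"
proof (induction k)
  case 0
  show ?case by (intro bexI[of _ 1] bexI[of _ 0]) (auto intro: L_1 mspan.mspan_0)
next
  case (Suc k)
  obtain a b where ab: "a \<noteq> 0" "b \<noteq> 0" "x m * z (m - 1) = sc a * z m + sc b * z (m - 2)"
    using x_z_below[OF assms(1)] by blast
  obtain p s where ps: "p \<in> L (m - 2)" "s \<in> Tp m" "p \<noteq> 0" "x m ^ k * z (m - 1) ^ k = u m c * s + p"
    using Suc by blast
  obtain a1 where a1: "z m * z (m - 1) ^ k = sc a1 * (z (m - 1) ^ k * z m)"
    using E_comm[of "e m" "e_mult (m - 1) k"] unfolding E_e_mult z_def[symmetric] by blast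
  obtain b1 where b1: "b1 \<noteq> 0" "z (m - 2) * z (m - 1) ^ k = sc b1 * (z (m - 1) ^ k * z (m - 2))"
    using E_comm[of "e (m - 2)" "e_mult (m - 1) k"] qp_nz unfolding E_e_mult z_def[symmetric] by blast
  \<comment> \<open>Modulo \<open>u m c\<close>, this is the factor that
    \<open>x m * z (m - 1)\<close> contributes after its two summands have been moved past
    \<open>z (m - 1) ^ k\<close>; \<open>a1\<close> and \<open>b1\<close> are the scalars of these
    moves.\<close>
  define w where "w = sc (a * a1 * c) + sc (b * b1) * z (m - 2)"
  have wL: "w \<in> L (m - 2)" unfolding w_def by (intro L_add L_mult L_sc z_in_L) simp
  \<comment> \<open>For \<open>m = 2\<close> both summands of \<open>w\<close> are constants, and
    \<open>c = 0\<close> keeps them from cancelling. For larger \<open>m\<close> the coefficient at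
    \<open>z (m - 2)\<close> is nonzero.\<close>
  have "w \<noteq> 0"
  proof (cases "m = 2")
    case True
    then have "w = sc (b * b1)" using assms by (simp add: w_def)
    then show ?thesis using ab b1 coef_simps(4)[of "b * b1" 1 0] coef_simps(5)[of 0 0]
      by (auto simp: coef_simps(1))
  next
    case False
    then have m: "e (m - 2) \<noteq> 0" using e_pos[of "m - 2"] assms by auto
    have "coef w (e (m - 2)) = b * b1"
      using m coef_simps(4)[of "a * a1 * c" 1 "e (m - 2)"] coef_simps(5)[of 0 "e (m - 2)"]
      by (simp add: w_def coef_simps z_def)
    then show ?thesis using ab b1 by (auto simp: coef_simps)
  qed
  then have pw: "p * w \<noteq> 0" "p * w \<in> L (m - 2)"
    using T_no_zero_div[of p w] ps wL L_in_T L_mult by auto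
  have "x m ^ Suc k * z (m - 1) ^ Suc k = x m ^ k * (x m * z (m - 1)) * z (m - 1) ^ k"
    by (simp only: power_Suc2[of "x m"] power_Suc[of "z (m - 1)"] mult.assoc)
  also have "\<dots> = x m ^ k * (sc a * (z m * z (m - 1) ^ k) + sc b * (z (m - 2) * z (m - 1) ^ k))"
    by (simp only: ab(3) mult.assoc distrib_right)
  also have "\<dots> = x m ^ k * (z (m - 1) ^ k * (sc (a * a1) * z m + sc (b * b1) * z (m - 2)))"
    by (simp only: a1 b1(2) sc_mult_assoc distrib_left sc_left_commute[of "z (m - 1) ^ k"])
  also have "sc (a * a1) * z m + sc (b * b1) * z (m - 2) = sc (a * a1) * u m c + w"
    by (simp add: w_def u_def right_diff_distrib sc_mult)
  also have "x m ^ k * (z (m - 1) ^ k * (sc (a * a1) * u m c + w)) =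
      (u m c * s + p) * (sc (a * a1) * u m c + w)"
    by (simp only: ps(4)[symmetric] mult.assoc)
  finally have eq: "x m ^ Suc k * z (m - 1) ^ Suc k = (u m c * s + p) * (sc (a * a1) * u m c + w)" .
  have pT: "p \<in> Tp m"
    using ps L_mono[of "m - 2" m] L_sub_Tp by auto
  obtain p' where p': "p' \<in> Tp m" "p * u m c = u m c * p'"
    using u_normal_Tp[OF assms(2) pT] by blast
  have wT: "w \<in> Tp m" using wL L_mono[of "m - 2" m] L_sub_Tp by auto
  let ?s = "s * (sc (a * a1) * u m c + w) + sc (a * a1) * p'"
  have "?s \<in> Tp m"
    using ps p' wT u_in_Tp by (intro mspan_add Tp_mult mspan_sc)
  moreover have "(u m c * s + p) * (sc (a * a1) * u m c + w) = u m c * ?s + p * w"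
    by (simp add: distrib_left distrib_right p'(2) sc_left_commute[of p] sc_left_commute[of "u m c"] mult.assoc add.assoc)
  ultimately show ?case using pw eq by metis
qed

text \<open>Every factor \<open>x m\<close> is absorbed by a factor \<open>z (m - 1)\<close> through
  \<open>x_power_z_power\<close>, so that modulo \<open>u m c\<close> the generator
  \<open>x m\<close> disappears.\<close>

lemma L_deg_z_power:
  assumes "2 \<le> m" "u_normal_pair m c" "2 < m \<or> c = 0" "b \<in> L_deg m d"
  shows "\<exists>b'\<in>L (m - 1). \<exists>s\<in>Tp m. b * z (m - 1) ^ d = u m c * s + b'"
  using assms(4)
proof (induction d arbitrary: b)
  case 0
  then show ?case by (intro bexI[of _ b] bexI[of _ 0]) (auto intro: mspan.mspan_0)
next
  case (Suc d)
  obtain b1 a where b1: "b = b1 + a * x m ^ Suc d" "b1 \<in> L_deg m d" "a \<in> L (m - 1)"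
    using Suc(2) by (rule L_deg_SucE)
  obtain b' s where b': "b' \<in> L (m - 1)" "s \<in> Tp m" "b1 * z (m - 1) ^ d = u m c * s + b'"
    using Suc(1)[OF b1(2)] by blast
  obtain p t where p: "p \<in> L (m - 2)" "t \<in> Tp m" "x m ^ Suc d * z (m - 1) ^ Suc d = u m c * t + p"
    using x_power_z_power[OF assms(1-3)] by blast
  obtain a' where a': "a' \<in> Tp m" "a * u m c = u m c * a'"
    using u_normal_Tp[OF assms(2) L_pred_in_Tp[OF b1(3)]] by blast
  have zT: "z (m - 1) \<in> L (m - 1)" by (rule z_in_L) simp
  have "b * z (m - 1) ^ Suc d = b1 * z (m - 1) ^ d * z (m - 1) + a * (x m ^ Suc d * z (m - 1) ^ Suc d)"
    by (simp only: b1(1) distrib_right mult.assoc power_Suc2[of "z (m - 1)"])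
  also have "\<dots> = (u m c * s + b') * z (m - 1) + a * (u m c * t + p)"
    by (simp only: b'(3) p(3))
  also have "\<dots> = u m c * (s * z (m - 1)) + b' * z (m - 1) + ((a * u m c) * t + a * p)"
    by (simp only: distrib_left distrib_right mult.assoc)
  also have "\<dots> = u m c * (s * z (m - 1) + a' * t) + (b' * z (m - 1) + a * p)"
    by (simp only: a'(2) distrib_left mult.assoc add_ac)
  finally have "b * z (m - 1) ^ Suc d = \<dots>" .
  moreover have "s * z (m - 1) + a' * t \<in> Tp m"
    using b' a' p L_pred_in_Tp[OF zT] by (intro mspan_add Tp_mult)
  moreover have "m - 2 \<le> m - 1" by arith
  then have "p \<in> L (m - 1)" using p(1) L_mono by blast
  then have "b' * z (m - 1) + a * p \<in> L (m - 1)"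
    using b' zT b1 by (intro L_add L_mult)
  ultimately show ?case by blast
qed

text \<open>Induction on \<open>m\<close> and on the degree in \<open>x\<^sub>m\<close>: the leading coefficient turns out to be divisible by
  \<open>z\<^sub>m\<^sub>-\<^sub>1\<close> in the torus, hence in \<open>L\<^sub>m\<^sub>-\<^sub>1\<close>, and \<open>z\<^sub>m\<^sub>-\<^sub>1 x\<^sub>m = z\<^sub>m + z\<^sub>m\<^sub>-\<^sub>2\<close> lowers the degree.\<close>

lemma u_saturated:
  "u_normal_pair m c \<Longrightarrow> t \<in> Tp m \<Longrightarrow> u m c * t \<in> L m \<Longrightarrow> t \<in> L m"
proof (induction m arbitrary: c t rule: less_induct)
  case (less m)
  show ?case
  proof (cases "m = 1")
    case True
    have "0 \<le> expt a i" if "a \<in> top_nn_ex 1" for a i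
      using that upto_ex_ex[of a 1 i] upto_ex_1_0[of a 1] by (cases "i = 0"; cases "i = 1") (auto simp: top_nn_ex_def)
    then have "top_nn_ex 1 \<subseteq> nn_ex 1" by (auto simp: top_nn_ex_def nn_ex_def)
    then show ?thesis using less(3) mspan_mono Q_sub_L True by blast
  next
    case False
    have m: "2 \<le> m" using False less(2) by (auto simp: u_normal_pair_def)
    then have c: "2 < m \<or> c = 0" using less(2) by (cases "m = 2") (auto simp: u_normal_pair_def)
    \<comment> \<open>The auxiliary divisor is \<open>z (m - 1)\<close>, that is
      \<open>u (m - 1) 0\<close>, which is normal for either parity.\<close>
    have uc1: "u_normal_pair (m - 1) 0" using m by (simp add: u_normal_pair_def)
    have m1: "1 \<le> m - 1" using m by arith
    let ?z = "z (m - 1)"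
    have u1: "u (m - 1) 0 = ?z" by (simp add: u_def)
    have claim: "\<forall>a\<in>L_deg m d. \<forall>t\<in>Tp m. a = u m c * t \<longrightarrow> t \<in> L m" for d
    proof (induction d)
      case 0
      show ?case
      proof (intro ballI impI)
        fix a t assume "a \<in> L_deg m 0" "t \<in> Tp m" "a = u m c * t"
        then have "t = 0" using u_multiple_below[of t m c] L_sub_Tm[of a "m - 1"] m by auto
        then show "t \<in> L m" by (simp add: L_0)
      qed
    next
      case (Suc d)
      show ?case
      proof (intro ballI impI)
        fix a t assume a: "a \<in> L_deg m (Suc d)" and t: "t \<in> Tp m" "a = u m c * t"
        obtain b g where bg: "a = b + g * x m ^ Suc d" "b \<in> L_deg m d" "g \<in> L (m - 1)"
          using a by (rule L_deg_SucE)
        obtain b' s where b': "b' \<in> L (m - 1)" "s \<in> Tp m" "b * ?z ^ d = u m c * s + b'"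
          using L_deg_z_power[OF m less(2) c bg(2)] by blast
        obtain p r where p: "p \<in> L (m - 2)" "r \<in> Tp m" "p \<noteq> 0" "x m ^ Suc d * ?z ^ Suc d = u m c * r + p"
          using x_power_z_power[OF m less(2) c] by blast
        obtain g' where g': "g' \<in> Tp m" "g * u m c = u m c * g'"
          using u_normal_Tp[OF less(2) L_pred_in_Tp[OF bg(3)]] by blast
        have zL: "?z \<in> L (m - 1)" by (rule z_in_L) simp
        \<comment> \<open>The factor \<open>?z ^ Suc d\<close> removes \<open>x m\<close> from
          \<open>a\<close> modulo \<open>u m c\<close>. What remains is a multiple of
          \<open>u m c\<close> without \<open>z m\<close>, hence 0, and this yields
          \<open>g * p = - b' * ?z\<close>.\<close>
        have "u m c * (t * ?z ^ Suc d) = a * ?z ^ Suc d" by (simp only: t(2) mult.assoc)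
        also have "\<dots> = b * ?z ^ d * ?z + g * (x m ^ Suc d * ?z ^ Suc d)"
          by (simp only: bg(1) distrib_right mult.assoc power_Suc2[of ?z])
        also have "\<dots> = (u m c * s + b') * ?z + g * (u m c * r + p)"
          by (simp only: b'(3) p(4))
        also have "\<dots> = u m c * (s * ?z) + b' * ?z + ((g * u m c) * r + g * p)"
          by (simp only: distrib_left distrib_right mult.assoc)
        also have "\<dots> = u m c * (s * ?z + g' * r) + (b' * ?z + g * p)"
          by (simp only: g'(2) distrib_left mult.assoc add_ac)
        finally have "u m c * (t * ?z ^ Suc d - (s * ?z + g' * r)) = b' * ?z + g * p"
          by (simp add: right_diff_distrib)
        moreover have "t * ?z ^ Suc d - (s * ?z + g' * r) \<in> Tp m"
          using t b' g' p L_pred_in_Tp[OF zL] L_pred_in_Tp[OF L_power[OF zL]] by (intro mspan_diff mspan_add Tp_mult)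
        moreover have "m - 2 \<le> m - 1" by arith
        then have p1: "p \<in> L (m - 1)" using p(1) L_mono by blast
        have "b' * ?z + g * p \<in> L (m - 1)"
          using b' zL bg p1 by (intro L_add L_mult)
        ultimately have "t * ?z ^ Suc d - (s * ?z + g' * r) = 0"
          using u_multiple_below[of "t * ?z ^ Suc d - (s * ?z + g' * r)" m c] L_sub_Tm[of _ "m - 1"] m by simp
        then have "b' * ?z + g * p = 0"
          using \<open>u m c * (t * ?z ^ Suc d - (s * ?z + g' * r)) = b' * ?z + g * p\<close> by simp
        then have gp: "g * p = - b' * ?z" by (simp add: eq_neg_iff_add_eq_0 add.commute)
        \<comment> \<open>The remainder \<open>h0\<close> of \<open>g\<close> is 0: neither
          \<open>h0\<close> nor \<open>p\<close> involves \<open>z (m - 1)\<close>, so their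
          product, being a multiple of \<open>?z\<close>, vanishes, while \<open>p\<close> does not.
          This is why \<open>p\<close> is taken from \<open>L (m - 2)\<close>.\<close>
        obtain h h0 where h: "h \<in> Tp (m - 1)" "h0 \<in> Tm (m - 1 - 1)" "g = ?z * h + h0"
          using u_division_Tp[OF L_sub_Tp[OF bg(3)] m1, of 0] unfolding u1 by blast
        obtain b'' where b'': "b'' \<in> L (m - 1)" "- b' * ?z = ?z * b''"
          using u_normal[OF uc1 L_minus[OF b'(1)]] u1 by auto
        have "h0 * p = ?z * (b'' - h * p)"
          using gp h(3) b''(2) by (simp add: algebra_simps)
        moreover have "h0 * p \<in> Tm (m - 1 - 1)"
          using h(2) L_sub_Tm[OF p(1)] by (intro Tm_mult) (simp_all add: numeral_2_eq_2)
        moreover have "b'' - h * p \<in> Tp (m - 1)"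
          using b'' h p1 L_sub_Tp by (intro mspan_diff Tp_mult) auto
        ultimately have "b'' - h * p = 0"
          using u_multiple_below[of "b'' - h * p" "m - 1" 0] u1 m by simp
        then have "h0 * p = 0" using \<open>h0 * p = ?z * (b'' - h * p)\<close> by simp
        then have "h0 = 0" using T_no_zero_div[of h0 p] p h(2) mspan_in_T L_in_T by blast
        then have "g = ?z * h" using h by simp
        \<comment> \<open>The outer induction turns divisibility by \<open>?z\<close> in the torus
          into divisibility in \<open>L (m - 1)\<close>.\<close>
        then have "h \<in> L (m - 1)" using less(1)[of "m - 1" 0 h] uc1 u1 h(1) bg(3) m by simp
        then obtain h' where h': "h' \<in> L (m - 1)" "g = h' * ?z"
          using u_normal[OF uc1, of h] u1 \<open>g = ?z * h\<close> by auto
        have "h' \<in> L m" using h' L_mono[of "m - 1" m] by auto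
        then obtain h'' where h'': "h'' \<in> L m" "h' * u m c = u m c * h''"
          using u_normal[OF less(2)] by blast
        \<comment> \<open>With \<open>z m = u m c + sc c\<close> the leading term of
          \<open>a\<close> becomes a multiple of \<open>u m c\<close> plus a term of degree
          \<open>d\<close>, to which the inner induction applies.\<close>
        have zx: "?z * x m = z m + z (m - 2)"
          using z_Suc[of "m - 1"] m by (simp add: numeral_2_eq_2 Suc_diff_Suc)
        have "g * x m ^ Suc d = h' * (?z * x m) * x m ^ d"
          by (simp only: h'(2) power_Suc mult.assoc)
        also have "\<dots> = h' * (u m c + (sc c + z (m - 2))) * x m ^ d"
          by (simp only: zx) (simp add: u_def)
        also have "\<dots> = u m c * (h'' * x m ^ d) + (h' * (sc c + z (m - 2))) * x m ^ d"
          by (simp only: distrib_left[of h'] h''(2) distrib_right mult.assoc)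
        finally have "a = u m c * (h'' * x m ^ d) + (b + (h' * (sc c + z (m - 2))) * x m ^ d)"
          by (simp add: bg(1))
        then have eq: "b + (h' * (sc c + z (m - 2))) * x m ^ d = u m c * (t - h'' * x m ^ d)"
          using t(2) by (simp add: right_diff_distrib)
        have "h' * (sc c + z (m - 2)) \<in> L (m - 1)"
          using h' by (intro L_mult L_add L_sc z_in_L) auto
        then have "b + (h' * (sc c + z (m - 2))) * x m ^ d \<in> L_deg m d"
          using L_deg_add[OF bg(2) L_deg_monomial] by blast
        moreover have xL: "h'' * x m ^ d \<in> L m" using h'' m by (intro L_mult L_power L_x) auto
        moreover have "t - h'' * x m ^ d \<in> Tp m" using t(1) L_sub_Tp[OF xL] by (rule mspan_diff)
        ultimately have "t - h'' * x m ^ d \<in> L m" using Suc eq by blast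
        then show "t \<in> L m" using L_add[OF _ xL] by fastforce
      qed
    qed
    obtain d where "u m c * t \<in> L_deg m d" using L_in_L_deg[OF less(4)] m by auto
    then show ?thesis using claim less(3) by blast
  qed
qed

text \<open>Clear denominators in an element outside \<open>(z\<^sub>n - c) L\<^sub>n\<close> and specialise \<open>z\<^sub>n\<close> to \<open>c\<close>.\<close>

lemma specialise:
  assumes I: "ideal_in_L n I" and u_normal_pair: "u_normal_pair n c" and "u n c \<in> I" "a \<in> I" "a \<notin> (*) (u n c) ` L n"
  shows "\<exists>b\<in>I \<inter> Q (n - 1). b \<noteq> 0"
proof -
  have n: "1 \<le> n" using u_normal_pair by (simp add: u_normal_pair_def)
  have aL: "a \<in> L n" using ideal_in_L_L[OF I assms(4)] .
  obtain b where b: "b \<in> nn_ex (n - 1)" "E b * a \<in> Q n" using clear_denominators[OF L_sub_Tp[OF aL]] by blast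
  have bL: "E b \<in> L n" using E_nn_in_L b(1) L_mono[of "n - 1" n] by auto
  obtain t t0 where t: "t \<in> Q n" "t0 \<in> Q (n - 1)" "E b * a = u n c * t + t0"
    using u_division_Q[OF b(2) n] by blast
  have "u n c * t \<in> I" by (rule ideal_in_L_right[OF I assms(3) Q_sub_L[OF t(1)]])
  moreover have "E b * a \<in> I" by (rule ideal_in_L_left[OF I assms(4) bL])
  ultimately have "t0 \<in> I" using t(3) ideal_in_L_diff[OF I] by (metis add_diff_cancel_left')
  \<comment> \<open>If the specialised element were 0, comparing remainders would make
    \<open>a\<close> a multiple of \<open>u n c\<close> in \<open>Tp n\<close>, and by
    \<open>u_saturated\<close> also in \<open>L n\<close>.\<close>
  moreover have "t0 \<noteq> 0"
  proof
    assume "t0 = 0"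
    obtain s s0 where s: "s \<in> Tp n" "s0 \<in> Tm (n - 1)" "a = u n c * s + s0"
      using u_division_Tp[OF L_sub_Tp[OF aL] n] by blast
    obtain b' where b': "b' \<in> L n" "E b * u n c = u n c * b'" using u_normal[OF u_normal_pair bL] by blast
    have "u n c * (b' * s) + E b * s0 = E b * (u n c * s + s0)"
      by (simp only: distrib_left mult.assoc[symmetric] b'(2))
    also have "\<dots> = u n c * t" using s(3) t(3) \<open>t0 = 0\<close> by simp
    finally have eq: "u n c * (t - b' * s) = E b * s0"
      by (simp add: right_diff_distrib diff_eq_eq add.commute)
    moreover have "E b * s0 \<in> Tm (n - 1)"
      using b(1) s(2) by (intro Tm_mult mspan_E) (auto simp: nn_ex_def)
    moreover have "t - b' * s \<in> Tp n"
      using t(1) Q_sub_Tp b' s(1) L_sub_Tp by (intro mspan_diff Tp_mult) auto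
    ultimately have "t - b' * s = 0" using u_multiple_below[of _ n c] n by metis
    then have "E b * s0 = 0" using eq by simp
    then have "s0 = 0" using E_mult_nz mspan_in_T[OF s(2)] by blast
    then have "a = u n c * s" using s by simp
    then have "s \<in> L n" using u_saturated[OF u_normal_pair s(1)] aL by simp
    then show False using assms(5) \<open>a = u n c * s\<close> by blast
  qed
  ultimately show ?thesis using t(2) by blast
qed

section \<open>Prime ideals of the subalgebra\<close>

definition primeL :: "nat \<Rightarrow> (expo, 'k) lin_op set \<Rightarrow> bool" where
  "primeL n P \<longleftrightarrow> ideal_in_L n P \<and> 1 \<notin> P \<and>
     (\<forall>a\<in>L n. \<forall>b\<in>L n. (\<forall>r\<in>L n. a * r * b \<in> P) \<longrightarrow> a \<in> P \<or> b \<in> P)"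

text \<open>Linear factors of \<open>p\<close> are split off one at a time. Since \<open>t\<close>
  is central modulo \<open>P\<close>, the factor \<open>t - sc c\<close> passes any
  \<open>r\<close>, so primeness applies to the factorisation. The process cannot end in a nonzero
  constant because \<open>1 \<notin> P\<close>.\<close>

lemma prime_root:
  fixes t
  assumes P: "primeL n P" and t: "t \<in> L n" and comm: "\<And>r. r \<in> L n \<Longrightarrow> t * r - r * t \<in> P"
    and alg: "\<And>p :: 'k poly. 0 < degree p \<Longrightarrow> \<exists>c. poly p c = 0"
    and p: "poly_op p t \<in> P" "p \<noteq> 0"
  shows "\<exists>c. t - sc c \<in> P"
  using p
proof (induction "degree p" arbitrary: p)
  case 0
  have I: "ideal_in_L n P" and 1: "1 \<notin> P" using P by (auto simp: primeL_def)
  obtain c where "p = [:c:]" using 0(1) by (metis degree_eq_zeroE)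
  then have "sc c * 1 \<in> P" "c \<noteq> 0" using 0 by auto
  then show ?case using ideal_in_L_scD[OF I] 1 by blast
next
  case (Suc d)
  have I: "ideal_in_L n P" using P by (auto simp: primeL_def)
  obtain c where "poly p c = 0" using alg[of p] Suc(2) by auto
  then obtain p' where p': "p = [:- c, 1:] * p'" by (auto simp: poly_eq_0_iff_dvd dvd_def)
  then have p'0: "p' \<noteq> 0" using Suc by auto
  then have "d = degree p'" using Suc(2) degree_mult_eq[of "[:- c, 1:]" p'] p' by simp
  have fact: "(t - sc c) * poly_op p' t \<in> P" using Suc(3) p' poly_op_linear_mult by metis
  have "(t - sc c) * r * poly_op p' t \<in> P" if r: "r \<in> L n" for r
  proof -
    have "(t - sc c) * r * poly_op p' t = (t * r - r * t) * poly_op p' t + r * ((t - sc c) * poly_op p' t)"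
      by (simp add: algebra_simps sc_left_commute[of r])
    moreover have "(t * r - r * t) * poly_op p' t \<in> P"
      by (rule ideal_in_L_right[OF I comm[OF r] poly_op_in_L[OF t]])
    ultimately show ?thesis using ideal_in_L_add[OF I] ideal_in_L_left[OF I fact r] by metis
  qed
  moreover have "t - sc c \<in> L n" "poly_op p' t \<in> L n" using t by (auto intro: L_diff L_sc poly_op_in_L)
  ultimately have "t - sc c \<in> P \<or> poly_op p' t \<in> P" using P by (auto simp: primeL_def)
  then show ?case using Suc(1)[of p'] \<open>d = degree p'\<close> p'0 by blast
qed

lemma ideal_in_L_multiples:
  assumes "u_normal_pair n c"
  shows "ideal_in_L n ((*) (u n c) ` L n)"
  unfolding ideal_in_L_def
proof (intro conjI ballI)
  show "(*) (u n c) ` L n \<subseteq> L n" using u_in_L L_mult by blast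
  show "0 \<in> (*) (u n c) ` L n" using L_0 by (intro image_eqI[of _ _ 0]) auto
  fix a assume a: "a \<in> (*) (u n c) ` L n"
  then obtain a' where a': "a = u n c * a'" "a' \<in> L n" by blast
  show "a + b \<in> (*) (u n c) ` L n" if "b \<in> (*) (u n c) ` L n" for b
    using that a' L_add by (auto simp flip: distrib_left)
  show "a * r \<in> (*) (u n c) ` L n" if "r \<in> L n" for r
    using that a' L_mult by (auto simp: mult.assoc)
  show "r * a \<in> (*) (u n c) ` L n" if r: "r \<in> L n" for r
  proof -
    obtain r' where "r' \<in> L n" "r * u n c = u n c * r'" using u_normal[OF assms r] by blast
    then have "r * a = u n c * (r' * a')" by (simp only: a' mult.assoc[symmetric])
    then show ?thesis using L_mult[OF \<open>r' \<in> L n\<close> a'(2)] by blast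
  qed
qed

text \<open>Modulo \<open>u n c\<close> an element is represented by its remainder in
  \<open>Tm (n - 1)\<close>, and a product by the product of the remainders, which lies in a domain.
  A quotient found in \<open>Tp n\<close> is brought back to \<open>L n\<close> by
  \<open>u_saturated\<close>.\<close>

lemma primeL_multiples:
  assumes u_normal_pair: "u_normal_pair n c"
  shows "primeL n ((*) (u n c) ` L n)"
  unfolding primeL_def
proof (intro conjI ballI impI)
  have n: "1 \<le> n" using u_normal_pair by (simp add: u_normal_pair_def)
  have zeroD: "t = 0" if "t \<in> Tm (n - 1)" "t = u n c * s" "s \<in> Tp n" for t s
    using u_multiple_below[of s n c] that n by simp
  show "ideal_in_L n ((*) (u n c) ` L n)" by (rule ideal_in_L_multiples[OF u_normal_pair])
  show "1 \<notin> (*) (u n c) ` L n"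
    using zeroD[of 1] mspan_one[of _ 1] L_sub_Tp by fastforce
  fix a b assume a: "a \<in> L n" and b: "b \<in> L n" and ab: "\<forall>r\<in>L n. a * r * b \<in> (*) (u n c) ` L n"
  then obtain s where s: "s \<in> L n" "a * b = u n c * s" using L_1[of n] by fastforce
  obtain a' a0 where a': "a' \<in> Tp n" "a0 \<in> Tm (n - 1)" "a = u n c * a' + a0"
    using u_division_Tp[OF L_sub_Tp[OF a] n] by blast
  obtain b' b0 where b': "b' \<in> Tp n" "b0 \<in> Tm (n - 1)" "b = u n c * b' + b0"
    using u_division_Tp[OF L_sub_Tp[OF b] n] by blast
  have a0: "a0 \<in> Tp n" using a'(2) Tm_sub_Tp[of "n - 1"] n by auto
  obtain a1 where a1: "a1 \<in> Tp n" "a0 * u n c = u n c * a1" using u_normal_Tp[OF u_normal_pair a0] by blast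
  have "a * b = u n c * (a' * b) + (a0 * u n c) * b' + a0 * b0"
    by (subst a'(3)) (simp only: distrib_left distrib_right mult.assoc b'(3) add_ac)
  then have "a0 * b0 = u n c * (s - a' * b - a1 * b')"
    using s(2) by (simp add: a1(2) algebra_simps)
  moreover have "s - a' * b - a1 * b' \<in> Tp n"
    using s(1) a' b' a1 b L_sub_Tp by (intro mspan_diff Tp_mult) auto
  ultimately have "a0 * b0 = 0" using zeroD Tm_mult a' b' by blast
  then have "a0 = 0 \<or> b0 = 0" using T_no_zero_div a' b' mspan_in_T by blast
  then show "a \<in> (*) (u n c) ` L n \<or> b \<in> (*) (u n c) ` L n"
  proof
    assume "a0 = 0"
    then have "a = u n c * a'" using a' by simp
    then show ?thesis using u_saturated[OF u_normal_pair a'(1)] a by auto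
  next
    assume "b0 = 0"
    then have "b = u n c * b'" using b' by simp
    then show ?thesis using u_saturated[OF u_normal_pair b'(1)] b by auto
  qed
qed

lemma primeL_0: "primeL n {0}"
  unfolding primeL_def
proof (intro conjI ballI impI)
  show "ideal_in_L n {0}" by (simp add: ideal_in_L_def L_0)
  fix a b assume a: "a \<in> L n" and b: "b \<in> L n" and "\<forall>r\<in>L n. a * r * b \<in> {0}"
  then have "a * 1 * b = 0" using L_1 by blast
  then show "a \<in> {0} \<or> b \<in> {0}" using T_no_zero_div[OF L_in_T[OF a] L_in_T[OF b]] by simp
qed simp

text \<open>For fixed \<open>b\<close>, the elements \<open>c\<close> with
  \<open>c * r * b \<in> P\<close> for all \<open>r\<close> form an ideal containing
  \<open>P\<close>. If \<open>a\<close> makes it strictly larger, it contains 1, and then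
  \<open>b \<in> P\<close>.\<close>

lemma maximal_primeL:
  assumes I: "ideal_in_L n P" "1 \<notin> P" and max: "\<And>J. ideal_in_L n J \<Longrightarrow> P \<subseteq> J \<Longrightarrow> J \<noteq> P \<Longrightarrow> 1 \<in> J"
  shows "primeL n P"
  unfolding primeL_def
proof (intro conjI ballI impI)
  fix a b assume a: "a \<in> L n" and b: "b \<in> L n" and ab: "\<forall>r\<in>L n. a * r * b \<in> P"
  let ?J = "{c \<in> L n. \<forall>r\<in>L n. c * r * b \<in> P}"
  have J: "ideal_in_L n ?J"
    unfolding ideal_in_L_def
  proof (intro conjI ballI)
    show "0 \<in> ?J" using L_0 ideal_in_L_0[OF I(1)] by simp
    fix c assume c: "c \<in> ?J"
    show "c + d \<in> ?J" if "d \<in> ?J" for d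
      using c that by (auto simp: distrib_right intro: L_add ideal_in_L_add[OF I(1)])
    show "s * c \<in> ?J" if "s \<in> L n" for s
      using c that by (auto simp: mult.assoc intro: L_mult ideal_in_L_left[OF I(1)])
    show "c * s \<in> ?J" if s: "s \<in> L n" for s
    proof -
      have "c * s * r * b \<in> P" if "r \<in> L n" for r
        using c L_mult[OF s that] by (auto simp: mult.assoc)
      then show ?thesis using c s L_mult by blast
    qed
  qed auto
  have "P \<subseteq> ?J"
    using ideal_in_L_L[OF I(1)] ideal_in_L_right[OF I(1)] L_mult b by (auto simp: mult.assoc)
  show "a \<in> P \<or> b \<in> P"
  proof (cases "a \<in> P")
    case False
    then have "?J \<noteq> P" using a ab by blast
    then have "1 \<in> ?J" using max[OF J \<open>P \<subseteq> ?J\<close>] by blast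
    then have "1 * 1 * b \<in> P" using L_1 by blast
    then show ?thesis by simp
  qed simp
qed (use I in auto)

end

section \<open>Separating and removing monomials when \<open>q\<close> is not a root of
  unity\<close>

locale generic_qtorus = qtorus q for q :: "'k::field" +
  assumes nru: "0 < m \<Longrightarrow> q ^ m \<noteq> 1"
begin

lemma qp_eq_1_iff: "qp k = 1 \<longleftrightarrow> k = 0"
proof
  assume "qp k = 1"
  then have "q ^ nat \<bar>k\<bar> = 1"
    by (cases "0 \<le> k") (auto simp: power_int_def power_inverse)
  then show "k = 0" using nru[of "nat \<bar>k\<bar>"] by auto
qed simp

lemma qp_inj: "qp k = qp l \<longleftrightarrow> k = l"
proof
  assume "qp k = qp l"
  then have "qp (k - l) = 1" using qp_nz[of l] q_nz by (simp add: power_int_diff)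
  then show "k = l" using qp_eq_1_iff by simp
qed simp

text \<open>If \<open>z\<^sub>r\<close> is the last variable in a monomial, its \<open>q\<close>-commutator with \<open>x\<^sub>r\<^sub>+\<^sub>1\<close> replaces one
  factor \<open>z\<^sub>r\<close> by \<open>z\<^sub>r\<^sub>-\<^sub>1\<close>, so both \<open>z\<^sub>r\<close> and \<open>z\<^sub>r\<^sub>-\<^sub>1\<close> times the remaining monomial lie in the ideal.\<close>

lemma reduce_monomial:
  assumes I: "ideal_in_L n I" and m: "m \<le> n"
    and w: "\<And>i. 1 \<le> i \<Longrightarrow> i \<le> m \<Longrightarrow> \<exists>\<beta>. \<beta> \<noteq> 0 \<and> x i * w = sc \<beta> * (w * x i)"
    and a: "a \<in> nn_ex (m - 1)" "E a * w \<in> I"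
  shows "w \<in> I"
  using a
proof (induction rule: nn_ex_induct)
  case (add a r)
  let ?c = "a + e r" let ?s = "comm_exp ?c (e (Suc r) - e r)" let ?X = "x (Suc r)"
  have r: "Suc r \<le> m" "r \<le> n" "1 \<le> r" using add m by auto
  obtain \<beta> where \<beta>: "\<beta> \<noteq> 0" "?X * w = sc \<beta> * (w * ?X)" using w[of "Suc r"] r by auto
  define \<kappa> where "\<kappa> = qp ?s * (qp (- expt ?c r) - 1)"
  \<comment> \<open>The exponent of \<open>z r\<close> in \<open>?c\<close> is positive, so the
    error coefficient in \<open>E_x\<close> is nonzero because \<open>q\<close> is not a root of
    unity.\<close>
  have "0 \<le> expt a r" using add by (simp add: nn_ex_def)
  then have "expt ?c r \<noteq> 0" using r by (simp add: expt_e)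
  then have \<kappa>: "\<kappa> \<noteq> 0" using qp_nz[of ?s] qp_eq_1_iff[of "- expt ?c r"] by (simp add: \<kappa>_def)
  have X: "?X \<in> L n" using r m by (intro L_x) auto
  have "E ?c * ?X = sc (qp ?s) * (?X * E ?c) + sc \<kappa> * (E (- e r) * E (e (r - 1)) * E ?c)"
    using E_x[of ?c r] r by (simp add: \<kappa>_def)
  then have "E ?c * ?X * w = sc (qp ?s) * (?X * (E ?c * w)) + sc \<kappa> * (E (- e r) * E (e (r - 1)) * E ?c) * w"
    by (simp add: distrib_right mult.assoc)
  moreover have "E ?c * ?X * w = sc \<beta> * (E ?c * w * ?X)"
    by (simp add: mult.assoc \<beta> sc_left_commute[of "E _"])
  then have "E ?c * ?X * w \<in> I" using add X by (auto intro: ideal_in_L_sc[OF I] ideal_in_L_right[OF I])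
  moreover have "sc (qp ?s) * (?X * (E ?c * w)) \<in> I"
    using add X by (auto intro: ideal_in_L_sc[OF I] ideal_in_L_left[OF I])
  ultimately have "sc \<kappa> * (E (- e r) * E (e (r - 1)) * E ?c) * w \<in> I"
    using ideal_in_L_diff[OF I] by (metis add_diff_cancel_left')
  moreover have M: "E (- e r) * E (e (r - 1)) * E ?c =
      sc (qp (twist (- e r) (e (r - 1))) * qp (twist (- e r + e (r - 1)) ?c) * qp (- twist (e (r - 1)) a)) *
      (z (r - 1) * E a)"
  proof -
    have "- e r + e (r - 1) + ?c = e (r - 1) + a" by simp
    then have "E (- e r) * E (e (r - 1)) * E ?c =
      sc (qp (twist (- e r) (e (r - 1)))) * (sc (qp (twist (- e r + e (r - 1)) ?c)) * E (e (r - 1) + a))"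
      by (simp only: E_mult mult.assoc)
    then show ?thesis by (simp only: E_add[of "e (r - 1)"] sc_mult_assoc z_def mult.assoc)
  qed
  ultimately have "sc (\<kappa> * (qp (twist (- e r) (e (r - 1))) * qp (twist (- e r + e (r - 1)) ?c) * qp (- twist (e (r - 1)) a))) *
      (z (r - 1) * (E a * w)) \<in> I"
    by (simp only: M sc_mult_assoc) (simp only: sc_mult_assoc mult.assoc)
  then have "z (r - 1) * (E a * w) \<in> I"
    using ideal_in_L_scD[OF I] \<kappa> qp_nz by (metis mult_eq_0_iff)
  moreover have "z r * (E a * w) \<in> I"
  proof -
    have "E ?c * w = sc (qp (- twist (e r) a)) * (z r * (E a * w))"
      by (simp only: add.commute[of a] E_add z_def mult.assoc)
    then show ?thesis using add(5) ideal_in_L_scD[OF I] qp_nz by metis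
  qed
  ultimately have "E a * w \<in> I" using two_consecutive[OF I] r by blast
  then show ?case using add by blast
qed simp

text \<open>Take an element of minimal support: since \<open>q\<close> is not a root of unity, monomials that commute
  differently with some \<open>z\<^sub>j\<close> can be separated by a \<open>q\<close>-commutator.\<close>

lemma ideal_separation:
  assumes I: "ideal_in_L n I" and m: "1 \<le> m" "m \<le> n" and b: "b \<in> I" "b \<in> Q m" "b \<noteq> 0"
  shows "\<exists>b\<in>I \<inter> Q m. b \<noteq> 0 \<and>
    (\<forall>a\<in>supp b. \<forall>a'\<in>supp b. \<forall>i. i < m \<or> even m \<longrightarrow> expt a i = expt a' i)"
proof -
  define B where "B = {b \<in> I \<inter> Q m. b \<noteq> 0}"
  have "b \<in> B" using b by (auto simp: B_def)
  then obtain b where b: "b \<in> B" and min: "\<And>b'. b' \<in> B \<Longrightarrow> card (supp b) \<le> card (supp b')"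
    using arg_min_nat_lemma[of "\<lambda>b. b \<in> B" _ "\<lambda>b. card (supp b)"] that by blast
  have bQ: "b \<in> Q m" "b \<in> I" "b \<noteq> 0" using b by (auto simp: B_def)
  have fin: "finite (supp b)" using supp_mspan bQ by blast
  have same: "comm_exp a (e j) = comm_exp a1 (e j)" if a: "a \<in> supp b" "a1 \<in> supp b" and j: "j \<le> m" for a a1 j
  proof (rule ccontr)
    assume neq: "comm_exp a (e j) \<noteq> comm_exp a1 (e j)"
    \<comment> \<open>With this scalar the term at \<open>a1\<close> cancels, while the term at
      \<open>a\<close> survives by \<open>qp_inj\<close>. All exponents are shifted by
      \<open>e j\<close>, so the support becomes strictly smaller.\<close>
    define k where "k = qp (comm_exp a1 (e j))"
    define b' where "b' = b * z j - sc k * (z j * b)"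
    have bz: "b * z j = (\<Sum>c\<in>supp b. sc (coef b c) * (E c * E (e j)))"
      by (subst mspan_expand[OF bQ(1)]) (simp only: z_def sum_distrib_right mult.assoc)
    have zb: "z j * b = (\<Sum>c\<in>supp b. sc (coef b c) * (E (e j) * E c))"
      by (subst (1) mspan_expand[OF bQ(1)]) (simp only: z_def sum_distrib_left sc_left_commute[of "E _"])
    have b'_sum: "b' = (\<Sum>c\<in>supp b. sc (coef b c * (qp (comm_exp c (e j)) - k) * qp (twist (e j) c)) * E (e j + c))"
    proof -
      have "sc (coef b c) * (E c * E (e j)) - sc k * (sc (coef b c) * (E (e j) * E c)) =
          sc (coef b c * (qp (comm_exp c (e j)) - k) * qp (twist (e j) c)) * E (e j + c)" for c
      proof -
        have "sc (coef b c) * (E c * E (e j)) - sc k * (sc (coef b c) * (E (e j) * E c)) =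
            sc (coef b c * qp (comm_exp c (e j)) * qp (twist (e j) c) - k * coef b c * qp (twist (e j) c)) * E (e j + c)"
          by (simp only: E_comm[of c "e j"] E_mult[of "e j" c] sc_mult_assoc sc_diff left_diff_distrib mult.assoc)
        moreover have "coef b c * qp (comm_exp c (e j)) * qp (twist (e j) c) - k * coef b c * qp (twist (e j) c) =
            coef b c * (qp (comm_exp c (e j)) - k) * qp (twist (e j) c)"
          by (simp add: algebra_simps)
        ultimately show ?thesis by (simp only:)
      qed
      then show ?thesis
        by (simp only: b'_def bz zb sum_distrib_left sum_subtractf[symmetric])
    qed
    have coef_b': "coef b' d = (\<Sum>c\<in>supp b. if d = e j + c then coef b c * (qp (comm_exp c (e j)) - k) * qp (twist (e j) c) else 0)" for d
      unfolding b'_sum coef_sum coef_simps by (intro sum.cong) auto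
    have "supp b' \<subseteq> (+) (e j) ` (supp b - {a1})"
    proof
      fix d assume "d \<in> supp b'"
      then have "(\<Sum>c\<in>supp b. if d = e j + c then coef b c * (qp (comm_exp c (e j)) - k) * qp (twist (e j) c) else 0) \<noteq> 0"
        by (simp add: supp_def coef_b')
      then obtain c where "c \<in> supp b" "d = e j + c" "qp (comm_exp c (e j)) - k \<noteq> 0"
        by (auto elim!: sum.not_neutral_contains_not_neutral split: if_splits)
      then show "d \<in> (+) (e j) ` (supp b - {a1})" by (auto simp: k_def)
    qed
    then have "card (supp b') \<le> card ((+) (e j) ` (supp b - {a1}))"
      using fin by (intro card_mono) auto
    also have "\<dots> \<le> card (supp b - {a1})" using fin by (intro card_image_le) auto
    also have "\<dots> < card (supp b)" using a(2) fin by (metis card_Diff1_less)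
    finally have "b' \<notin> B" using min by (metis not_less)
    moreover have "b' \<in> I"
      unfolding b'_def using bQ(2) z_in_L[of j n] j m
      by (intro ideal_in_L_diff[OF I] ideal_in_L_sc[OF I] ideal_in_L_left[OF I, of b] ideal_in_L_right[OF I]) auto
    moreover have "b' \<in> Q m"
      unfolding b'_def z_def using bQ(1) j by (intro mspan_diff mspan_sc Q_mult mspan_E nn_ex_e)
    moreover have "coef b' (e j + a) = coef b a * (qp (comm_exp a (e j)) - k) * qp (twist (e j) a)"
      unfolding coef_b' using a(1) fin by (simp add: sum.delta)
    then have "coef b' (e j + a) \<noteq> 0"
      using a(1) neq qp_nz by (auto simp: supp_def k_def qp_inj)
    then have "b' \<noteq> 0" by (auto simp: coef_simps)
    ultimately show False by (simp add: B_def)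
  qed
  have "expt a i = expt a1 i" if a: "a \<in> supp b" "a1 \<in> supp b" and i: "i < m \<or> even m" for a a1 i
  proof -
    have up: "a \<in> upto_ex m" "a1 \<in> upto_ex m" using a supp_mspan[OF bQ(1)] by (auto simp: nn_ex_def)
    consider "i = 0" | "0 < i" "i < m" | "0 < i" "i = m" "even m" | "m < i" using i by linarith
    then show ?thesis
    proof cases
      case 1
      then show ?thesis using upto_ex_1_0 up by simp
    next
      case 2
      then show ?thesis using comm_exp_e_step[of i a] comm_exp_e_step[of i a1] same[OF a] by simp
    next
      case 3
      then have "comm_exp a (e (Suc m)) = 0" "comm_exp a1 (e (Suc m)) = 0"
        using up comm_exp_e_odd_top[of _ m "Suc m"] by auto
      then show ?thesis using 3 comm_exp_e_step[of m a] comm_exp_e_step[of m a1] same[OF a, of "m - 1"] by simp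
    next
      case 4
      then show ?thesis using upto_ex_ex up by simp
    qed
  qed
  then show ?thesis using bQ by blast
qed

lemma ideal_contains_product:
  assumes I: "ideal_in_L n I" and m: "1 \<le> m" "m \<le> n" and b: "b \<in> I" "b \<in> Q m" "b \<noteq> 0"
  shows "\<exists>a\<in>nn_ex (m - 1). \<exists>p. p \<noteq> 0 \<and> E a * poly_op p (z m) \<in> I \<and> (even m \<longrightarrow> (\<exists>k. p = monom 1 k))"
proof -
  obtain b where b: "b \<in> I" "b \<in> Q m" "b \<noteq> 0"
    and same: "\<And>a a' i. a \<in> supp b \<Longrightarrow> a' \<in> supp b \<Longrightarrow> i < m \<or> even m \<Longrightarrow> expt a i = expt a' i"
    using ideal_separation[OF assms] by blast
  have fin: "finite (supp b)" and sub: "supp b \<subseteq> nn_ex m" using supp_mspan[OF b(2)] by auto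
  have "supp b \<noteq> {}" using mspan_eq_0_iff b by blast
  then obtain a1 where a1: "a1 \<in> supp b" by blast
  \<comment> \<open>The exponents in the support differ at most in \<open>z m\<close>, so this is
    their common part with \<open>z m\<close> removed.\<close>
  define a where "a = a1 - e_mult m (nat (expt a1 m))"
  have a1m: "a1 \<in> upto_ex m" "0 \<le> expt a1 i" for i using a1 sub by (auto simp: nn_ex_def)
  have kem: "e_mult m k \<in> upto_ex m" for k using nn_ex_e_mult[of m m k] by (simp add: nn_ex_def)
  have am: "a \<in> upto_ex m" unfolding a_def using a1m kem by (intro upto_ex_diff)
  have expt_a: "expt a i = (if i = m then 0 else expt a1 i)" for i
    using m a1m(2)[of m] by (simp add: a_def expt_e_mult)
  have "a \<in> upto_ex (m - 1)"
  proof (rule upto_ex_shrink[OF am])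
    fix j assume "m - 1 < j" "j \<le> m"
    then have "j = m" by simp
    then show "expt a j = 0" by (simp add: expt_a)
  qed
  then have a: "a \<in> nn_ex (m - 1)" using a1m by (simp add: nn_ex_def expt_a)
  have dec: "c = a + e_mult m (nat (expt c m))" if c: "c \<in> supp b" for c
  proof (rule upto_ex_eqI[of _ m])
    show "c \<in> upto_ex m" using c sub by (auto simp: nn_ex_def)
    show "a + e_mult m (nat (expt c m)) \<in> upto_ex m" using am kem by (rule upto_ex_add)
    fix i assume i: "1 \<le> i" "i \<le> m"
    show "expt c i = expt (a + e_mult m (nat (expt c m))) i"
    proof (cases "i = m")
      case True
      then show ?thesis using c sub m by (auto simp: expt_a expt_e_mult nn_ex_def)
    next
      case False
      then show ?thesis using i same[OF c a1, of i] by (simp add: expt_a expt_e_mult)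
    qed
  qed
  \<comment> \<open>The correction absorbs the power of \<open>q\<close> that arises when
    \<open>E c\<close> is split into \<open>E a\<close> and a power of \<open>z m\<close>.\<close>
  define f where "f c = coef b c * qp (- twist a (e_mult m (nat (expt c m))))" for c
  define p where "p = (\<Sum>c\<in>supp b. monom (f c) (nat (expt c m)))"
  have "b = (\<Sum>c\<in>supp b. sc (coef b c) * E c)" by (rule mspan_expand[OF b(2)])
  also have "\<dots> = (\<Sum>c\<in>supp b. E a * (sc (f c) * z m ^ nat (expt c m)))"
  proof (intro sum.cong refl)
    fix c assume "c \<in> supp b"
    then have "E c = sc (qp (- twist a (e_mult m (nat (expt c m))))) * (E a * z m ^ nat (expt c m))"
      using dec[of c] E_add[of a "e_mult m (nat (expt c m))"] by (simp only: E_e_mult)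
    then show "sc (coef b c) * E c = E a * (sc (f c) * z m ^ nat (expt c m))"
      by (simp add: f_def sc_mult_assoc sc_left_commute[of "E a"])
  qed
  also have "\<dots> = E a * poly_op p (z m)"
    by (simp add: p_def poly_op_sum poly_op_monom sum_distrib_left)
  finally have bp: "b = E a * poly_op p (z m)" .
  show ?thesis
  proof (cases "even m")
    case False
    have "p \<noteq> 0" using bp b by auto
    then show ?thesis using a bp b False by blast
  next
    case True
    have "supp b = {a1}"
    proof -
      have "c = a1" if "c \<in> supp b" for c
        using dec[OF that] dec[OF a1] same[OF that a1, of m] True by simp
      then show ?thesis using a1 by blast
    qed
    then have "p = monom (f a1) (nat (expt a1 m))" by (simp add: p_def)
    then have "b = sc (f a1) * (E a * poly_op (monom 1 (nat (expt a1 m))) (z m))"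
      by (simp add: bp poly_op_monom sc_left_commute[of "E a"])
    moreover have "f a1 \<noteq> 0" using a1 qp_nz by (simp add: f_def supp_def)
    ultimately have "E a * poly_op (monom 1 (nat (expt a1 m))) (z m) \<in> I"
      using b(1) ideal_in_L_scD[OF I] by metis
    then show ?thesis using a by (intro bexI[of _ a] exI[of _ "monom 1 (nat (expt a1 m))"]) auto
  qed
qed

lemma x_z_power_comm:
  assumes "1 \<le> i" "i \<le> m"
  shows "\<exists>\<beta>. \<beta> \<noteq> 0 \<and> x i * z m ^ k = sc \<beta> * (z m ^ k * x i)"
proof -
  obtain l where l: "l \<noteq> 0" "z m * x i = sc l * (x i * z m)" using z_x_comm[OF assms] by blast
  have "z m ^ k * x i = sc (l ^ k) * (x i * z m ^ k)"
  proof (induction k)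
    case (Suc k)
    have "z m ^ Suc k * x i = z m ^ k * (z m * x i)" by (simp only: power_Suc2 mult.assoc)
    also have "\<dots> = sc l * ((z m ^ k * x i) * z m)"
      by (simp only: l(2) sc_left_commute[of "z m ^ k"] mult.assoc)
    also have "\<dots> = sc (l * l ^ k) * (x i * (z m ^ k * z m))"
      by (simp only: Suc mult.assoc sc_mult_assoc)
    finally show ?case by (simp only: power_Suc power_commutes)
  qed simp
  then have "x i * z m ^ k = sc (inverse (l ^ k)) * (z m ^ k * x i)"
    using l(1) by (simp add: sc_mult_assoc)
  then show ?thesis using l(1) by (metis nonzero_imp_inverse_nonzero power_not_zero)
qed

text \<open>\<open>reduce_monomial\<close> needs a cofactor that passes every \<open>x i\<close>
  with \<open>i \<le> m\<close> up to a scalar. For odd \<open>m\<close> any polynomial in the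
  central \<open>z m\<close> qualifies; for even \<open>m\<close> the cofactor is a power of
  \<open>z m\<close>, which is the reason for the last clause.\<close>

lemma ideal_meets:
  assumes I: "ideal_in_L n I" and m: "1 \<le> m" "m \<le> n" and b: "b \<in> I" "b \<in> Q m" "b \<noteq> 0"
  shows "\<exists>p. p \<noteq> 0 \<and> poly_op p (z m) \<in> I \<and> (even m \<longrightarrow> (\<exists>k. p = monom 1 k))"
proof -
  obtain a p where a: "a \<in> nn_ex (m - 1)" and p: "p \<noteq> 0" "E a * poly_op p (z m) \<in> I" "even m \<longrightarrow> (\<exists>k. p = monom 1 k)"
    using ideal_contains_product[OF assms] by blast
  have "\<exists>\<beta>. \<beta> \<noteq> 0 \<and> x i * poly_op p (z m) = sc \<beta> * (poly_op p (z m) * x i)" if i: "1 \<le> i" "i \<le> m" for i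
  proof (cases "even m")
    case True
    then obtain k where "p = monom 1 k" using p by blast
    then show ?thesis using x_z_power_comm[OF i, of k] by (simp add: poly_op_monom)
  next
    case False
    then have "x i * poly_op p (z m) = poly_op p (z m) * x i"
      using z_odd_central[OF False L_x[OF i]] by (intro poly_op_commute) simp
    then show ?thesis by (intro exI[of _ 1]) simp
  qed
  then have "poly_op p (z m) \<in> I" using reduce_monomial[OF I m(2) _ a p(2)] by blast
  then show ?thesis using p by blast
qed

text \<open>For \<open>m < n\<close> a power of \<open>z m\<close> is a monomial in
  \<open>z 1\<close>, ..., \<open>z (n - 1)\<close>, so \<open>reduce_monomial\<close> removes all
  of it and leaves the cofactor 1.\<close>

lemma z_power_unit:
  assumes I: "ideal_in_L n I" and "m < n" "z m ^ k \<in> I"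
  shows "1 \<in> I"
proof (rule reduce_monomial[OF I order_refl])
  show "e_mult m k \<in> nn_ex (n - 1)" using assms by (intro nn_ex_e_mult) simp
  show "E (e_mult m k) * 1 \<in> I" using assms by (simp add: E_e_mult)
  show "\<exists>\<beta>. \<beta> \<noteq> 0 \<and> x i * 1 = sc \<beta> * (1 * x i)" for i
    by (intro exI[of _ 1]) simp
qed

lemma nonzero_ideal_meets:
  assumes I: "ideal_in_L n I" "1 \<le> n" "a \<in> I" "a \<noteq> 0"
  shows "\<exists>p. p \<noteq> 0 \<and> poly_op p (z n) \<in> I \<and> (even n \<longrightarrow> (\<exists>k. p = monom 1 k))"
proof -
  have aL: "a \<in> L n" using ideal_in_L_L[OF I(1,3)] .
  obtain b where b: "b \<in> nn_ex (n - 1)" "E b * a \<in> Q n" using clear_denominators[OF L_sub_Tp[OF aL]] by blast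
  have "E b \<in> L n" using E_nn_in_L b(1) L_mono[of "n - 1" n] by auto
  then have "E b * a \<in> I" using ideal_in_L_left[OF I(1,3)] by blast
  moreover have "E b * a \<noteq> 0" using E_mult_nz L_in_T aL I(4) by blast
  ultimately show ?thesis using ideal_meets[OF I(1,2) order_refl] b by blast
qed

section \<open>Prime ideals for odd \<open>n\<close>\<close>

text \<open>As \<open>n - 1\<close> is even, the specialised ideal contains a power of
  \<open>z (n - 1)\<close> and not merely a polynomial in it, and \<open>z_power_unit\<close>
  applies.\<close>

lemma odd_multiples_maximal:
  assumes n: "odd n" "3 \<le> n" and I: "ideal_in_L n I" "u n c \<in> I" "a \<in> I" "a \<notin> (*) (u n c) ` L n"
  shows "1 \<in> I"
proof -
  have u_normal_pair: "u_normal_pair n c" using n by (simp add: u_normal_pair_def)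
  have n1: "1 \<le> n - 1" using n by arith
  obtain b where b: "b \<in> I" "b \<in> Q (n - 1)" "b \<noteq> 0" using specialise[OF I(1) u_normal_pair I(2-4)] by blast
  then obtain k where "poly_op (monom 1 k) (z (n - 1)) \<in> I"
    using ideal_meets[OF I(1) n1 _ b] n(1) by auto
  then have "z (n - 1) ^ k \<in> I" by (simp add: poly_op_monom)
  then show ?thesis using z_power_unit[OF I(1), of "n - 1" k] n1 by simp
qed

lemma odd_primes:
  assumes n: "odd n" "3 \<le> n" and alg: "\<And>p :: 'k poly. 0 < degree p \<Longrightarrow> \<exists>c. poly p c = 0"
  shows "primeL n P \<longleftrightarrow> P = {0} \<or> (\<exists>c. P = (*) (u n c) ` L n)"
proof
  assume P: "primeL n P"
  then have I: "ideal_in_L n P" "1 \<notin> P" by (auto simp: primeL_def)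
  show "P = {0} \<or> (\<exists>c. P = (*) (u n c) ` L n)"
  proof (cases "P = {0}")
    case False
    then obtain a where "a \<in> P" "a \<noteq> 0" using ideal_in_L_0[OF I(1)] by blast
    then obtain p where p: "p \<noteq> 0" "poly_op p (z n) \<in> P" using nonzero_ideal_meets[OF I(1)] n by auto
    have "z n * r - r * z n \<in> P" if "r \<in> L n" for r
      using z_odd_central[OF n(1) that] ideal_in_L_0[OF I(1)] by simp
    then obtain c where "z n - sc c \<in> P"
      using prime_root[OF P z_in_L[OF order_refl] _ alg p(2,1)] by blast
    then have c: "u n c \<in> P" by (simp add: u_def)
    have "P \<subseteq> (*) (u n c) ` L n" using odd_multiples_maximal[OF n I(1) c] I(2) by blast
    moreover have "(*) (u n c) ` L n \<subseteq> P" using ideal_in_L_right[OF I(1) c] by blast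
    ultimately show ?thesis by blast
  qed simp
next
  assume "P = {0} \<or> (\<exists>c. P = (*) (u n c) ` L n)"
  then show "primeL n P" using primeL_0 primeL_multiples n by (auto simp: u_normal_pair_def)
qed

section \<open>Prime ideals for even \<open>n\<close>\<close>

definition pair_ideal :: "nat \<Rightarrow> 'k \<Rightarrow> (expo, 'k) lin_op set" where
  "pair_ideal n c = {u (n - 1) c * a + z n * b | a b. a \<in> L n \<and> b \<in> L n}"

text \<open>\<open>z (n - 1)\<close> is already central in \<open>L (n - 1)\<close>, and its
  commutator with the remaining generator \<open>x n\<close> is
  \<open>sc (1 - inverse q) * z n\<close>.\<close>

lemma z_pred_central_mod:
  assumes n: "even n" "2 \<le> n" and I: "ideal_in_L n I" "z n \<in> I" and r: "r \<in> L n"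
  shows "z (n - 1) * r - r * z (n - 1) \<in> I"
  using r
proof induction
  case (L_sc k)
  then show ?case using ideal_in_L_0[OF I(1)] by (simp add: sc_comm)
next
  case (L_x i)
  show ?case
  proof (cases "i = n")
    case False
    then have "x i \<in> L (n - 1)" using L_x by (intro L.L_x) auto
    then have "z (n - 1) * x i = x i * z (n - 1)" using z_odd_central[of "n - 1"] n by auto
    then show ?thesis using ideal_in_L_0[OF I(1)] by simp
  next
    case True
    have z1: "z (n - 1) * x n = z n + z (n - 2)"
      using z_Suc[of "n - 1"] n by (simp add: numeral_2_eq_2 Suc_diff_Suc)
    have "E (e (n - 1)) * x n = sc (qp (comm_exp (e (n - 1)) (e n - e (n - 1)))) * (x n * E (e (n - 1))) +
      sc (qp (comm_exp (e (n - 1)) (e n - e (n - 1))) * (qp (- 1) - 1)) * (E (- e (n - 1)) * E (e (n - 2)) * E (e (n - 1)))"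
      using E_x[of "e (n - 1)" "n - 1"] n by (simp add: expt_e numeral_2_eq_2 Suc_diff_Suc)
    moreover have "comm_exp (e (n - 1)) (e n - e (n - 1)) = 1"
      using n by (simp add: comm_exp_simps comm_exp_e_e)
    moreover have "E (- e (n - 1)) * E (e (n - 2)) * E (e (n - 1)) = z (n - 2)"
    proof -
      have "comm_exp (e (n - 2)) (e (n - 1)) = 0" using n by (simp add: comm_exp_e_e)
      then have "E (e (n - 2)) * E (e (n - 1)) = E (e (n - 1)) * E (e (n - 2))"
        using E_comm[of "e (n - 2)" "e (n - 1)"] by simp
      then have "E (- e (n - 1)) * E (e (n - 2)) * E (e (n - 1)) = (E (- e (n - 1)) * E (e (n - 1))) * E (e (n - 2))"
        by (simp only: mult.assoc)
      then show ?thesis by (simp add: E_inverse z_def)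
    qed
    ultimately have "z (n - 1) * x n = sc q * (x n * z (n - 1)) + sc (1 - q) * z (n - 2)"
      using q_nz by (simp add: z_def right_diff_distrib)
    then have "sc q * (x n * z (n - 1)) = z n + sc q * z (n - 2)"
      using z1 by (simp add: sc_diff algebra_simps)
    then have "sc (inverse q) * (sc q * (x n * z (n - 1))) = sc (inverse q) * (z n + sc q * z (n - 2))"
      by (rule arg_cong)
    then have "x n * z (n - 1) = sc (inverse q) * z n + z (n - 2)"
      using q_nz by (simp add: distrib_left sc_mult_assoc)
    then have "z (n - 1) * x n - x n * z (n - 1) = z n - sc (inverse q) * z n"
      by (simp only: z1) simp
    then show ?thesis using True ideal_in_L_diff[OF I(1) I(2) ideal_in_L_sc[OF I]] by simp
  qed
next
  case (L_add r s)
  have "z (n - 1) * (r + s) - (r + s) * z (n - 1) =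
     (z (n - 1) * r - r * z (n - 1)) + (z (n - 1) * s - s * z (n - 1))"
    by (simp add: algebra_simps)
  then show ?case using ideal_in_L_add[OF I(1) L_add(3,4)] by simp
next
  case (L_mult r s)
  have "z (n - 1) * (r * s) - (r * s) * z (n - 1) =
     (z (n - 1) * r - r * z (n - 1)) * s + r * (z (n - 1) * s - s * z (n - 1))"
    by (simp add: algebra_simps)
  then show ?case
    using ideal_in_L_add[OF I(1) ideal_in_L_right[OF I(1) L_mult(3,2)] ideal_in_L_left[OF I(1) L_mult(4,1)]] by simp
qed

text \<open>The set is two-sided because \<open>z n\<close> is normal and \<open>z (n - 1)\<close>
  is central modulo \<open>z n\<close>: a left factor passes both generators up to multiples of
  \<open>z n\<close>.\<close>

lemma ideal_in_L_pair_ideal: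
  assumes n: "even n" "2 \<le> n"
  shows "ideal_in_L n (pair_ideal n c)"
proof -
  have ucn: "u_normal_pair n 0" using n by (simp add: u_normal_pair_def)
  have un: "u n 0 = z n" by (simp add: u_def)
  have Z: "ideal_in_L n ((*) (z n) ` L n)" using ideal_in_L_multiples[OF ucn] un by simp
  have zZ: "z n \<in> (*) (z n) ` L n" using L_1 by (intro image_eqI[of _ _ 1]) auto
  have uL: "u (n - 1) c \<in> L n" using u_in_L L_mono[of "n - 1" n] by auto
  have zL: "z n \<in> L n" by (rule z_in_L) simp
  show ?thesis
    unfolding ideal_in_L_def
  proof (intro conjI ballI)
    show "pair_ideal n c \<subseteq> L n" using uL zL by (auto simp: pair_ideal_def intro!: L_add L_mult)
    have "0 = u (n - 1) c * 0 + z n * 0" by simp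
    then show "0 \<in> pair_ideal n c" unfolding pair_ideal_def using L_0 by blast
    fix s assume "s \<in> pair_ideal n c"
    then obtain a b where ab: "s = u (n - 1) c * a + z n * b" "a \<in> L n" "b \<in> L n" by (auto simp: pair_ideal_def)
    show "s + t \<in> pair_ideal n c" if "t \<in> pair_ideal n c" for t
    proof -
      obtain a' b' where ab': "t = u (n - 1) c * a' + z n * b'" "a' \<in> L n" "b' \<in> L n"
        using \<open>t \<in> pair_ideal n c\<close> by (auto simp: pair_ideal_def)
      have "s + t = u (n - 1) c * (a + a') + z n * (b + b')"
        by (simp only: ab ab' distrib_left add_ac)
      then show ?thesis unfolding pair_ideal_def using ab ab' L_add by blast
    qed
    show "s * r \<in> pair_ideal n c" if "r \<in> L n" for r
    proof -
      have "s * r = u (n - 1) c * (a * r) + z n * (b * r)"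
        by (simp only: ab distrib_right mult.assoc)
      then show ?thesis unfolding pair_ideal_def using ab \<open>r \<in> L n\<close> L_mult by blast
    qed
    show "r * s \<in> pair_ideal n c" if r: "r \<in> L n" for r
    proof -
      have "z (n - 1) * r - r * z (n - 1) \<in> (*) (z n) ` L n"
        by (rule z_pred_central_mod[OF n Z zZ r])
      then obtain d where d: "d \<in> L n" "z (n - 1) * r - r * z (n - 1) = z n * d" by blast
      obtain r' where r': "r' \<in> L n" "r * z n = z n * r'" using u_normal[OF ucn r] un by auto
      have "r * u (n - 1) c = u (n - 1) c * r - z n * d"
        by (simp add: u_def algebra_simps sc_comm flip: d(2))
      then have "r * s = (u (n - 1) c * r - z n * d) * a + z n * r' * b"
        by (simp only: ab distrib_left mult.assoc[symmetric] r'(2))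
      also have "\<dots> = u (n - 1) c * (r * a) + z n * (r' * b - d * a)"
        by (simp add: algebra_simps)
      finally have "r * s = u (n - 1) c * (r * a) + z n * (r' * b - d * a)" .
      moreover have "r * a \<in> L n" "r' * b - d * a \<in> L n"
        using r ab r' d by (auto intro: L_mult L_diff)
      ultimately show ?thesis unfolding pair_ideal_def by blast
    qed
  qed
qed

text \<open>After reduction modulo \<open>z n\<close>, a representation of 1 would give
  \<open>z (n - 1) - sc c\<close> an inverse in the torus. For \<open>c \<noteq> 0\<close> it has
  two terms, so its product with a nonzero element has at least two terms.\<close>

lemma pair_ideal_proper:
  assumes n: "even n" "2 \<le> n" and c: "c \<noteq> 0"
  shows "1 \<notin> pair_ideal n c"
proof
  assume "1 \<in> pair_ideal n c"
  then obtain a b where ab: "1 = u (n - 1) c * a + z n * b" "a \<in> L n" "b \<in> L n" by (auto simp: pair_ideal_def)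
  have ucn: "u_normal_pair n 0" using n by (simp add: u_normal_pair_def)
  have un: "u n 0 = z n" by (simp add: u_def)
  let ?u = "u (n - 1) c"
  have uT: "?u \<in> Tm (n - 1)" using u_in_Tp Tp_sub_Tm by blast
  then have uTp: "?u \<in> Tp n" using Tm_sub_Tp[of "n - 1"] n by auto
  obtain a' t where t: "a' \<in> Tp n" "t \<in> Tm (n - 1)" "a = z n * a' + t"
    using u_division_Tp[OF L_sub_Tp[OF ab(2)], of 0] n un by auto
  obtain v where v: "v \<in> Tp n" "?u * z n = z n * v" using u_normal_Tp[OF ucn uTp] un by auto
  have "1 = ?u * z n * a' + ?u * t + z n * b"
    by (subst ab(1)) (simp only: t(3) distrib_left mult.assoc)
  then have "1 - ?u * t = ?u * z n * a' + z n * b"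
    by (rule subst[of _ _ "\<lambda>s. s - ?u * t = _", OF sym]) simp
  then have "1 - ?u * t = z n * (v * a' + b)"
    by (simp only: v(2) distrib_left mult.assoc)
  moreover have "1 - ?u * t \<in> Tm (n - 1)"
    using uT t mspan_one[of "upto_ex (n - 1)" 1] by (intro mspan_diff Tm_mult) auto
  moreover have "v * a' + b \<in> Tp n" using v t ab L_sub_Tp by (intro mspan_add Tp_mult) auto
  ultimately have "v * a' + b = 0" using u_multiple_below[of "v * a' + b" n 0] un n by simp
  then have ut: "?u * t = 1" using \<open>1 - ?u * t = z n * (v * a' + b)\<close> by simp
  have T: "?u \<in> T" "t \<in> T" "t \<noteq> 0" using uT t mspan_in_T ut by auto
  have n1: "1 \<le> n - 1" using n by auto
  have coef_1: "coef 1 d = (if d = 0 then 1 else 0)" for d using coef_simps(5)[of 0 d] by simp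
  have "lead (1 :: (expo, 'k) lin_op) = 0"
    using mspan_in_T[OF mspan_one[of UNIV 1]] by (intro lead_eqI) (auto simp: supp_def coef_1 split: if_splits)
  then have "e (n - 1) + lead t = 0"
    using lead_mult(2)[of ?u t] T lead_u[OF n1, of c] ut by simp
  then have "lead t = - e (n - 1)" by (simp add: eq_neg_iff_add_eq_0 add.commute)
  moreover have "0 < e (n - 1)" using n1 by (intro e_pos) arith
  ultimately have ldt: "lead t < 0" by simp
  \<comment> \<open>The leading term has already forced \<open>lead t < 0\<close>. The lowest
    exponent of \<open>t\<close> is met only by the constant \<open>- c\<close>, so it survives in
    the product and would have to be 0.\<close>
  define s where "s = Min (supp t)"
  have fin: "finite (supp t)" "supp t \<noteq> {}" using supp_mspan[OF T(2)] mspan_eq_0_iff T by auto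
  have sS: "s \<in> supp t" using fin by (simp add: s_def)
  have "s - e (n - 1) \<notin> supp t"
  proof
    assume "s - e (n - 1) \<in> supp t"
    then have "s \<le> s - e (n - 1)" using fin by (simp add: s_def)
    then have "e (n - 1) \<le> 0" by simp
    moreover have "0 < e (n - 1)" using n1 by (intro e_pos) arith
    ultimately show False by simp
  qed
  then have "coef (z (n - 1) * t) s = 0" by (simp add: z_def coef_E_mult supp_def)
  then have "coef (?u * t) s = - (c * coef t s)"
    by (simp add: u_def left_diff_distrib coef_simps)
  then have "- (c * coef t s) = (if s = 0 then 1 else 0)" by (simp only: ut coef_1)
  moreover have "c * coef t s \<noteq> 0" using sS c by (simp add: supp_def)
  ultimately have "s = 0" by (auto split: if_splits)
  then show False using ldt lead_ge[OF T(2) sS] by simp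
qed

text \<open>Modulo the pair, \<open>c x\<^sub>n = z\<^sub>n\<^sub>-\<^sub>1 x\<^sub>n = z\<^sub>n\<^sub>-\<^sub>2\<close>, so \<open>x\<^sub>n\<close> is redundant.\<close>

lemma pair_ideal_reduce:
  assumes n: "even n" "2 \<le> n" and c: "c \<noteq> 0" and r: "r \<in> L n"
  shows "\<exists>s\<in>L (n - 1). r - s \<in> pair_ideal n c"
  using r
proof induction
  case (L_sc k)
  then show ?case using L.L_sc ideal_in_L_0[OF ideal_in_L_pair_ideal[OF n]] by (intro bexI[of _ "sc k"]) auto
next
  case (L_x i)
  show ?case
  proof (cases "i = n")
    case False
    then have "x i \<in> L (n - 1)" using L_x by (intro L.L_x) auto
    then show ?thesis using ideal_in_L_0[OF ideal_in_L_pair_ideal[OF n]] by (intro bexI[of _ "x i"]) auto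
  next
    case True
    have z1: "z (n - 1) * x n = z n + z (n - 2)"
      using z_Suc[of "n - 1"] n by (simp add: numeral_2_eq_2 Suc_diff_Suc)
    have xn: "x n \<in> L n" using L.L_x[of n n] n by simp
    have "sc c * x n - z (n - 2) = u (n - 1) c * (- x n) + z n * 1"
      using z1 by (simp add: u_def algebra_simps)
    then have "sc c * x n - z (n - 2) \<in> pair_ideal n c"
      unfolding pair_ideal_def using L_minus[OF xn] L_1 by blast
    then have "sc (inverse c) * (sc c * x n - z (n - 2)) \<in> pair_ideal n c"
      by (rule ideal_in_L_sc[OF ideal_in_L_pair_ideal[OF n]])
    then have "x n - sc (inverse c) * z (n - 2) \<in> pair_ideal n c"
      using c by (simp add: right_diff_distrib sc_mult_assoc)
    moreover have "sc (inverse c) * z (n - 2) \<in> L (n - 1)" by (intro L.L_mult L.L_sc z_in_L) simp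
    ultimately show ?thesis using True by blast
  qed
next
  case (L_add r s)
  then obtain r' s' where "r' \<in> L (n - 1)" "s' \<in> L (n - 1)" and P: "r - r' \<in> pair_ideal n c" "s - s' \<in> pair_ideal n c" by blast
  moreover have "(r + s) - (r' + s') = (r - r') + (s - s')" by simp
  ultimately show ?case using ideal_in_L_add[OF ideal_in_L_pair_ideal[OF n] P] L.L_add by metis
next
  case (L_mult r s)
  then obtain r' s' where L: "r' \<in> L (n - 1)" "s' \<in> L (n - 1)" and P: "r - r' \<in> pair_ideal n c" "s - s' \<in> pair_ideal n c" by blast
  have "r' \<in> L n" using L L_mono[of "n - 1" n] by auto
  then have "(r - r') * s + r' * (s - s') \<in> pair_ideal n c"
    using L_mult ideal_in_L_add[OF ideal_in_L_pair_ideal[OF n] ideal_in_L_right[OF ideal_in_L_pair_ideal[OF n] P(1)] ideal_in_L_left[OF ideal_in_L_pair_ideal[OF n] P(2)]] by blast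
  moreover have "(r - r') * s + r' * (s - s') = r * s - r' * s'" by (simp add: algebra_simps)
  ultimately show ?case using L.L_mult[OF L] by metis
qed

text \<open>By \<open>pair_ideal_reduce\<close> a strictly larger ideal contains an element of
  \<open>L (n - 1)\<close> that is not a multiple of \<open>u (n - 1) c\<close>, so
  \<open>odd_multiples_maximal\<close> applies to the intersection with \<open>L (n - 1)\<close>.
  The bound on \<open>n\<close> is what that lemma asks of \<open>n - 1\<close>.\<close>

lemma pair_ideal_maximal:
  assumes n: "even n" "4 \<le> n" and c: "c \<noteq> 0" and J: "ideal_in_L n J" "pair_ideal n c \<subseteq> J" "J \<noteq> pair_ideal n c"
  shows "1 \<in> J"
proof -
  have n2: "2 \<le> n" and n1: "odd (n - 1)" "3 \<le> n - 1" using n by auto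
  have I: "ideal_in_L n (pair_ideal n c)" by (rule ideal_in_L_pair_ideal[OF n(1) n2])
  obtain a where a: "a \<in> J" "a \<notin> pair_ideal n c" using J by blast
  obtain s where s: "s \<in> L (n - 1)" "a - s \<in> pair_ideal n c"
    using pair_ideal_reduce[OF n(1) n2 c] ideal_in_L_L[OF J(1) a(1)] by blast
  have "a - (a - s) \<in> J" using ideal_in_L_diff[OF J(1)] a s J(2) by blast
  then have sJ: "s \<in> J" by simp
  have sP: "s \<notin> pair_ideal n c"
  proof
    assume "s \<in> pair_ideal n c"
    then have "(a - s) + s \<in> pair_ideal n c" using ideal_in_L_add[OF I s(2)] by blast
    then show False using a by simp
  qed
  have sub: "L (n - 1) \<subseteq> L n" by (rule L_mono) simp
  have J1: "ideal_in_L (n - 1) (J \<inter> L (n - 1))"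
    unfolding ideal_in_L_def using ideal_in_L_0[OF J(1)] ideal_in_L_add[OF J(1)] ideal_in_L_left[OF J(1)] ideal_in_L_right[OF J(1)] sub
    by (auto intro: L_0 L_add L_mult)
  have "u (n - 1) c = u (n - 1) c * 1 + z n * 0" by simp
  then have uP: "u (n - 1) c \<in> pair_ideal n c" unfolding pair_ideal_def using L_0 L_1 by blast
  have "s \<notin> (*) (u (n - 1) c) ` L (n - 1)"
    using ideal_in_L_right[OF I uP] sP sub by blast
  then have "1 \<in> J \<inter> L (n - 1)"
    using odd_multiples_maximal[OF n1 J1, of c s] uP J(2) u_in_L sJ s(1) by blast
  then show ?thesis by blast
qed

lemma even_primes:
  assumes n: "even n" "3 \<le> n" and alg: "\<And>p :: 'k poly. 0 < degree p \<Longrightarrow> \<exists>c. poly p c = 0"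
  shows "primeL n P \<longleftrightarrow> P = {0} \<or> P = (*) (z n) ` L n \<or> (\<exists>c. c \<noteq> 0 \<and> P = pair_ideal n c)"
proof
  have ucn: "u_normal_pair n 0" using n by (simp add: u_normal_pair_def)
  have un: "u n 0 = z n" by (simp add: u_def)
  have n4: "4 \<le> n" using n by (cases "n = 3") auto
  then have n1: "1 \<le> n - 1" by arith
  {
    assume P: "primeL n P"
    then have I: "ideal_in_L n P" "1 \<notin> P" by (auto simp: primeL_def)
    show "P = {0} \<or> P = (*) (z n) ` L n \<or> (\<exists>c. c \<noteq> 0 \<and> P = pair_ideal n c)"
    proof (cases "P = {0} \<or> P = (*) (z n) ` L n")
      case False
      then obtain a where "a \<in> P" "a \<noteq> 0" using ideal_in_L_0[OF I(1)] by blast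
      then obtain k where k: "z n ^ k \<in> P" using nonzero_ideal_meets[OF I(1)] n by (fastforce simp: poly_op_monom)
      \<comment> \<open>As \<open>z n\<close> is normal, \<open>z n ^ k * r * z n\<close> is a
        multiple of \<open>z n ^ Suc k\<close>, and primeness lowers the exponent until
        \<open>z n\<close> itself is reached.\<close>
      have zn: "z n \<in> P"
        using k
      proof (induction k)
        case 0
        then show ?case using I by simp
      next
        case (Suc k)
        have zL: "z n \<in> L n" by (rule z_in_L) simp
        have "z n ^ k * r * z n \<in> P" if r: "r \<in> L n" for r
        proof -
          obtain r' where r': "r' \<in> L n" "r * z n = z n * r'" using u_normal[OF ucn r] un by auto
          have "z n ^ k * r * z n = z n ^ Suc k * r'"
            by (simp only: mult.assoc r'(2) power_Suc2)
          then show ?thesis using ideal_in_L_right[OF I(1) Suc(2) r'(1)] by simp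
        qed
        then have "z n ^ k \<in> P \<or> z n \<in> P" using P zL L_power[OF zL] by (auto simp: primeL_def)
        then show ?case using Suc by blast
      qed
      have "(*) (z n) ` L n \<subseteq> P" using ideal_in_L_right[OF I(1) zn] by blast
      then obtain a where a: "a \<in> P" "a \<notin> (*) (z n) ` L n" using False by blast
      then obtain b where b: "b \<in> P" "b \<in> Q (n - 1)" "b \<noteq> 0"
        using specialise[OF I(1) ucn] zn un by auto
      then obtain p where p: "p \<noteq> 0" "poly_op p (z (n - 1)) \<in> P"
        using ideal_meets[OF I(1) n1 _ b] by auto
      have "z (n - 1) * r - r * z (n - 1) \<in> P" if "r \<in> L n" for r
        using z_pred_central_mod[OF n(1) _ I(1) zn that] n by simp
      then obtain c where "z (n - 1) - sc c \<in> P"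
        using prime_root[OF P z_in_L _ alg p(2,1)] by auto
      then have uP: "u (n - 1) c \<in> P" by (simp add: u_def)
      have "c \<noteq> 0"
      proof
        assume "c = 0"
        then have "z (n - 1) ^ 1 \<in> P" using uP by (simp add: u_def)
        then show False using z_power_unit[OF I(1), of "n - 1" 1] I(2) n by simp
      qed
      moreover have "pair_ideal n c \<subseteq> P"
        using ideal_in_L_add[OF I(1) ideal_in_L_right[OF I(1) uP] ideal_in_L_right[OF I(1) zn]] by (auto simp: pair_ideal_def)
      then have "P = pair_ideal n c" using pair_ideal_maximal[OF n(1) n4 \<open>c \<noteq> 0\<close> I(1)] I(2) by blast
      ultimately show ?thesis by blast
    qed blast
  }
  assume "P = {0} \<or> P = (*) (z n) ` L n \<or> (\<exists>c. c \<noteq> 0 \<and> P = pair_ideal n c)"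
  moreover have "primeL n (pair_ideal n c)" if "c \<noteq> 0" for c
    using n n4 that pair_ideal_maximal ideal_in_L_pair_ideal pair_ideal_proper by (intro maximal_primeL) auto
  ultimately show "primeL n P" using primeL_0 primeL_multiples[OF ucn] un by auto
qed

end

section \<open>The presented algebra\<close>

text \<open>The product of \<open>free_alg n\<close>, written without \<open>n\<close>, on which it
  does not depend.\<close>

definition conv :: "(nat list \<Rightarrow> 'k::field) \<Rightarrow> (nat list \<Rightarrow> 'k) \<Rightarrow> nat list \<Rightarrow> 'k" where
  "conv f g w = (\<Sum>i\<le>length w. f (take i w) * g (drop i w))"

definition word :: "nat list \<Rightarrow> nat list \<Rightarrow> 'k::field" where
  "word v = (\<lambda>w. if w = v then 1 else 0)"

lemma free_alg_simps:
  "f \<otimes>\<^bsub>free_alg n\<^esub> g = conv f g" "f \<oplus>\<^bsub>free_alg n\<^esub> g = (\<lambda>w. f w + g w)"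
  "\<zero>\<^bsub>free_alg n\<^esub> = (\<lambda>w. 0)" "\<one>\<^bsub>free_alg n\<^esub> = word []"
  by (simp_all add: free_alg_def conv_def[abs_def] word_def)

lemma free_alg_carrier:
  "f \<in> carrier (free_alg n) \<longleftrightarrow> finite {w. f w \<noteq> 0} \<and> (\<forall>w. f w \<noteq> 0 \<longrightarrow> set w \<subseteq> {1..n})"
  by (simp add: free_alg_def)

lemma free_alg_minus:
  assumes "f \<in> carrier (free_alg n)" "g \<in> carrier (free_alg n)"
  shows "f \<ominus>\<^bsub>free_alg n\<^esub> g = (\<lambda>w. f w - g w)"
proof -
  interpret F: ring "free_alg n :: (nat list \<Rightarrow> 'a) ring" by (rule ring_free_alg)
  have m: "(\<lambda>w. - g w) \<in> carrier (free_alg n)" using assms(2) by (simp add: free_alg_carrier)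
  have "\<ominus>\<^bsub>free_alg n\<^esub> g = (\<lambda>w. - g w)"
    using F.minus_equality[OF _ assms(2) m] by (simp add: free_alg_simps)
  then show ?thesis by (simp add: F.minus_eq free_alg_simps)
qed

lemma conv_linear:
  "conv (\<lambda>w. f w + g w) h = (\<lambda>w. conv f h w + conv g h w)"
  "conv h (\<lambda>w. f w + g w) = (\<lambda>w. conv h f w + conv h g w)"
  "conv (\<lambda>w. f w - g w) h = (\<lambda>w. conv f h w - conv g h w)"
  "conv h (\<lambda>w. f w - g w) = (\<lambda>w. conv h f w - conv h g w)"
  "conv (\<lambda>w. c * f w) h = (\<lambda>w. c * conv f h w)"
  "conv h (\<lambda>w. c * f w) = (\<lambda>w. c * conv h f w)"
  "conv (\<lambda>w. 0) h = (\<lambda>w. 0)"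
  by (auto simp: conv_def fun_eq_iff sum.distrib sum_subtractf sum_distrib_left algebra_simps)

lemma conv_word: "conv (word u) (word v) = word (u @ v)"
proof
  fix w
  have "conv (word u) (word v) w = (\<Sum>i\<le>length w. if i = length u then (if w = u @ v then 1 else 0) else 0)"
    unfolding conv_def
  proof (intro sum.cong refl)
    fix i assume "i \<in> {..length w}"
    then have iff: "take i w = u \<and> drop i w = v \<longleftrightarrow> i = length u \<and> w = u @ v"
      by (metis append_eq_conv_conj append_take_drop_id atMost_iff length_take min.absorb2)
    have "word u (take i w) * word v (drop i w) = (if take i w = u \<and> drop i w = v then 1 else 0)"
      by (simp add: word_def)
    also have "\<dots> = (if i = length u then (if w = u @ v then 1 else 0) else 0)"
      unfolding iff by simp
    finally show "word u (take i w) * word v (drop i w) =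
        (if i = length u then (if w = u @ v then 1 else 0) else 0)" .
  qed
  also have "\<dots> = word (u @ v) w" by (auto simp: word_def)
  finally show "conv (word u) (word v) w = word (u @ v) w" .
qed

lemma free_var_word: "free_var i = word [i]"
  by (simp add: free_var_def word_def)

lemma free_const_word: "free_const c = (\<lambda>w. c * word [] w)"
  by (auto simp: free_const_def word_def)

lemma word_closed: "word v \<in> carrier (free_alg n) \<longleftrightarrow> set v \<subseteq> {1..n}"
  by (auto simp: free_alg_carrier word_def)

lemma conv_one: "conv (word []) f = f" "f \<in> carrier (free_alg n) \<Longrightarrow> conv f (word []) = f"
proof -
  interpret F: ring "free_alg n :: (nat list \<Rightarrow> 'a) ring" by (rule ring_free_alg)
  show "f \<in> carrier (free_alg n) \<Longrightarrow> conv f (word []) = f"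
    using F.r_one[of f] by (simp add: free_alg_simps)
  show "conv (word []) f = f"
  proof
    fix w
    have "conv (word []) f w = (\<Sum>i\<le>length w. if i = 0 then f w else 0)"
      unfolding conv_def by (intro sum.cong) (auto simp: word_def)
    then show "conv (word []) f w = f w" by simp
  qed
qed

inductive_set wspan :: "nat list set \<Rightarrow> (nat list \<Rightarrow> 'k::field) set" for W where
  wspan_0: "(\<lambda>w. 0) \<in> wspan W"
| wspan_step: "v \<in> W \<Longrightarrow> f \<in> wspan W \<Longrightarrow> (\<lambda>w. c * word v w + f w) \<in> wspan W"

lemma wspan_add: "f \<in> wspan W \<Longrightarrow> g \<in> wspan W \<Longrightarrow> (\<lambda>w. f w + g w) \<in> wspan W"
  by (induction rule: wspan.induct) (auto simp: add.assoc intro: wspan.intros)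

lemma wspan_scale: "f \<in> wspan W \<Longrightarrow> (\<lambda>w. c * f w) \<in> wspan W"
  by (induction rule: wspan.induct) (auto simp: distrib_left mult.assoc[symmetric] intro: wspan.intros)

lemma wspan_word: "v \<in> W \<Longrightarrow> word v \<in> wspan W"
  using wspan_step[OF _ wspan_0, of v W 1] by simp

lemma wspan_conv_word:
  assumes "f \<in> wspan W" "\<And>w. w \<in> W \<Longrightarrow> w @ v \<in> V"
  shows "conv f (word v) \<in> wspan V"
  using assms(1) by induction (auto simp: conv_linear conv_word assms(2) intro: wspan.intros)

lemma wspan_carrier:
  assumes "f \<in> wspan W" "\<And>w. w \<in> W \<Longrightarrow> set w \<subseteq> {1..n}"
  shows "f \<in> carrier (free_alg n)" and "{w. f w \<noteq> 0} \<subseteq> W"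
proof -
  have "f \<in> carrier (free_alg n) \<and> {w. f w \<noteq> 0} \<subseteq> W"
    using assms(1)
  proof induction
    case (wspan_step v f c)
    have "(\<lambda>w. c * word v w) \<in> carrier (free_alg n)"
      using assms(2)[OF wspan_step(1)] by (auto simp: free_alg_carrier word_def)
    then have "(\<lambda>w. c * word v w + f w) \<in> carrier (free_alg n)"
      using free_alg_add_closed[of "\<lambda>w. c * word v w" n f] wspan_step by (simp add: free_alg_simps)
    moreover have "{w. c * word v w + f w \<noteq> 0} \<subseteq> W"
      using wspan_step by (auto simp: word_def split: if_splits)
    ultimately show ?case by blast
  qed (simp add: free_alg_carrier)
  then show "f \<in> carrier (free_alg n)" "{w. f w \<noteq> 0} \<subseteq> W" by auto
qed

lemma carrier_wspan:
  assumes "finite S" "{w. f w \<noteq> 0} \<subseteq> S" "S \<subseteq> W"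
  shows "f \<in> wspan W"
  using assms
proof (induction S arbitrary: f)
  case empty
  then have "f = (\<lambda>w. 0)" by auto
  then show ?case by (simp add: wspan_0)
next
  case (insert v S)
  define g where "g w = (if w = v then 0 else f w)" for w
  have "g \<in> wspan W" using insert by (intro insert.IH) (auto simp: g_def)
  then have "(\<lambda>w. f v * word v w + g w) \<in> wspan W" using insert by (intro wspan_step) auto
  moreover have "(\<lambda>w. f v * word v w + g w) = f" by (auto simp: g_def word_def)
  ultimately show ?case by simp
qed

section \<open>Straightening of words modulo an ideal\<close>

definition sorted_words :: "nat \<Rightarrow> nat list set" where
  "sorted_words m = {w. sorted w \<and> set w \<subseteq> {1..m}}"

locale alg_ideal =
  fixes n :: nat and I :: "(nat list \<Rightarrow> 'k::field) set"
  assumes ideal: "ideal I (free_alg n)"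
begin

lemma I_0: "(\<lambda>w. 0) \<in> I"
  using additive_subgroup.zero_closed[OF ideal.axioms(1)[OF ideal]] by (simp add: free_alg_simps)

lemma I_add: "f \<in> I \<Longrightarrow> g \<in> I \<Longrightarrow> (\<lambda>w. f w + g w) \<in> I"
  using additive_subgroup.a_closed[OF ideal.axioms(1)[OF ideal], of f g] by (simp add: free_alg_simps)

lemma I_left: "f \<in> I \<Longrightarrow> g \<in> carrier (free_alg n) \<Longrightarrow> conv g f \<in> I"
  using ideal.I_l_closed[OF ideal, of f g] by (simp add: free_alg_simps)

lemma I_right: "f \<in> I \<Longrightarrow> g \<in> carrier (free_alg n) \<Longrightarrow> conv f g \<in> I"
  using ideal.I_r_closed[OF ideal, of f g] by (simp add: free_alg_simps)

lemma I_scale: "f \<in> I \<Longrightarrow> (\<lambda>w. c * f w) \<in> I"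
  using I_left[OF _ free_const_closed[of c n], of f] by (simp add: free_const_word conv_linear conv_one)

definition eqv :: "(nat list \<Rightarrow> 'k) \<Rightarrow> (nat list \<Rightarrow> 'k) \<Rightarrow> bool" where
  "eqv f g \<longleftrightarrow> (\<lambda>w. f w - g w) \<in> I"

lemma eqv_refl: "eqv f f"
  by (simp add: eqv_def I_0)

lemma eqv_add: "eqv f g \<Longrightarrow> eqv f' g' \<Longrightarrow> eqv (\<lambda>w. f w + f' w) (\<lambda>w. g w + g' w)"
  using I_add[of "\<lambda>w. f w - g w" "\<lambda>w. f' w - g' w"] by (simp add: eqv_def algebra_simps)

lemma eqv_scale: "eqv f g \<Longrightarrow> eqv (\<lambda>w. c * f w) (\<lambda>w. c * g w)"
  using I_scale[of "\<lambda>w. f w - g w" c] by (simp add: eqv_def algebra_simps)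

lemma eqv_trans: "eqv f g \<Longrightarrow> eqv g h \<Longrightarrow> eqv f h"
  using I_add[of "\<lambda>w. f w - g w" "\<lambda>w. g w - h w"] by (simp add: eqv_def)

lemma eqv_right: "eqv f g \<Longrightarrow> set v \<subseteq> {1..n} \<Longrightarrow> eqv (conv f (word v)) (conv g (word v))"
  using I_right[of "\<lambda>w. f w - g w" "word v"] by (simp add: eqv_def conv_linear word_closed)

lemma eqv_left: "eqv f g \<Longrightarrow> set v \<subseteq> {1..n} \<Longrightarrow> eqv (conv (word v) f) (conv (word v) g)"
  using I_left[of "\<lambda>w. f w - g w" "word v"] by (simp add: eqv_def conv_linear word_closed)

end

text \<open>Words are brought into sorted form by appending letters one at a time; the locale only needs
  that a descent is equivalent to its swap plus a constant.\<close>

locale straightening = alg_ideal n I for n and I :: "(nat list \<Rightarrow> 'k::field) set" +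
  fixes \<alpha> \<gamma> :: "nat \<Rightarrow> nat \<Rightarrow> 'k::field"
  assumes swap: "1 \<le> i \<Longrightarrow> i < j \<Longrightarrow> j \<le> n \<Longrightarrow>
    eqv (word [j, i]) (\<lambda>w. \<alpha> i j * word [i, j] w + \<gamma> i j * word [] w)"
begin

text \<open>The bound on the letters is what makes the induction work: inserting \<open>i\<close>
  into \<open>w\<close> produces only letters up to the former last letter \<open>j\<close>, so the
  words stay sorted when \<open>j\<close> is appended again.\<close>

lemma straighten_append:
  "w \<in> sorted_words m \<Longrightarrow> 1 \<le> i \<Longrightarrow> i \<le> m \<Longrightarrow> m \<le> n \<Longrightarrow> \<exists>g\<in>wspan (sorted_words m). eqv (word (w @ [i])) g"
proof (induction w arbitrary: m rule: rev_induct)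
  case Nil
  then show ?case by (intro bexI[of _ "word [i]"] wspan_word) (auto simp: sorted_words_def eqv_refl)
next
  case (snoc j w)
  have w: "sorted w" "set w \<subseteq> {1..j}" "1 \<le> j" "j \<le> m"
    using snoc.prems(1) by (auto simp: sorted_words_def sorted_append)
  show ?case
  proof (cases "j \<le> i")
    case True
    then have "w @ [j] @ [i] \<in> sorted_words m"
      using snoc.prems w by (fastforce simp: sorted_words_def sorted_append)
    then show ?thesis by (intro bexI[of _ "word (w @ [j] @ [i])"] wspan_word) (auto simp: eqv_refl)
  next
    case False
    then obtain g where g: "g \<in> wspan (sorted_words j)" "eqv (word (w @ [i])) g"
      using snoc.IH[of j] w snoc.prems by (auto simp: sorted_words_def)
    let ?g = "conv g (word [j])"
    have wn: "set w \<subseteq> {1..n}" using w snoc.prems by (meson atLeastatMost_subset_iff dual_order.trans order_refl)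
    have "eqv (conv (word w) (word [j, i])) (conv (word w) (\<lambda>w. \<alpha> i j * word [i, j] w + \<gamma> i j * word [] w))"
      using False snoc.prems w by (intro eqv_left[OF swap wn]) auto
    then have 1: "eqv (word (w @ [j, i])) (\<lambda>v. \<alpha> i j * word (w @ [i, j]) v + \<gamma> i j * word w v)"
      by (simp add: conv_linear conv_word)
    have "eqv (word (w @ [i, j])) ?g"
      using eqv_right[OF g(2), of "[j]"] w snoc.prems by (simp add: conv_word)
    then have "eqv (\<lambda>v. \<alpha> i j * word (w @ [i, j]) v + \<gamma> i j * word w v) (\<lambda>v. \<alpha> i j * ?g v + \<gamma> i j * word w v)"
      by (intro eqv_add eqv_scale eqv_refl)
    with 1 have "eqv (word (w @ [j, i])) (\<lambda>v. \<alpha> i j * ?g v + \<gamma> i j * word w v)" by (rule eqv_trans)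
    moreover have "?g \<in> wspan (sorted_words m)"
      using g(1) w by (rule_tac wspan_conv_word) (fastforce simp: sorted_words_def sorted_append)+
    moreover have "word w \<in> wspan (sorted_words m)"
      using w by (intro wspan_word) (auto simp: sorted_words_def)
    ultimately show ?thesis
      by (intro bexI[of _ "\<lambda>v. \<alpha> i j * ?g v + \<gamma> i j * word w v"] wspan_add wspan_scale) auto
  qed
qed

lemma straighten_wspan:
  assumes "f \<in> wspan W" "\<And>w. w \<in> W \<Longrightarrow> \<exists>g\<in>wspan (sorted_words n). eqv (word w) g"
  shows "\<exists>g\<in>wspan (sorted_words n). eqv f g"
  using assms(1)
proof induction
  case wspan_0
  show ?case using eqv_refl wspan.wspan_0 by blast
next
  case (wspan_step v f c)
  obtain g where g: "g \<in> wspan (sorted_words n)" "eqv f g" using wspan_step by blast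
  obtain h where h: "h \<in> wspan (sorted_words n)" "eqv (word v) h" using assms(2) wspan_step by blast
  show ?case using g h
    by (intro bexI[of _ "\<lambda>w. c * h w + g w"] eqv_add eqv_scale wspan_add wspan_scale)
qed

lemma straighten_word: "set w \<subseteq> {1..n} \<Longrightarrow> \<exists>g\<in>wspan (sorted_words n). eqv (word w) g"
proof (induction w rule: rev_induct)
  case Nil
  have "word [] \<in> wspan (sorted_words n)" by (rule wspan_word) (simp add: sorted_words_def)
  then show ?case using eqv_refl by blast
next
  case (snoc i w)
  then obtain g where g: "g \<in> wspan (sorted_words n)" "eqv (word w) g" by auto
  have i: "1 \<le> i" "i \<le> n" using snoc by auto
  have "conv g (word [i]) \<in> wspan {v @ [i] | v. v \<in> sorted_words n}"
    using g(1) by (rule wspan_conv_word) auto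
  then obtain h where "h \<in> wspan (sorted_words n)" "eqv (conv g (word [i])) h"
    using straighten_wspan straighten_append[OF _ i] by blast
  moreover have "eqv (word (w @ [i])) (conv g (word [i]))"
    using eqv_right[OF g(2), of "[i]"] i by (simp add: conv_word)
  ultimately show ?case using eqv_trans by blast
qed

lemma straighten:
  assumes "f \<in> carrier (free_alg n)"
  shows "\<exists>g\<in>wspan (sorted_words n). eqv f g"
proof (rule straighten_wspan)
  show "f \<in> wspan {w. f w \<noteq> 0}" using assms by (intro carrier_wspan) (auto simp: free_alg_carrier)
  show "\<exists>g\<in>wspan (sorted_words n). eqv (word w) g" if "w \<in> {w. f w \<noteq> 0}" for w
    using assms that by (intro straighten_word) (auto simp: free_alg_carrier)
qed

end

section \<open>Ideals and primeness in terms of elements\<close>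

lemma (in ring) ideal_iff_closed:
  "ideal P R \<longleftrightarrow> P \<subseteq> carrier R \<and> \<zero>\<^bsub>R\<^esub> \<in> P \<and> (\<forall>a\<in>P. \<forall>b\<in>P. a \<oplus>\<^bsub>R\<^esub> b \<in> P) \<and>
     (\<forall>a\<in>P. \<forall>r\<in>carrier R. r \<otimes>\<^bsub>R\<^esub> a \<in> P \<and> a \<otimes>\<^bsub>R\<^esub> r \<in> P)"
proof
  show "P \<subseteq> carrier R \<and> \<zero> \<in> P \<and> (\<forall>a\<in>P. \<forall>b\<in>P. a \<oplus> b \<in> P) \<and>
     (\<forall>a\<in>P. \<forall>r\<in>carrier R. r \<otimes> a \<in> P \<and> a \<otimes> r \<in> P)" if "ideal P R"
  proof -
    interpret P: ideal P R by fact
    show ?thesis by (auto intro: P.I_l_closed P.I_r_closed P.a_closed P.zero_closed P.Icarr)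
  qed
  assume P: "P \<subseteq> carrier R \<and> \<zero> \<in> P \<and> (\<forall>a\<in>P. \<forall>b\<in>P. a \<oplus> b \<in> P) \<and>
     (\<forall>a\<in>P. \<forall>r\<in>carrier R. r \<otimes> a \<in> P \<and> a \<otimes> r \<in> P)"
  show "ideal P R"
  proof (rule idealI[OF ring_axioms])
    show "subgroup P (add_monoid R)"
    proof (rule add.subgroupI)
      fix a assume a: "a \<in> P"
      then have "\<ominus> \<one> \<otimes> a \<in> P" using P by blast
      moreover have "a \<in> carrier R" using a P by blast
      ultimately show "\<ominus> a \<in> P" by (simp add: l_minus)
    qed (use P in auto)
  qed (use P in auto)
qed

lemma (in ring) nc_prime_ideal_iff:
  "nc_prime_ideal P R \<longleftrightarrow> ideal P R \<and> P \<noteq> carrier R \<and>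
    (\<forall>a\<in>carrier R. \<forall>b\<in>carrier R. (\<forall>r\<in>carrier R. a \<otimes>\<^bsub>R\<^esub> r \<otimes>\<^bsub>R\<^esub> b \<in> P) \<longrightarrow> a \<in> P \<or> b \<in> P)"
proof (cases "ideal P R")
  case True
  interpret P: ideal P R by fact
  have "(\<forall>I J. ideal I R \<longrightarrow> ideal J R \<longrightarrow> ideal_prod R I J \<subseteq> P \<longrightarrow> I \<subseteq> P \<or> J \<subseteq> P) \<longleftrightarrow>
    (\<forall>a\<in>carrier R. \<forall>b\<in>carrier R. (\<forall>r\<in>carrier R. a \<otimes> r \<otimes> b \<in> P) \<longrightarrow> a \<in> P \<or> b \<in> P)"
  proof safe
    fix a b assume prod: "\<forall>I J. ideal I R \<longrightarrow> ideal J R \<longrightarrow> ideal_prod R I J \<subseteq> P \<longrightarrow> I \<subseteq> P \<or> J \<subseteq> P"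
      and a: "a \<in> carrier R" and b: "b \<in> carrier R" and ab: "\<forall>r\<in>carrier R. a \<otimes> r \<otimes> b \<in> P" and "b \<notin> P"
    \<comment> \<open>These replace the ideals generated by \<open>a\<close> and \<open>b\<close>
      and avoid sums of products: \<open>?I\<close> contains \<open>a\<close>, \<open>?J\<close>
      contains \<open>b\<close>, and their product lies in \<open>P\<close> by construction.\<close>
    let ?I = "{i \<in> carrier R. \<forall>r\<in>carrier R. i \<otimes> r \<otimes> b \<in> P}"
    let ?J = "{j \<in> carrier R. \<forall>i\<in>?I. \<forall>r\<in>carrier R. i \<otimes> r \<otimes> j \<in> P}"
    have I: "ideal ?I R"
      unfolding ideal_iff_closed
    proof (intro conjI ballI)
      show "\<zero> \<in> ?I" using b by simp
      fix i assume i: "i \<in> ?I"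
      show "i \<oplus> i' \<in> ?I" if i': "i' \<in> ?I" for i'
      proof -
        have "(i \<oplus> i') \<otimes> r \<otimes> b = i \<otimes> r \<otimes> b \<oplus> i' \<otimes> r \<otimes> b" if "r \<in> carrier R" for r
          using i i' b that by (simp add: l_distr)
        then show ?thesis using i i' by auto
      qed
      fix s assume s: "s \<in> carrier R"
      have "s \<otimes> i \<otimes> r \<otimes> b = s \<otimes> (i \<otimes> r \<otimes> b)" "i \<otimes> s \<otimes> r \<otimes> b = i \<otimes> (s \<otimes> r) \<otimes> b" if "r \<in> carrier R" for r
        using i s b that by (simp_all add: m_assoc)
      then show "s \<otimes> i \<in> ?I" "i \<otimes> s \<in> ?I" using i s by (auto intro: P.I_l_closed)
    qed auto
    have J: "ideal ?J R"
      unfolding ideal_iff_closed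
    proof (intro conjI ballI)
      show "\<zero> \<in> ?J" by auto
      fix j assume j: "j \<in> ?J"
      show "j \<oplus> j' \<in> ?J" if j': "j' \<in> ?J" for j'
      proof -
        have "i \<otimes> r \<otimes> (j \<oplus> j') = i \<otimes> r \<otimes> j \<oplus> i \<otimes> r \<otimes> j'" if "i \<in> ?I" "r \<in> carrier R" for i r
          using j j' that by (simp add: r_distr)
        then show ?thesis using j j' by auto
      qed
      fix s assume s: "s \<in> carrier R"
      have "i \<otimes> r \<otimes> (j \<otimes> s) = (i \<otimes> r \<otimes> j) \<otimes> s" "i \<otimes> r \<otimes> (s \<otimes> j) = i \<otimes> (r \<otimes> s) \<otimes> j"
        if "i \<in> ?I" "r \<in> carrier R" for i r
        using j s that by (simp_all add: m_assoc)
      then show "s \<otimes> j \<in> ?J" "j \<otimes> s \<in> ?J" using j s by (auto intro: P.I_r_closed)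
    qed auto
    have "s \<in> P" if "s \<in> ideal_prod R ?I ?J" for s
      using that
    proof induction
      case (prod i j)
      then have "i \<otimes> \<one> \<otimes> j \<in> P" by blast
      then show ?case using prod by simp
    qed (rule P.a_closed)
    then have "?I \<subseteq> P \<or> ?J \<subseteq> P" using prod I J by blast
    moreover have "a \<in> ?I" using a ab by blast
    moreover have "b \<in> ?J" using b by blast
    ultimately show "a \<in> P" using \<open>b \<notin> P\<close> by blast
  next
    fix I J i j assume el: "\<forall>a\<in>carrier R. \<forall>b\<in>carrier R. (\<forall>r\<in>carrier R. a \<otimes> r \<otimes> b \<in> P) \<longrightarrow> a \<in> P \<or> b \<in> P"
      and I: "ideal I R" and J: "ideal J R" and IJ: "ideal_prod R I J \<subseteq> P"
      and j: "j \<in> J" "j \<notin> P" and i: "i \<in> I"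
    have "i \<otimes> r \<otimes> j \<in> P" if "r \<in> carrier R" for r
      using IJ ideal_prod.prod[OF ideal.I_r_closed[OF I i that] j(1), of R] by blast
    then show "i \<in> P" using el ideal.Icarr[OF I i] ideal.Icarr[OF J j(1)] j(2) by blast
  qed
  then show ?thesis using True by (simp add: nc_prime_ideal_def)
qed (simp add: nc_prime_ideal_def)

section \<open>The defining relations in one common form\<close>

text \<open>Neighbouring indices have odd difference, so the three families share one shape and only
  the constant singles out neighbours.\<close>

definition L_rel :: "'k::field \<Rightarrow> nat \<Rightarrow> nat \<Rightarrow> nat list \<Rightarrow> 'k" where
  "L_rel q i j = (\<lambda>w. word [i, j] w - (if odd (j - i) then q else inverse q) * word [j, i] w -
     (if j = i + 1 then 1 - q else 0) * word [] w)"

lemma scaled_word_closed: "set v \<subseteq> {1..n} \<Longrightarrow> (\<lambda>w. c * word v w) \<in> carrier (free_alg n)"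
  by (auto simp: free_alg_carrier word_def)

lemma commutator_fun:
  assumes "1 \<le> i" "i < j" "j \<le> n"
  shows "free_var i \<otimes>\<^bsub>free_alg n\<^esub> free_var j
      \<ominus>\<^bsub>free_alg n\<^esub> free_const k \<otimes>\<^bsub>free_alg n\<^esub> (free_var j \<otimes>\<^bsub>free_alg n\<^esub> free_var i)
    = (\<lambda>w. word [i, j] w - k * word [j, i] w)"
    and "(\<lambda>w. word [i, j] w - k * word [j, i] w) \<in> carrier (free_alg n)"
proof -
  interpret F: ring "free_alg n :: (nat list \<Rightarrow> 'a) ring" by (rule ring_free_alg)
  have c: "word [i, j] \<in> carrier (free_alg n)" "(\<lambda>w. k * word [j, i] w) \<in> carrier (free_alg n)"
    using assms by (auto simp: word_closed intro!: scaled_word_closed)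
  have "word [i, j] \<ominus>\<^bsub>free_alg n\<^esub> (\<lambda>w. k * word [j, i] w) \<in> carrier (free_alg n)"
    using c by (rule F.minus_closed)
  then show "(\<lambda>w. word [i, j] w - k * word [j, i] w) \<in> carrier (free_alg n)" by (simp only: free_alg_minus c)
  have "free_var i \<otimes>\<^bsub>free_alg n\<^esub> free_var j = (word [i, j] :: nat list \<Rightarrow> 'a)"
    "free_const k \<otimes>\<^bsub>free_alg n\<^esub> (free_var j \<otimes>\<^bsub>free_alg n\<^esub> free_var i) = (\<lambda>w. k * word [j, i] w)"
    by (simp_all add: free_alg_simps free_var_word free_const_word conv_word conv_linear conv_one)
  then show "free_var i \<otimes>\<^bsub>free_alg n\<^esub> free_var j
      \<ominus>\<^bsub>free_alg n\<^esub> free_const k \<otimes>\<^bsub>free_alg n\<^esub> (free_var j \<otimes>\<^bsub>free_alg n\<^esub> free_var i)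
    = (\<lambda>w. word [i, j] w - k * word [j, i] w)" by (simp only: free_alg_minus c)
qed

lemma L_relation_near:
  assumes "1 \<le> i" "i \<le> n - 1"
  shows "(free_var i \<otimes>\<^bsub>free_alg n\<^esub> free_var (i + 1)
      \<ominus>\<^bsub>free_alg n\<^esub> free_const q \<otimes>\<^bsub>free_alg n\<^esub> (free_var (i + 1) \<otimes>\<^bsub>free_alg n\<^esub> free_var i))
      \<ominus>\<^bsub>free_alg n\<^esub> free_const (1 - q) = L_rel q i (i + 1)"
proof -
  have i: "i < i + 1" "i + 1 \<le> n" using assms by auto
  show ?thesis
    by (simp only: commutator_fun[OF assms(1) i] free_alg_minus free_const_closed)
       (simp add: free_const_word L_rel_def)
qed

lemma L_relation_far:
  assumes "1 \<le> i" "i + 1 < j" "j \<le> n"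
  shows "free_var i \<otimes>\<^bsub>free_alg n\<^esub> free_var j
      \<ominus>\<^bsub>free_alg n\<^esub> free_const (if odd (j - i) then q else inverse q) \<otimes>\<^bsub>free_alg n\<^esub> (free_var j \<otimes>\<^bsub>free_alg n\<^esub> free_var i)
    = L_rel q i j"
proof -
  have "i < j" using assms by simp
  then show ?thesis
    using assms by (simp only: commutator_fun[OF assms(1) _ assms(3)]) (simp add: L_rel_def)
qed

lemma L_rels_cases: "L_rels n q = {L_rel q i (i + 1) | i. 1 \<le> i \<and> i \<le> n - 1} \<union>
    {L_rel q i j | i j. 1 \<le> i \<and> i + 1 < j \<and> j \<le> n \<and> odd (j - i)} \<union>
    {L_rel q i j | i j. 1 \<le> i \<and> i + 1 < j \<and> j \<le> n \<and> even (j - i)}"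
  unfolding L_rels_def Let_def
proof (intro arg_cong2[where f = "(\<union>)"] Collect_cong ex_cong1 rev_conj_cong refl, elim conjE, goal_cases)
  case 1
  then show ?case by (simp only: L_relation_near)
next
  case (2 f i j)
  then show ?case using L_relation_far[of i j n q] by simp
next
  case (3 f i j)
  then have h: "1 \<le> i" "i + 1 < j" "j \<le> n" "even (j - i)" by auto
  then show ?case using L_relation_far[OF h(1-3), of q] by (simp only: not_True_eq_False if_False)
qed

lemma L_rels_eq: "L_rels n q = {L_rel q i j | i j. 1 \<le> i \<and> i < j \<and> j \<le> n}"
proof (intro equalityI subsetI)
  fix f assume "f \<in> L_rels n q"
  then consider i where "f = L_rel q i (i + 1)" "1 \<le> i" "i \<le> n - 1"
    | i j where "f = L_rel q i j" "1 \<le> i" "i + 1 < j" "j \<le> n"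
    unfolding L_rels_cases by blast
  then show "f \<in> {L_rel q i j | i j. 1 \<le> i \<and> i < j \<and> j \<le> n}"
  proof cases
    case (1 i)
    then have "i < i + 1" "i + 1 \<le> n" by auto
    then show ?thesis using 1 by blast
  next
    case (2 i j)
    then have "i < j" by simp
    then show ?thesis using 2 by blast
  qed
next
  fix f assume "f \<in> {L_rel q i j | i j. 1 \<le> i \<and> i < j \<and> j \<le> n}"
  then obtain i j where ij: "f = L_rel q i j" "1 \<le> i" "i < j" "j \<le> n" by blast
  show "f \<in> L_rels n q"
  proof (cases "j = i + 1")
    case True
    then have "i \<le> n - 1" using ij by simp
    then show ?thesis unfolding L_rels_cases using ij True by blast
  next
    case False
    then have "i + 1 < j" using ij by simp
    then show ?thesis unfolding L_rels_cases using ij by blast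
  qed
qed

lemma L_rel_in_L_ideal:
  assumes "1 \<le> i" "i < j" "j \<le> n"
  shows "L_rel q i j \<in> L_ideal n q"
  using ring.genideal_self[OF ring_free_alg L_rels_closed, of n q] assms
  unfolding L_ideal_def L_rels_eq by blast

section \<open>Leading exponents of words\<close>

text \<open>The leading exponent of the product of the \<open>x i\<close> along the word:
  \<open>x i\<close> contributes \<open>e i - e (i - 1)\<close>, and leading exponents add
  (\<open>lead_word_op\<close>).\<close>

definition lead_ex :: "nat list \<Rightarrow> expo" where
  "lead_ex w = (\<Sum>i\<leftarrow>w. e i - e (i - 1))"

lemma expt_lead_ex: "0 < i \<Longrightarrow> expt (lead_ex w) i = int (count (mset w) i) - int (count (mset w) (i + 1))"
proof (induction w)
  case (Cons j w)
  then show ?case by (cases "j = 0") (auto simp: lead_ex_def expt_e)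
qed (simp add: lead_ex_def)

text \<open>The exponent at \<open>i\<close> is the difference of the numbers of letters
  \<open>i\<close> and \<open>i + 1\<close>, so all letter counts follow downwards from
  \<open>n + 1\<close>, where they are 0. A sorted word is determined by its letter counts.\<close>

lemma lead_ex_inj:
  assumes "v \<in> sorted_words n" "w \<in> sorted_words n" "lead_ex v = lead_ex w"
  shows "v = w"
proof -
  have down: "count (mset v) i = count (mset w) i" if "0 < i" "count (mset v) (i + 1) = count (mset w) (i + 1)" for i
    using expt_lead_ex[OF that(1), of v] expt_lead_ex[OF that(1), of w] that(2) assms(3) by simp
  have zero: "count (mset v) i = count (mset w) i" if "n < i \<or> i = 0" for i
  proof -
    have "i \<notin> set v" "i \<notin> set w" using assms(1,2) that by (auto simp: sorted_words_def)
    then have "count (mset v) i = 0" "count (mset w) i = 0" by (simp_all add: count_eq_zero_iff)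
    then show ?thesis by (simp only:)
  qed
  have below: "count (mset v) (n + 1 - k) = count (mset w) (n + 1 - k)" for k
  proof (induction k)
    case 0
    show ?case by (rule zero) simp
  next
    case (Suc k)
    show ?case
    proof (cases "n + 1 - Suc k = 0")
      case True
      then show ?thesis by (intro zero) simp
    next
      case False
      then have "n + 1 - Suc k + 1 = n + 1 - k" by arith
      then have "count (mset v) (n + 1 - Suc k + 1) = count (mset w) (n + 1 - Suc k + 1)"
        using Suc by (simp only:)
      moreover have "0 < n + 1 - Suc k" using False by simp
      ultimately show ?thesis by (rule down[rotated])
    qed
  qed
  have "count (mset v) i = count (mset w) i" for i
    using zero[of i] below[of "n + 1 - i"] by (cases "i \<le> n") auto
  then have "mset v = mset w" by (intro multiset_eqI)
  then have "sort w = v" using assms(1) by (intro properties_for_sort) (simp_all add: sorted_words_def)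
  then show ?thesis using assms(2) by (simp add: sorted_words_def sorted_sort_id)
qed

section \<open>The homomorphism from the free algebra and its kernel\<close>

context qtorus
begin

definition word_op :: "nat list \<Rightarrow> (expo, 'k) lin_op" where
  "word_op w = prod_list (map x w)"

lemma word_op_simps: "word_op [] = 1" "word_op (i # w) = x i * word_op w" "word_op (v @ w) = word_op v * word_op w"
  by (simp_all add: word_op_def)

lemma word_op_in_L: "set w \<subseteq> {1..n} \<Longrightarrow> word_op w \<in> L n"
  by (induction w) (auto simp: word_op_simps intro!: L_1 L_mult L_x)

text \<open>Substitution of the operators \<open>x i\<close> for the indeterminates. Finiteness of
  the support has to be carried along, since the sum is meaningful only then.\<close>

definition Phi :: "(nat list \<Rightarrow> 'k) \<Rightarrow> (expo, 'k) lin_op" where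
  "Phi f = (\<Sum>w\<in>{w. f w \<noteq> 0}. sc (f w) * word_op w)"

lemma Phi_superset: "finite S \<Longrightarrow> {w. f w \<noteq> 0} \<subseteq> S \<Longrightarrow> Phi f = (\<Sum>w\<in>S. sc (f w) * word_op w)"
  unfolding Phi_def by (intro sum.mono_neutral_left) auto

lemma Phi_add:
  assumes "finite {w. f w \<noteq> 0}" "finite {w. g w \<noteq> 0}"
  shows "Phi (\<lambda>w. f w + g w) = Phi f + Phi g"
proof -
  let ?S = "{w. f w \<noteq> 0} \<union> {w. g w \<noteq> 0}"
  have S: "finite ?S" using assms by simp
  have "{w. f w + g w \<noteq> 0} \<subseteq> ?S" by auto
  then show ?thesis
    by (subst (1 2 3) Phi_superset[OF S]) (auto simp: sc_add distrib_right sum.distrib)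
qed

lemma Phi_scale: "Phi (\<lambda>w. c * f w) = sc c * Phi f"
proof (cases "c = 0")
  case False
  then show ?thesis by (simp add: Phi_def sc_mult mult.assoc sum_distrib_left)
qed (simp add: Phi_def)

lemma Phi_word: "Phi (word v) = word_op v"
  by (subst Phi_superset[of "{v}"]) (auto simp: word_def)

lemma Phi_diff:
  assumes "finite {w. f w \<noteq> 0}" "finite {w. g w \<noteq> 0}"
  shows "Phi (\<lambda>w. f w - g w) = Phi f - Phi g"
  using Phi_add[of f "\<lambda>w. - 1 * g w"] assms Phi_scale[of "- 1" g] by (simp add: sc_minus)

lemma wspan_finite: "f \<in> wspan W \<Longrightarrow> finite {w. f w \<noteq> 0}"
proof (induction rule: wspan.induct)
  case (wspan_step v f c)
  have "{w. c * word v w + f w \<noteq> 0} \<subseteq> insert v {w. f w \<noteq> 0}" by (auto simp: word_def)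
  then show ?case using wspan_step finite_subset by blast
qed simp

lemma finite_word: "finite {w. c * word v w \<noteq> 0}" "finite {w. word v w \<noteq> (0::'k)}"
  by (rule finite_subset[of _ "{v}"]; auto simp: word_def)+

lemma Phi_step: "f \<in> wspan W \<Longrightarrow> Phi (\<lambda>w. c * word v w + f w) = sc c * word_op v + Phi f"
  using Phi_add[OF finite_word(1)[of c v] wspan_finite] by (simp only: Phi_scale Phi_word)

lemma Phi_conv_word: "g \<in> wspan W \<Longrightarrow> Phi (conv (word v) g) = word_op v * Phi g"
proof (induction rule: wspan.induct)
  case wspan_0
  then show ?case by (simp add: Phi_def conv_def)
next
  case (wspan_step u g c)
  have "finite {w. conv (word v) g w \<noteq> 0}"
  proof -
    have "conv (word v) g \<in> wspan UNIV"
      using wspan_step(2) by induction (auto simp: conv_linear conv_word conv_def[of _ "\<lambda>w. 0", abs_def] intro: wspan.intros)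
    then show ?thesis by (rule wspan_finite)
  qed
  then show ?case
    using wspan_step Phi_add[of "\<lambda>w. c * word (v @ u) w" "conv (word v) g"]
    by (simp add: conv_linear conv_word finite_word Phi_scale Phi_word Phi_step word_op_simps
        distrib_left sc_left_commute[of "word_op v"])
qed

lemma carrier_in_wspan: "f \<in> carrier (free_alg n) \<Longrightarrow> f \<in> wspan {w. set w \<subseteq> {1..n}}"
  by (intro carrier_wspan[of "{w. f w \<noteq> 0}"]) (auto simp: free_alg_carrier)

lemma Phi_conv:
  assumes f: "f \<in> carrier (free_alg n)" and g: "g \<in> carrier (free_alg n)"
  shows "Phi (conv f g) = Phi f * Phi g"
proof -
  have g': "g \<in> wspan {w. set w \<subseteq> {1..n}}" by (rule carrier_in_wspan[OF g])
  have cl: "conv h g \<in> carrier (free_alg n)" if "h \<in> carrier (free_alg n)" for h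
    using free_alg_mult_closed[OF that g] by (simp add: free_alg_simps)
  show ?thesis
    using carrier_in_wspan[OF f]
  proof induction
    case wspan_0
    then show ?case by (simp add: conv_linear Phi_def)
  next
    case (wspan_step v f c)
    have "word v \<in> carrier (free_alg n)" "f \<in> carrier (free_alg n)"
      using wspan_step(1) wspan_carrier(1)[OF wspan_step(2)] by (auto simp: word_closed)
    then have fin: "finite {w. conv (word v) g w \<noteq> 0}" "finite {w. conv f g w \<noteq> 0}"
      using cl unfolding free_alg_carrier by blast+
    then have "finite {w. c * conv (word v) g w \<noteq> 0}" by (rule_tac finite_subset[OF _ fin(1)]) auto
    then show ?case
      using fin wspan_step Phi_add[of "\<lambda>w. c * conv (word v) g w" "conv f g"] Phi_conv_word[OF g']
      by (simp add: conv_linear Phi_scale Phi_step distrib_right mult.assoc)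
  qed
qed

lemma Phi_in_L:
  assumes "f \<in> carrier (free_alg n)"
  shows "Phi f \<in> L n"
  using carrier_in_wspan[OF assms]
  by induction (auto simp: Phi_step Phi_def[of "\<lambda>w. 0"] intro!: L_0 L_add L_mult L_sc word_op_in_L)

definition L_ring :: "nat \<Rightarrow> (expo, 'k) lin_op ring" where
  "L_ring n = \<lparr>carrier = L n, monoid.mult = (*), one = 1, ring.zero = 0, add = (+)\<rparr>"

lemma L_ring_simps [simp]: "carrier (L_ring n) = L n" "a \<otimes>\<^bsub>L_ring n\<^esub> b = a * b" "a \<oplus>\<^bsub>L_ring n\<^esub> b = a + b"
  "\<one>\<^bsub>L_ring n\<^esub> = 1" "\<zero>\<^bsub>L_ring n\<^esub> = 0"
  by (simp_all add: L_ring_def)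

lemma ring_L_ring: "ring (L_ring n)"
proof (rule ringI)
  show "abelian_group (L_ring n)"
  proof (rule abelian_groupI)
    fix a assume "a \<in> carrier (L_ring n)"
    then show "\<exists>b\<in>carrier (L_ring n). b \<oplus>\<^bsub>L_ring n\<^esub> a = \<zero>\<^bsub>L_ring n\<^esub>"
      by (intro bexI[of _ "- a"]) (auto intro: L_minus)
  qed (auto intro: L_add L_0 simp: add_ac)
  show "monoid (L_ring n)"
    by (rule monoidI) (auto intro: L_mult L_1 simp: mult.assoc)
qed (auto simp: distrib_left distrib_right)

lemma Phi_ring_hom: "ring_hom_ring (free_alg n) (L_ring n) Phi"
proof (rule ring_hom_ringI2[OF ring_free_alg ring_L_ring], rule ring_hom_memI)
  fix f g :: "nat list \<Rightarrow> 'k" assume f: "f \<in> carrier (free_alg n)" and g: "g \<in> carrier (free_alg n)"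
  show "Phi f \<in> carrier (L_ring n)" using Phi_in_L[OF f] by simp
  show "Phi (f \<otimes>\<^bsub>free_alg n\<^esub> g) = Phi f \<otimes>\<^bsub>L_ring n\<^esub> Phi g"
    using Phi_conv[OF f g] by (simp add: free_alg_simps)
  show "Phi (f \<oplus>\<^bsub>free_alg n\<^esub> g) = Phi f \<oplus>\<^bsub>L_ring n\<^esub> Phi g"
    using Phi_add[of f g] f g by (simp add: free_alg_simps free_alg_carrier)
qed (simp add: free_alg_simps Phi_word word_op_simps)

lemma Phi_gens: "Phi (free_var i) = x i" "Phi (free_const c) = sc c"
  using Phi_scale[of c "word []"]
  by (simp_all add: free_var_word free_const_word Phi_word word_op_simps)

lemma Phi_surj: "Phi ` carrier (free_alg n) = L n"
proof
  show "Phi ` carrier (free_alg n) \<subseteq> L n" using Phi_in_L by blast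
  show "L n \<subseteq> Phi ` carrier (free_alg n)"
  proof
    interpret h: ring_hom_ring "free_alg n" "L_ring n" Phi by (rule Phi_ring_hom)
    fix r assume "r \<in> L n"
    then show "r \<in> Phi ` carrier (free_alg n)"
    proof induction
      case (L_sc k)
      have "Phi (free_const k) \<in> Phi ` carrier (free_alg n)" by (rule imageI[OF free_const_closed])
      then show ?case by (simp only: Phi_gens)
    next
      case (L_x i)
      then have "Phi (free_var i) \<in> Phi ` carrier (free_alg n)" by (intro imageI free_var_closed)
      then show ?case by (simp only: Phi_gens)
    next
      case (L_add r s)
      then obtain f g where "f \<in> carrier (free_alg n)" "g \<in> carrier (free_alg n)" "r = Phi f" "s = Phi g" by blast
      then show ?case using h.hom_add[of f g] h.R.a_closed[of f g] by (metis L_ring_simps(3) imageI)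
    next
      case (L_mult r s)
      then obtain f g where "f \<in> carrier (free_alg n)" "g \<in> carrier (free_alg n)" "r = Phi f" "s = Phi g" by blast
      then show ?case using h.hom_mult[of f g] h.R.m_closed[of f g] by (metis L_ring_simps(2) imageI)
    qed
  qed
qed

lemma lead_x: "1 \<le> i \<Longrightarrow> x i \<in> T \<and> x i \<noteq> 0 \<and> lead (x i) = e i - e (i - 1)"
proof -
  assume i: "1 \<le> i"
  have T: "x i \<in> T" using x_in_Tp[of i i] i mspan_in_T by auto
  have less: "e (i - 2) < e i" if "i \<noteq> 1"
  proof (cases "i = 2")
    case True
    then show ?thesis using e_pos[of i] by simp
  next
    case False
    then show ?thesis using that i unfolding less_poly_mapping.rep_eq less_fun_def
      by (intro exI[of _ "- int i"]) (auto simp: e_def lookup_single when_def)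
  qed
  have coef: "coef (x i) a = (if a = e i - e (i - 1) then qp (twist (- e (i - 1)) (e i)) else 0) +
     (if i \<noteq> 1 \<and> a = e (i - 2) - e (i - 1) then qp (twist (- e (i - 1)) (e (i - 2))) else 0)" for a
    using i by (auto simp: x_eq_monomials coef_simps)
  have "coef (x i) (e i - e (i - 1)) \<noteq> 0"
    using qp_nz less by (auto simp: coef)
  then have s: "e i - e (i - 1) \<in> supp (x i)" by (simp add: supp_def)
  then have "lead (x i) = e i - e (i - 1)"
    using less by (intro lead_eqI[OF T]) (auto simp: supp_def coef split: if_splits)
  moreover have "x i \<noteq> 0" using s by (auto simp: supp_def coef_simps)
  ultimately show ?thesis using T by blast
qed

lemma lead_word_op: "set w \<subseteq> {1..n} \<Longrightarrow> word_op w \<in> T \<and> word_op w \<noteq> 0 \<and> lead (word_op w) = lead_ex w"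
proof (induction w)
  case Nil
  have 1: "(1 :: (expo, 'k) lin_op) \<in> T" using mspan_one[of UNIV 1] by simp
  have "coef 1 d = (if d = 0 then 1 else 0)" for d using coef_simps(5)[of 0 d] by simp
  then have "lead (1 :: (expo, 'k) lin_op) = 0"
    by (intro lead_eqI[OF 1]) (auto simp: supp_def split: if_splits)
  then show ?case using 1 by (simp add: word_op_simps lead_ex_def)
next
  case (Cons i w)
  then have "x i \<in> T" "x i \<noteq> 0" "lead (x i) = e i - e (i - 1)" using lead_x[of i] by auto
  then show ?case
    using Cons lead_mult[of "x i" "word_op w"] mspan_mult[of "x i" UNIV "word_op w" UNIV UNIV]
    by (simp add: word_op_simps lead_ex_def)
qed

text \<open>By \<open>lead_ex_inj\<close> the words in the support have distinct leading exponents,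
  so the largest of these cannot cancel.\<close>

lemma Phi_sorted_inj:
  assumes f: "f \<in> wspan (sorted_words n)" and "Phi f = 0"
  shows "f = (\<lambda>w. 0)"
proof (rule ccontr)
  assume "f \<noteq> (\<lambda>w. 0)"
  let ?S = "{w. f w \<noteq> 0}"
  have fin: "finite ?S" and sub: "?S \<subseteq> sorted_words n" and ne: "?S \<noteq> {}"
    using wspan_finite[OF f] wspan_carrier(2)[OF f, of n] \<open>f \<noteq> (\<lambda>w. 0)\<close> by (auto simp: sorted_words_def)
  obtain v where v: "v \<in> ?S" and max: "\<And>w. w \<in> ?S \<Longrightarrow> lead_ex w \<le> lead_ex v"
  proof -
    have "Max (lead_ex ` ?S) \<in> lead_ex ` ?S" using fin ne by (intro Max_in) auto
    then obtain v where "v \<in> ?S" "lead_ex v = Max (lead_ex ` ?S)" by force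
    then show ?thesis using fin by (intro that[of v]) auto
  qed
  have op: "word_op w \<in> T \<and> word_op w \<noteq> 0 \<and> lead (word_op w) = lead_ex w" if "w \<in> ?S" for w
    using lead_word_op[of w n] that sub by (auto simp: sorted_words_def)
  have "coef (word_op w) (lead_ex v) = 0" if w: "w \<in> ?S" "w \<noteq> v" for w
  proof (rule ccontr)
    assume "coef (word_op w) (lead_ex v) \<noteq> 0"
    then have "lead_ex v \<le> lead_ex w" using lead_ge[of "word_op w" "lead_ex v"] op[OF w(1)] by (auto simp: supp_def)
    then have "lead_ex v = lead_ex w" using max[OF w(1)] by simp
    then show False using lead_ex_inj[of v n w] sub v w by auto
  qed
  then have "coef (Phi f) (lead_ex v) = (\<Sum>w\<in>?S. if w = v then f v * coef (word_op v) (lead_ex v) else 0)"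
    unfolding Phi_def coef_sum coef_simps by (intro sum.cong) auto
  also have "\<dots> = f v * coef (word_op v) (lead_ex v)" using fin v by simp
  also have "\<dots> \<noteq> 0"
    using v lead_in_supp[of "word_op v"] op[OF v] by (auto simp: supp_def)
  finally show False using assms(2) by (simp add: coef_simps)
qed

lemma kernel_Phi_iff: "f \<in> a_kernel (free_alg n) (L_ring n) Phi \<longleftrightarrow> f \<in> carrier (free_alg n) \<and> Phi f = 0"
  by (simp add: a_kernel_def')

lemma L_ideal_sub_kernel: "L_ideal n q \<subseteq> a_kernel (free_alg n) (L_ring n) Phi"
  unfolding L_ideal_def
proof (rule ring.genideal_minimal[OF ring_free_alg ring_hom_ring.kernel_is_ideal[OF Phi_ring_hom]], rule subsetI)
  fix f assume f: "f \<in> L_rels n q"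
  then obtain i j where ij: "f = L_rel q i j" "1 \<le> i" "i < j" "j \<le> n"
    by (auto simp only: L_rels_eq mem_Collect_eq)
  let ?k = "if odd (j - i) then q else inverse q" and ?d = "if j = i + 1 then 1 - q else 0"
  have "finite {w. word [i, j] w - ?k * word [j, i] w \<noteq> 0}"
    by (rule finite_subset[OF _ finite_UnI[OF finite_word(2)[of "[i, j]"] finite_word(1)[of ?k "[j, i]"]]]) auto
  then have "Phi (L_rel q i j) = word_op [i, j] - sc ?k * word_op [j, i] - sc ?d * word_op []"
    using Phi_diff[of "\<lambda>w. word [i, j] w - ?k * word [j, i] w" "\<lambda>w. ?d * word [] w"]
      Phi_diff[OF finite_word(2)[of "[i, j]"] finite_word(1)[of ?k "[j, i]"]] finite_word(1)[of ?d "[]"]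
    by (simp only: L_rel_def Phi_scale Phi_word)
  also have "\<dots> = x i * x j - sc ?k * (x j * x i) - sc ?d"
    by (simp add: word_op_simps)
  also have "\<dots> = 0"
  proof (cases "j = i + 1")
    case True
    then show ?thesis using x_rel_near[OF ij(2)] by simp
  next
    case False
    then have "x i * x j = sc ?k * (x j * x i)" using ij by (intro x_rel_far) auto
    then show ?thesis using False by simp
  qed
  finally show "f \<in> a_kernel (free_alg n) (L_ring n) Phi"
    using subsetD[OF L_rels_closed f] ij(1) by (simp only: kernel_Phi_iff)
qed

text \<open>Modulo \<open>L_ideal n q\<close> every element is a combination of sorted words, and by
  \<open>Phi_sorted_inj\<close> no nonzero combination of these is killed.\<close>

lemma kernel_Phi: "a_kernel (free_alg n) (L_ring n) Phi = L_ideal n q"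
proof
  interpret I: alg_ideal n "L_ideal n q" by (rule alg_ideal.intro[OF ideal_L_ideal])
  \<comment> \<open>The coefficients come from solving \<open>L_rel q i j\<close> for the descending
    word \<open>[j, i]\<close>.\<close>
  interpret S: straightening n "L_ideal n q"
    "\<lambda>i j. inverse (if odd (j - i) then q else inverse q)"
    "\<lambda>i j. - inverse (if odd (j - i) then q else inverse q) * (if j = i + 1 then 1 - q else 0)"
  proof
    fix i j :: nat assume ij: "1 \<le> i" "i < j" "j \<le> n"
    let ?k = "if odd (j - i) then q else inverse q" and ?d = "if j = i + 1 then 1 - q else 0"
    have "(\<lambda>w. - inverse ?k * L_rel q i j w) \<in> L_ideal n q"
      by (rule I.I_scale[OF L_rel_in_L_ideal[OF ij]])
    moreover have "(\<lambda>w. - inverse ?k * L_rel q i j w) =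
        (\<lambda>w. word [j, i] w - (inverse ?k * word [i, j] w + - inverse ?k * ?d * word [] w))"
    proof
      fix w
      have scal: "- inverse k * (a - k * b - d * c) = b - (inverse k * a + - inverse k * d * c)" if "k \<noteq> 0" for k a b c d :: 'k
        using that by (simp add: field_simps)
      have "?k \<noteq> 0" using q_nz by simp
      then show "- inverse ?k * L_rel q i j w =
          word [j, i] w - (inverse ?k * word [i, j] w + - inverse ?k * ?d * word [] w)"
        unfolding L_rel_def by (rule scal)
    qed
    ultimately show "I.eqv (word [j, i]) (\<lambda>w. inverse ?k * word [i, j] w + - inverse ?k * ?d * word [] w)"
      unfolding I.eqv_def by simp
  qed
  show "L_ideal n q \<subseteq> a_kernel (free_alg n) (L_ring n) Phi" by (rule L_ideal_sub_kernel)
  show "a_kernel (free_alg n) (L_ring n) Phi \<subseteq> L_ideal n q"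
  proof
    fix f assume "f \<in> a_kernel (free_alg n) (L_ring n) Phi"
    then have f: "f \<in> carrier (free_alg n)" "Phi f = 0" by (simp_all only: kernel_Phi_iff)
    obtain g where g: "g \<in> wspan (sorted_words n)" "I.eqv f g" using S.straighten[OF f(1)] by blast
    have fin: "finite {w. f w \<noteq> 0}" "finite {w. g w \<noteq> 0}"
      using f(1) wspan_finite[OF g(1)] by (simp_all add: free_alg_carrier)
    have "(\<lambda>w. f w - g w) \<in> a_kernel (free_alg n) (L_ring n) Phi"
      using g(2) L_ideal_sub_kernel unfolding I.eqv_def by blast
    then have "Phi g = 0" using Phi_diff[OF fin] f(2) by (simp add: kernel_Phi_iff)
    then have "g = (\<lambda>w. 0)" by (rule Phi_sorted_inj[OF g(1)])
    then show "f \<in> L_ideal n q" using g(2) by (simp add: I.eqv_def)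
  qed
qed

section \<open>Transport to the presented algebra\<close>

text \<open>The isomorphism induced on the quotient: \<open>Phi\<close> is constant on each coset of
  its kernel, and \<open>the_elem\<close> extracts that value.\<close>

definition Psi :: "(nat list \<Rightarrow> 'k) set \<Rightarrow> (expo, 'k) lin_op" where
  "Psi X = the_elem (Phi ` X)"

lemma Psi_iso: "Psi \<in> ring_iso (L_alg n q) (L_ring n)"
proof -
  interpret h: ring_hom_ring "free_alg n" "L_ring n" Phi by (rule Phi_ring_hom)
  show ?thesis
    using h.FactRing_iso_set Phi_surj[of n] by (simp add: kernel_Phi L_alg_def Psi_def[abs_def])
qed

lemma Psi_coset:
  assumes "f \<in> carrier (free_alg n)"
  shows "L_ideal n q +>\<^bsub>free_alg n\<^esub> f \<in> carrier (L_alg n q)" "Psi (L_ideal n q +>\<^bsub>free_alg n\<^esub> f) = Phi f"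
proof -
  interpret h: ring_hom_ring "free_alg n" "L_ring n" Phi by (rule Phi_ring_hom)
  show "Psi (L_ideal n q +>\<^bsub>free_alg n\<^esub> f) = Phi f"
    using h.the_elem_simp[OF assms] by (simp add: kernel_Phi Psi_def)
  show "L_ideal n q +>\<^bsub>free_alg n\<^esub> f \<in> carrier (L_alg n q)"
    using assms by (auto simp: L_alg_def FactRing_def A_RCOSETS_def')
qed

abbreviation LA :: "nat \<Rightarrow> (nat list \<Rightarrow> 'k) set set" where
  "LA n \<equiv> carrier (L_alg n q)"

lemma Psi_hom:
  assumes "a \<in> LA n" "b \<in> LA n"
  shows "Psi (a \<otimes>\<^bsub>L_alg n q\<^esub> b) = Psi a * Psi b" "Psi (a \<oplus>\<^bsub>L_alg n q\<^esub> b) = Psi a + Psi b"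
    "Psi (a \<ominus>\<^bsub>L_alg n q\<^esub> b) = Psi a - Psi b"
proof -
  interpret A: ring "L_alg n q" by (rule ring_L_alg)
  have h: "Psi \<in> ring_hom (L_alg n q) (L_ring n)" using Psi_iso[of n] by (simp add: ring_iso_def)
  show "Psi (a \<otimes>\<^bsub>L_alg n q\<^esub> b) = Psi a * Psi b" using ring_hom_mult[OF h assms] by simp
  have add: "Psi (c \<oplus>\<^bsub>L_alg n q\<^esub> d) = Psi c + Psi d" if "c \<in> LA n" "d \<in> LA n" for c d
    using ring_hom_add[OF h that] by simp
  show "Psi (a \<oplus>\<^bsub>L_alg n q\<^esub> b) = Psi a + Psi b" by (rule add[OF assms])
  have "(a \<ominus>\<^bsub>L_alg n q\<^esub> b) \<oplus>\<^bsub>L_alg n q\<^esub> b = a"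
    using assms by (simp add: A.minus_eq A.a_assoc A.l_neg)
  then show "Psi (a \<ominus>\<^bsub>L_alg n q\<^esub> b) = Psi a - Psi b"
    using add[OF A.minus_closed[OF assms] assms(2)] by simp
qed

lemma Psi_one_zero: "Psi \<one>\<^bsub>L_alg n q\<^esub> = 1" "Psi \<zero>\<^bsub>L_alg n q\<^esub> = 0"
proof -
  interpret A: ring "L_alg n q" by (rule ring_L_alg)
  have h: "Psi \<in> ring_hom (L_alg n q) (L_ring n)" using Psi_iso[of n] by (simp add: ring_iso_def)
  show "Psi \<one>\<^bsub>L_alg n q\<^esub> = 1" using ring_hom_one[OF h] by simp
  show "Psi \<zero>\<^bsub>L_alg n q\<^esub> = 0" using Psi_hom(2)[OF A.zero_closed A.zero_closed] by simp
qed

lemma Psi_bij: "inj_on Psi (LA n)" "Psi ` LA n = L n"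
  using Psi_iso[of n] by (auto simp: ring_iso_def bij_betw_def)

lemma Psi_mem: "P \<subseteq> LA n \<Longrightarrow> a \<in> LA n \<Longrightarrow> Psi a \<in> Psi ` P \<longleftrightarrow> a \<in> P"
  using inj_on_image_mem_iff[OF Psi_bij(1)] by blast

lemma Psi_z: "i \<le> n \<Longrightarrow> L_z n q i \<in> LA n \<and> Psi (L_z n q i) = z i"
proof (induction i rule: less_induct)
  case (less i)
  interpret A: ring "L_alg n q" by (rule ring_L_alg)
  have var: "L_var n q j \<in> LA n" "Psi (L_var n q j) = x j" if "1 \<le> j" "j \<le> n" for j
    using Psi_coset[OF free_var_closed[OF that]] by (simp_all add: L_var_def Phi_gens)
  consider "i = 0" | "i = Suc 0" | j where "i = Suc (Suc j)" by (metis not0_implies_Suc)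
  then show ?case
  proof cases
    case 1
    then show ?thesis by (simp add: Psi_one_zero)
  next
    case 2
    then show ?thesis using var[of 1] less(2) z_Suc[of 0] by (simp add: Psi_hom Psi_one_zero)
  next
    case (3 j)
    then show ?thesis
      using var[of i] less(1)[of j] less(1)[of "Suc j"] less(2) z_Suc[of "Suc j"] by (simp add: Psi_hom)
  qed
qed

lemma Psi_const: "L_const n q c \<in> LA n" "Psi (L_const n q c) = sc c"
  using Psi_coset[OF free_const_closed] by (simp_all add: L_const_def Phi_gens)

lemma Psi_ideal_iff:
  assumes "P \<subseteq> LA n"
  shows "ideal P (L_alg n q) \<longleftrightarrow> ideal_in_L n (Psi ` P)"
proof -
  interpret A: ring "L_alg n q" by (rule ring_L_alg)
  have c: "a \<in> LA n" if "a \<in> P" for a using assms that by blast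
  have m: "Psi a * Psi b \<in> Psi ` P \<longleftrightarrow> a \<otimes>\<^bsub>L_alg n q\<^esub> b \<in> P"
    if "a \<in> LA n" "b \<in> LA n" for a b
    using Psi_mem[OF assms A.m_closed[OF that]] Psi_hom(1)[OF that] by simp
  have a: "Psi a + Psi b \<in> Psi ` P \<longleftrightarrow> a \<oplus>\<^bsub>L_alg n q\<^esub> b \<in> P"
    if "a \<in> LA n" "b \<in> LA n" for a b
    using Psi_mem[OF assms A.a_closed[OF that]] Psi_hom(2)[OF that] by simp
  have z: "0 \<in> Psi ` P \<longleftrightarrow> \<zero>\<^bsub>L_alg n q\<^esub> \<in> P"
    using Psi_mem[OF assms A.zero_closed] Psi_one_zero(2)[of n] by simp
  show ?thesis
    unfolding A.ideal_iff_closed ideal_in_L_def Psi_bij(2)[symmetric] using assms c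
    by (auto simp: m a z simp del: image_iff)
qed

lemma Psi_prime_iff:
  assumes "P \<subseteq> LA n"
  shows "nc_prime_ideal P (L_alg n q) \<longleftrightarrow> primeL n (Psi ` P)"
proof -
  interpret A: ring "L_alg n q" by (rule ring_L_alg)
  have m: "Psi a * Psi r * Psi b \<in> Psi ` P \<longleftrightarrow> a \<otimes>\<^bsub>L_alg n q\<^esub> r \<otimes>\<^bsub>L_alg n q\<^esub> b \<in> P"
    if "a \<in> LA n" "r \<in> LA n" "b \<in> LA n" for a r b
    using Psi_mem[OF assms A.m_closed[OF A.m_closed[OF that(1,2)] that(3)]]
      Psi_hom(1)[OF A.m_closed[OF that(1,2)] that(3)] Psi_hom(1)[OF that(1,2)] by simp
  have one: "1 \<in> Psi ` P \<longleftrightarrow> \<one>\<^bsub>L_alg n q\<^esub> \<in> P"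
    using Psi_mem[OF assms A.one_closed] Psi_one_zero(1)[of n] by simp
  have "P \<noteq> LA n \<longleftrightarrow> \<one>\<^bsub>L_alg n q\<^esub> \<notin> P" if "ideal P (L_alg n q)"
    using ideal.one_imp_carrier[OF that] A.one_closed by blast
  then show ?thesis
    unfolding A.nc_prime_ideal_iff primeL_def Psi_ideal_iff[OF assms, symmetric] Psi_bij(2)[symmetric]
    using one by (auto simp: m Psi_mem[OF assms] simp del: image_iff)
qed

lemma Psi_l_coset:
  assumes "a \<in> LA n"
  shows "a <#\<^bsub>L_alg n q\<^esub> LA n \<subseteq> LA n"
    and "Psi ` (a <#\<^bsub>L_alg n q\<^esub> LA n) = (*) (Psi a) ` L n"
proof -
  interpret A: ring "L_alg n q" by (rule ring_L_alg)
  show "a <#\<^bsub>L_alg n q\<^esub> LA n \<subseteq> LA n"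
    using assms by (auto simp: l_coset_def)
  show "Psi ` (a <#\<^bsub>L_alg n q\<^esub> LA n) = (*) (Psi a) ` L n"
    using assms unfolding Psi_bij(2)[symmetric] l_coset_def by (auto simp: Psi_hom image_iff)
qed

lemma Psi_set_add:
  assumes "H \<subseteq> LA n" "K \<subseteq> LA n"
  shows "H <+>\<^bsub>L_alg n q\<^esub> K \<subseteq> LA n"
    and "Psi ` (H <+>\<^bsub>L_alg n q\<^esub> K) = {a + b | a b. a \<in> Psi ` H \<and> b \<in> Psi ` K}"
proof -
  interpret A: ring "L_alg n q" by (rule ring_L_alg)
  show "H <+>\<^bsub>L_alg n q\<^esub> K \<subseteq> LA n"
    using assms by (auto simp: set_add_def')
  have "Psi ` (H <+>\<^bsub>L_alg n q\<^esub> K) = {Psi (a \<oplus>\<^bsub>L_alg n q\<^esub> b) | a b. a \<in> H \<and> b \<in> K}"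
    by (auto simp: set_add_def')
  also have "\<dots> = {Psi a + Psi b | a b. a \<in> H \<and> b \<in> K}"
  proof -
    have "Psi (a \<oplus>\<^bsub>L_alg n q\<^esub> b) = Psi a + Psi b" if "a \<in> H" "b \<in> K" for a b
      using that assms by (intro Psi_hom) auto
    then show ?thesis by (intro Collect_cong ex_cong1 rev_conj_cong refl) auto
  qed
  also have "\<dots> = {a + b | a b. a \<in> Psi ` H \<and> b \<in> Psi ` K}" by blast
  finally show "Psi ` (H <+>\<^bsub>L_alg n q\<^esub> K) = \<dots>" .
qed

lemma Psi_image_eq_iff:
  "P \<subseteq> LA n \<Longrightarrow> R \<subseteq> LA n \<Longrightarrow> Psi ` P = Psi ` R \<longleftrightarrow> P = R"
  by (rule inj_on_image_eq_iff[OF Psi_bij(1)])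

lemma nc_prime_subset: "nc_prime_ideal P (L_alg n q) \<Longrightarrow> P \<subseteq> LA n"
  unfolding nc_prime_ideal_def
  using additive_subgroup.a_subset ideal.axioms(1) by blast

lemma Psi_zero_ideal: "{\<zero>\<^bsub>L_alg n q\<^esub>} \<subseteq> LA n" "Psi ` {\<zero>\<^bsub>L_alg n q\<^esub>} = {0}"
  using ring.ring_simprules(2)[OF ring_L_alg] by (auto simp: Psi_one_zero)

lemma Psi_u:
  assumes "m \<le> n"
  shows "L_z n q m \<ominus>\<^bsub>L_alg n q\<^esub> L_const n q c \<in> LA n"
    and "Psi (L_z n q m \<ominus>\<^bsub>L_alg n q\<^esub> L_const n q c) = u m c"
  using Psi_z[OF assms] Psi_const[of n c] ring.ring_simprules(4)[OF ring_L_alg]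
  by (auto simp: Psi_hom u_def intro: abelian_group.minus_closed[OF ring.is_abelian_group[OF ring_L_alg]])

end

section \<open>The two cases of the theorem in the presented algebra\<close>

context generic_qtorus
begin

lemma odd_prime_ideals:
  assumes n: "odd n" "3 \<le> n" and alg: "\<And>p :: 'k poly. 0 < degree p \<Longrightarrow> \<exists>c. poly p c = 0"
  shows "{P. nc_prime_ideal P (L_alg n q)} = {{\<zero>\<^bsub>L_alg n q\<^esub>}} \<union>
    {(L_z n q n \<ominus>\<^bsub>L_alg n q\<^esub> L_const n q c) <#\<^bsub>L_alg n q\<^esub> LA n | c. True}"
    (is "_ = {?Z} \<union> {?M c | c. True}")
proof -
  have M: "?M c \<subseteq> LA n" "Psi ` ?M c = (*) (u n c) ` L n" for c
    using Psi_l_coset[OF Psi_u(1)[OF order_refl]] Psi_u(2)[OF order_refl] by simp_all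
  \<comment> \<open>Subsets of the carrier may be compared through their images, since
    \<open>Psi\<close> is injective there; any other set belongs to neither side.\<close>
  have key: "nc_prime_ideal P (L_alg n q) \<longleftrightarrow> P = ?Z \<or> (\<exists>c. P = ?M c)" if P: "P \<subseteq> LA n" for P
  proof -
    have "nc_prime_ideal P (L_alg n q) \<longleftrightarrow> Psi ` P = Psi ` ?Z \<or> (\<exists>c. Psi ` P = Psi ` ?M c)"
      unfolding M(2) Psi_zero_ideal(2) Psi_prime_iff[OF P] by (rule odd_primes[OF n alg])
    then show ?thesis
      by (simp only: Psi_image_eq_iff[OF P M(1)] Psi_image_eq_iff[OF P Psi_zero_ideal(1)])
  qed
  show ?thesis
  proof (rule Set.set_eqI)
    fix P
    show "P \<in> {P. nc_prime_ideal P (L_alg n q)} \<longleftrightarrow> P \<in> {?Z} \<union> {?M c | c. True}"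
    proof (cases "P \<subseteq> LA n")
      case True
      then show ?thesis using key[OF True] by auto
    next
      case False
      then show ?thesis using nc_prime_subset[of P n] M(1) Psi_zero_ideal(1)[of n] by auto
    qed
  qed
qed

lemma even_prime_ideals:
  assumes n: "even n" "3 \<le> n" and alg: "\<And>p :: 'k poly. 0 < degree p \<Longrightarrow> \<exists>c. poly p c = 0"
  shows "{P. nc_prime_ideal P (L_alg n q)} =
    {{\<zero>\<^bsub>L_alg n q\<^esub>}, L_z n q n <#\<^bsub>L_alg n q\<^esub> LA n} \<union>
    {((L_z n q (n - 1) \<ominus>\<^bsub>L_alg n q\<^esub> L_const n q c) <#\<^bsub>L_alg n q\<^esub> LA n)
       <+>\<^bsub>L_alg n q\<^esub> (L_z n q n <#\<^bsub>L_alg n q\<^esub> LA n) | c. c \<noteq> 0}"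
    (is "_ = {?Z, ?N} \<union> {?M c | c. c \<noteq> 0}")
proof -
  have N: "?N \<subseteq> LA n" "Psi ` ?N = (*) (z n) ` L n"
    using Psi_l_coset[of "L_z n q n" n] Psi_z[of n n] by simp_all
  have U: "(L_z n q (n - 1) \<ominus>\<^bsub>L_alg n q\<^esub> L_const n q c) <#\<^bsub>L_alg n q\<^esub> LA n \<subseteq> LA n"
    "Psi ` ((L_z n q (n - 1) \<ominus>\<^bsub>L_alg n q\<^esub> L_const n q c) <#\<^bsub>L_alg n q\<^esub> LA n) = (*) (u (n - 1) c) ` L n" for c
    using Psi_l_coset[OF Psi_u(1)] Psi_u(2) by simp_all
  have M: "?M c \<subseteq> LA n" "Psi ` ?M c = pair_ideal n c" for c
  proof -
    show "?M c \<subseteq> LA n" by (rule Psi_set_add(1)[OF U(1) N(1)])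
    have "Psi ` ?M c = {a + b | a b. a \<in> (*) (u (n - 1) c) ` L n \<and> b \<in> (*) (z n) ` L n}"
      by (simp only: Psi_set_add(2)[OF U(1) N(1)] U(2) N(2))
    also have "\<dots> = pair_ideal n c" unfolding pair_ideal_def by blast
    finally show "Psi ` ?M c = pair_ideal n c" .
  qed
  have key: "nc_prime_ideal P (L_alg n q) \<longleftrightarrow> P = ?Z \<or> P = ?N \<or> (\<exists>c. c \<noteq> 0 \<and> P = ?M c)" if P: "P \<subseteq> LA n" for P
  proof -
    have "nc_prime_ideal P (L_alg n q) \<longleftrightarrow> Psi ` P = Psi ` ?Z \<or> Psi ` P = Psi ` ?N \<or> (\<exists>c. c \<noteq> 0 \<and> Psi ` P = Psi ` ?M c)"
      unfolding M(2) N(2) Psi_zero_ideal(2) Psi_prime_iff[OF P] by (rule even_primes[OF n alg])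
    then show ?thesis
      by (simp only: Psi_image_eq_iff[OF P M(1)] Psi_image_eq_iff[OF P N(1)] Psi_image_eq_iff[OF P Psi_zero_ideal(1)])
  qed
  show ?thesis
  proof (rule Set.set_eqI)
    fix P
    show "P \<in> {P. nc_prime_ideal P (L_alg n q)} \<longleftrightarrow> P \<in> {?Z, ?N} \<union> {?M c | c. c \<noteq> 0}"
    proof (cases "P \<subseteq> LA n")
      case True
      then show ?thesis using key[OF True] by auto
    next
      case False
      then show ?thesis using nc_prime_subset[of P n] M(1) N(1) Psi_zero_ideal(1)[of n] by auto
    qed
  qed
qed

end

theorem theorem3p13:
  fixes n :: nat and q :: "'k::alg_closed_field"
  assumes "n \<ge> 3" and "q \<noteq> 0" and "\<forall>m>0. q ^ m \<noteq> 1"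
  shows "(odd n \<longrightarrow>
      {P. nc_prime_ideal P (L_alg n q)} =
        {{\<zero>\<^bsub>L_alg n q\<^esub>}} \<union>
        {(L_z n q n \<ominus>\<^bsub>L_alg n q\<^esub> L_const n q c) <#\<^bsub>L_alg n q\<^esub> carrier (L_alg n q) | c. True})
    \<and> (even n \<longrightarrow>
      {P. nc_prime_ideal P (L_alg n q)} =
        {{\<zero>\<^bsub>L_alg n q\<^esub>}, L_z n q n <#\<^bsub>L_alg n q\<^esub> carrier (L_alg n q)} \<union>
        {((L_z n q (n - 1) \<ominus>\<^bsub>L_alg n q\<^esub> L_const n q c) <#\<^bsub>L_alg n q\<^esub> carrier (L_alg n q))
           <+>\<^bsub>L_alg n q\<^esub> (L_z n q n <#\<^bsub>L_alg n q\<^esub> carrier (L_alg n q)) | c. c \<noteq> 0})"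
proof -
  interpret generic_qtorus q using assms by unfold_locales auto
  show ?thesis
    by (intro conjI impI odd_prime_ideals even_prime_ideals assms(1) alg_closed_imp_poly_has_root)
qed

end
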